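(* Let $\{p:(L,h)\to(M,g_M),\ I\}$ be horizontal data with $I=[0,\varepsilon)$ for some $\varepsilon>0$, and assume there exist real-analytic functions $\sigma_1$ and $\sigma_2$ on $I$, and distinct momentum profiles $\varphi_1$ and $\varphi_2$ on $I$, with $\varphi_1(0)=\varphi_2(0)$ and inducing bundle-adapted metrics of scalar curvature $\sigma_1(\tau)$ and $\sigma_2(\tau)$, respectively. Then the horizontal data are $\sigma$-constant.
   Context: Conventions: a Kähler metric with local components $g_{i\bar\jmath}$ has Kähler form $\omega=\frac{\sqrt{-1}}2\sum g_{i\bar\jmath}\,dz^i\wedge d\bar z^j$ and Ricci form $\rho=-\sqrt{-1}\,\partial\bar\partial\log\det(g_{i\bar\jmath})$. Its scalar curvature is the trace of the endomorphism $\omega^{-1}\rho$ of $T^{1,0}$. $p:(L,h)\to(M,g_M)$ is an Hermitian holomorphic line bundle over a Kähler manifold with Kähler form $\omega_M$. Its curvature form is $\gamma=-\sqrt{-1}\,\partial\bar\partial\log h$, where $h$ also denotes the local function such that the squared norm on $L$ is $r=|z^0|^2h(z)$, $z^0$ being a linear fibre coordinate. Horizontal data $\{p:(L,h)\to(M,g_M),I\}$ consist of such a bundle together with an interval $I\subset\mathbf R$ such that $\omega_M(\tau):=\omega_M-\tau\gamma$ is positive for every $\tau\in I$; the corresponding metric is $g_M(\tau)$. The data are $\sigma$-constant if (i) the curvature endomorphism $\omega_M^{-1}\gamma$ of $T^{1,0}M$ has constant eigenvalues on $M$, and (ii) $g_M(\tau)$ has constant scalar curvature for each $\tau\in I$.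 A momentum profile is a function $\varphi$ that is smooth on the closure of $I$ and positive on the interior of $I$. Metric induced by a profile: with $(a,b)$ the interior of $I$ and $\tau_0\in(a,b)$ fixed, set $t_1=\lim_{\tau\to a^+}\int_{\tau_0}^\tau dx/\varphi(x)$ and $t_2=\lim_{\tau\to b^-}\int_{\tau_0}^\tau dx/\varphi(x)$. Define $\mu(t)$ and $f(t)$ on $(t_1,t_2)$ by $t=\int_{\tau_0}^{\mu(t)}\frac{dx}{\varphi(x)}$ and $f(t)=\int_{\tau_0}^{\mu(t)}\frac{x\,dx}{\varphi(x)}$. With $t=\frac12\log r$ on $L$ minus its zero section, the induced bundle-adapted metric is the Kähler metric on $\{t_1<t<t_2\}$ with Kähler form $p^*\omega_M+2\sqrt{-1}\,\partial\bar\partial f(t)$. A function of $\tau$ is regarded as a function on this domain via $\tau=\mu(t)$. *)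

theory Defs
  imports "HOL-Analysis.Analysis" "HOL-Computational_Algebra.Polynomial"
begin

section \<open>Smooth and holomorphic functions\<close>

text \<open>Continuous differentiability of order k on an open set.\<close>

primrec Ck_on :: "nat \<Rightarrow> ('a::real_normed_vector \<Rightarrow> 'b::real_normed_vector) \<Rightarrow> 'a set \<Rightarrow> bool"
  where
    "Ck_on 0 f S \<longleftrightarrow> continuous_on S f"
  | "Ck_on (Suc k) f S \<longleftrightarrow>
       (\<forall>x\<in>S. f differentiable (at x)) \<and>
       (\<forall>v. Ck_on k (\<lambda>x. frechet_derivative f (at x) v) S)"

definition smooth_fun_on :: "('a::real_normed_vector \<Rightarrow> 'b::real_normed_vector) \<Rightarrow> 'a set \<Rightarrow> bool"
  where "smooth_fun_on f S \<longleftrightarrow> (\<forall>k. Ck_on k f S)"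

text \<open>Complex Frechet differentiability on an open subset of complex n-space.\<close>

definition holo_fun_on :: "(complex^'n \<Rightarrow> complex) \<Rightarrow> (complex^'n) set \<Rightarrow> bool"
  where "holo_fun_on f S \<longleftrightarrow>
    (\<forall>z\<in>S. \<exists>a::complex^'n. (f has_derivative (\<lambda>v. \<Sum>i\<in>UNIV. a $ i * v $ i)) (at z))"

definition holo_map_on :: "(complex^'n \<Rightarrow> complex^'m) \<Rightarrow> (complex^'n) set \<Rightarrow> bool"
  where "holo_map_on F S \<longleftrightarrow> (\<forall>i. holo_fun_on (\<lambda>z. F z $ i) S)"

text \<open>The Wirtinger derivatives with respect to the k-th coordinate and its conjugate.\<close>

definition wirt :: "'n \<Rightarrow> (complex^'n \<Rightarrow> complex) \<Rightarrow> complex^'n \<Rightarrow> complex"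
  where "wirt k u z =
    (frechet_derivative u (at z) (axis k 1) - \<i> * frechet_derivative u (at z) (axis k \<i>)) / 2"

definition wirt_bar :: "'n \<Rightarrow> (complex^'n \<Rightarrow> complex) \<Rightarrow> complex^'n \<Rightarrow> complex"
  where "wirt_bar k u z =
    (frechet_derivative u (at z) (axis k 1) + \<i> * frechet_derivative u (at z) (axis k \<i>)) / 2"

text \<open>Functions of one real variable on an interval that may contain end points: all derivatives
  are one-sided there, so smoothness holds up to the boundary.\<close>

definition smooth_real_on :: "(real \<Rightarrow> real) \<Rightarrow> real set \<Rightarrow> bool"
  where "smooth_real_on f S \<longleftrightarrow>
    (\<exists>D :: nat \<Rightarrow> real \<Rightarrow> real. D 0 = f \<and>
      (\<forall>k. \<forall>x\<in>S. (D k has_real_derivative D (Suc k) x) (at x within S)))"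

definition real_analytic_fun_on :: "(real \<Rightarrow> real) \<Rightarrow> real set \<Rightarrow> bool"
  where "real_analytic_fun_on f S \<longleftrightarrow>
    (\<forall>x\<in>S. \<exists>a :: nat \<Rightarrow> real. \<exists>e>0. \<forall>y\<in>S. \<bar>y - x\<bar> < e \<longrightarrow> (\<lambda>n. a n * (y - x) ^ n) sums f y)"


section \<open>Complex manifolds and Kaehler metrics\<close>

text \<open>A chart is a pair of a domain and a coordinate map; only the values of the coordinate map on
  the domain matter.\<close>

type_synonym ('a, 'n) chart = "'a set \<times> ('a \<Rightarrow> complex^'n)"

definition chart_inv :: "('a, 'n) chart \<Rightarrow> complex^'n \<Rightarrow> 'a"
  where "chart_inv c = inv_into (fst c) (snd c)"

definition complex_manifold :: "'a topology \<Rightarrow> ('a, 'n::finite) chart set \<Rightarrow> bool"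
  where "complex_manifold X A \<longleftrightarrow>
    Hausdorff_space X \<and> second_countable X \<and>
    (\<forall>(U, \<phi>)\<in>A. openin X U \<and> open (\<phi> ` U) \<and>
       homeomorphic_map (subtopology X U) (top_of_set (\<phi> ` U)) \<phi>) \<and>
    (\<Union>c\<in>A. fst c) = topspace X \<and>
    (\<forall>c\<in>A. \<forall>c'\<in>A. holo_map_on (snd c' \<circ> chart_inv c) (snd c ` (fst c \<inter> fst c')))"

text \<open>A field of (1,1)-forms is given by its component matrices in the charts, as functions of the
  coordinates. Throughout, a component matrix G stands for the form
  (i/2) * (SUM i j. G $ i $ j dz^i /\ dzbar^j).\<close>

type_synonym ('a, 'n) form11 = "('a, 'n) chart \<Rightarrow> complex^'n \<Rightarrow> complex^'n^'n"

definition hermitian_mat :: "complex^'n^'n \<Rightarrow> bool"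
  where "hermitian_mat G \<longleftrightarrow> (\<forall>i j. G $ i $ j = cnj (G $ j $ i))"

definition pos_def_mat :: "complex^'n^'n \<Rightarrow> bool"
  where "pos_def_mat G \<longleftrightarrow> hermitian_mat G \<and>
    (\<forall>v. v \<noteq> 0 \<longrightarrow> 0 < Re (\<Sum>i\<in>UNIV. \<Sum>j\<in>UNIV. G $ i $ j * v $ i * cnj (v $ j)))"

definition positive_form :: "('a, 'n::finite) chart set \<Rightarrow> ('a, 'n) form11 \<Rightarrow> bool"
  where "positive_form A g \<longleftrightarrow> (\<forall>c\<in>A. \<forall>x\<in>fst c. pos_def_mat (g c (snd c x)))"

text \<open>The second conjunct is the transformation law under a change of coordinates with Jacobian J,
  the last one says that the form is closed.\<close>

definition kaehler_metric :: "('a, 'n::finite) chart set \<Rightarrow> ('a, 'n) form11 \<Rightarrow> bool"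
  where "kaehler_metric A g \<longleftrightarrow>
    (\<forall>c\<in>A. smooth_fun_on (g c) (snd c ` fst c)) \<and>
    (\<forall>c\<in>A. \<forall>c'\<in>A. \<forall>x\<in>fst c \<inter> fst c'.
       let J = matrix (frechet_derivative (snd c' \<circ> chart_inv c) (at (snd c x)))
       in g c (snd c x) = transpose J ** g c' (snd c' x) ** map_matrix cnj J) \<and>
    positive_form A g \<and>
    (\<forall>c\<in>A. \<forall>z\<in>snd c ` fst c. \<forall>i j k.
       wirt k (\<lambda>w. g c w $ i $ j) z = wirt i (\<lambda>w. g c w $ k $ j) z)"

text \<open>Components, in a chart c, of the form i * del delbar u of a real function u.\<close>

definition ddbar_form :: "('a, 'n::finite) chart \<Rightarrow> ('a \<Rightarrow> real) \<Rightarrow> complex^'n \<Rightarrow> complex^'n^'n"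
  where "ddbar_form c u z =
    (\<chi> i j. 2 * wirt i (wirt_bar j (\<lambda>w. complex_of_real (u (chart_inv c w)))) z)"

text \<open>Components of the Ricci form - i * del delbar (log det G); the determinant of a positive
  definite Hermitian matrix is real and positive.\<close>

definition ricci_form :: "(complex^'n \<Rightarrow> complex^'n^'n) \<Rightarrow> complex^'n \<Rightarrow> complex^'n^'n"
  where "ricci_form G z =
    (\<chi> i j. - 2 * wirt i (wirt_bar j (\<lambda>w. complex_of_real (ln (Re (det (G w)))))) z)"

text \<open>Matrix, with respect to the coordinate frame of the holomorphic tangent bundle, of the
  endomorphism E with R(X, Ybar) = G(E X, Ybar), that is, of the quotient of the form R by the
  metric form G.\<close>

definition form_endo :: "complex^'n^'n \<Rightarrow> complex^'n^'n \<Rightarrow> complex^'n^'n"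
  where "form_endo G R = transpose (R ** matrix_inv G)"

definition scalar_curvature :: "(complex^'n \<Rightarrow> complex^'n^'n) \<Rightarrow> complex^'n \<Rightarrow> complex"
  where "scalar_curvature G z = trace (form_endo (G z) (ricci_form G z))"


section \<open>Hermitian holomorphic line bundles\<close>

text \<open>A local trivialization is a pair of an open subset V of the base and a fibre coordinate on the
  part of the total space over V. The line bundle has total space L and projection p; the topology,
  the complex structure and the linear structure of the fibres are those transported by the
  trivializations, whose transition functions are holomorphic and nowhere zero.\<close>

type_synonym ('a, 'b) triv = "'a set \<times> ('b \<Rightarrow> complex)"

definition holo_line_bundle ::
  "'a topology \<Rightarrow> ('a, 'n::finite) chart set \<Rightarrow> 'b set \<Rightarrow> ('b \<Rightarrow> 'a) \<Rightarrow> ('a, 'b) triv set \<Rightarrow> bool"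
  where "holo_line_bundle X A L p T \<longleftrightarrow>
    p ` L \<subseteq> topspace X \<and>
    (\<Union>s\<in>T. fst s) = topspace X \<and>
    (\<forall>(V, \<zeta>)\<in>T. openin X V \<and> bij_betw (\<lambda>v. (p v, \<zeta> v)) {v\<in>L. p v \<in> V} (V \<times> UNIV)) \<and>
    (\<forall>(V, \<zeta>)\<in>T. \<forall>(V', \<zeta>')\<in>T. \<exists>q :: 'a \<Rightarrow> complex.
       (\<forall>x\<in>V \<inter> V'. q x \<noteq> 0) \<and>
       (\<forall>c\<in>A. holo_fun_on (q \<circ> chart_inv c) (snd c ` (fst c \<inter> (V \<inter> V')))) \<and>
       (\<forall>v\<in>L. p v \<in> V \<inter> V' \<longrightarrow> \<zeta>' v = q (p v) * \<zeta> v))"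

text \<open>The Hermitian structure is given by its squared norm function r on the total space. Its local
  function over a trivialization is the squared norm of the unit section.\<close>

definition local_weight :: "'b set \<Rightarrow> ('b \<Rightarrow> 'a) \<Rightarrow> ('b \<Rightarrow> real) \<Rightarrow> ('a, 'b) triv \<Rightarrow> 'a \<Rightarrow> real"
  where "local_weight L p r s x = r (THE v. v \<in> L \<and> p v = x \<and> snd s v = 1)"

definition hermitian_norm_sq ::
  "('a, 'n::finite) chart set \<Rightarrow> 'b set \<Rightarrow> ('b \<Rightarrow> 'a) \<Rightarrow> ('a, 'b) triv set \<Rightarrow> ('b \<Rightarrow> real) \<Rightarrow> bool"
  where "hermitian_norm_sq A L p T r \<longleftrightarrow>
    (\<forall>s\<in>T.
       (\<forall>v\<in>L. p v \<in> fst s \<longrightarrow> r v = (cmod (snd s v))\<^sup>2 * local_weight L p r s (p v)) \<and>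
       (\<forall>x\<in>fst s. 0 < local_weight L p r s x) \<and>
       (\<forall>c\<in>A. smooth_fun_on (local_weight L p r s \<circ> chart_inv c) (snd c ` (fst c \<inter> fst s))))"

text \<open>The curvature form - i * del delbar (log h). It does not depend on the trivialization, as the
  local functions of two trivializations differ by the squared modulus of a nowhere vanishing
  holomorphic function; at each point any trivialization around that point may be used.\<close>

definition curvature_form ::
  "'b set \<Rightarrow> ('b \<Rightarrow> 'a) \<Rightarrow> ('a, 'b) triv set \<Rightarrow> ('b \<Rightarrow> real) \<Rightarrow> ('a, 'n::finite) form11"
  where "curvature_form L p T r c z =
    (let s = (SOME s. s \<in> T \<and> chart_inv c z \<in> fst s)
     in - ddbar_form c (\<lambda>x. ln (local_weight L p r s x)) z)"


section \<open>Horizontal data\<close>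

definition base_metric ::
  "('a, 'n::finite) form11 \<Rightarrow> 'b set \<Rightarrow> ('b \<Rightarrow> 'a) \<Rightarrow> ('a, 'b) triv set \<Rightarrow> ('b \<Rightarrow> real) \<Rightarrow> real \<Rightarrow>
   ('a, 'n) form11"
  where "base_metric g L p T r \<tau> c z = g c z - \<tau> *\<^sub>R curvature_form L p T r c z"

definition horizontal_data ::
  "'a topology \<Rightarrow> ('a, 'n::finite) chart set \<Rightarrow> ('a, 'n) form11 \<Rightarrow>
   'b set \<Rightarrow> ('b \<Rightarrow> 'a) \<Rightarrow> ('a, 'b) triv set \<Rightarrow> ('b \<Rightarrow> real) \<Rightarrow> real set \<Rightarrow> bool"
  where "horizontal_data X A g L p T r I \<longleftrightarrow>
    complex_manifold X A \<and> kaehler_metric A g \<and>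
    holo_line_bundle X A L p T \<and> hermitian_norm_sq A L p T r \<and>
    is_interval I \<and> (\<forall>\<tau>\<in>I. positive_form A (base_metric g L p T r \<tau>))"

definition mat_eigenvalue :: "complex^'n^'n \<Rightarrow> complex \<Rightarrow> bool"
  where "mat_eigenvalue E l \<longleftrightarrow> (\<exists>v. v \<noteq> 0 \<and> E *v v = l *s v)"

definition mat_char_poly :: "complex^'n^'n \<Rightarrow> complex poly"
  where "mat_char_poly E = det (\<chi> i j. (if i = j then [:0, 1:] else 0) - [:E $ i $ j:])"

text \<open>The eigenvalues are constant, together with their (algebraic) multiplicities.\<close>

definition sigma_constant ::
  "('a, 'n::finite) chart set \<Rightarrow> ('a, 'n) form11 \<Rightarrow>
   'b set \<Rightarrow> ('b \<Rightarrow> 'a) \<Rightarrow> ('a, 'b) triv set \<Rightarrow> ('b \<Rightarrow> real) \<Rightarrow> real set \<Rightarrow> bool"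
  where "sigma_constant A g L p T r I \<longleftrightarrow>
    (let E = (\<lambda>c x. form_endo (g c (snd c x)) (curvature_form L p T r c (snd c x)))
     in \<forall>c\<in>A. \<forall>c'\<in>A. \<forall>x\<in>fst c. \<forall>x'\<in>fst c'. \<forall>l.
          (mat_eigenvalue (E c x) l \<longleftrightarrow> mat_eigenvalue (E c' x') l) \<and>
          order l (mat_char_poly (E c x)) = order l (mat_char_poly (E c' x'))) \<and>
    (\<forall>\<tau>\<in>I. \<exists>k::real. \<forall>c\<in>A. \<forall>x\<in>fst c.
       scalar_curvature (base_metric g L p T r \<tau> c) (snd c x) = complex_of_real k)"


section \<open>Momentum profiles and induced metrics\<close>

definition momentum_profile :: "(real \<Rightarrow> real) \<Rightarrow> real set \<Rightarrow> bool"
  where "momentum_profile \<phi> I \<longleftrightarrow>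
    smooth_real_on \<phi> (closure I) \<and> (\<forall>\<tau>\<in>interior I. 0 < \<phi> \<tau>)"

text \<open>In the following, the interior of the momentum interval is {a<..<b}.\<close>

definition profile_time :: "(real \<Rightarrow> real) \<Rightarrow> real \<Rightarrow> real \<Rightarrow> real"
  where "profile_time \<phi> \<tau>0 \<tau> = (LBINT x=ereal \<tau>0..ereal \<tau>. 1 / \<phi> x)"

definition time_lower :: "real \<Rightarrow> (real \<Rightarrow> real) \<Rightarrow> real \<Rightarrow> ereal"
  where "time_lower a \<phi> \<tau>0 = Lim (at_right a) (\<lambda>\<tau>. ereal (profile_time \<phi> \<tau>0 \<tau>))"

definition time_upper :: "real \<Rightarrow> (real \<Rightarrow> real) \<Rightarrow> real \<Rightarrow> ereal"
  where "time_upper b \<phi> \<tau>0 = Lim (at_left b) (\<lambda>\<tau>. ereal (profile_time \<phi> \<tau>0 \<tau>))"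

definition momentum :: "real \<Rightarrow> real \<Rightarrow> (real \<Rightarrow> real) \<Rightarrow> real \<Rightarrow> real \<Rightarrow> real"
  where "momentum a b \<phi> \<tau>0 t = (THE \<tau>. \<tau> \<in> {a<..<b} \<and> t = profile_time \<phi> \<tau>0 \<tau>)"

definition potential :: "real \<Rightarrow> real \<Rightarrow> (real \<Rightarrow> real) \<Rightarrow> real \<Rightarrow> real \<Rightarrow> real"
  where "potential a b \<phi> \<tau>0 t = (LBINT x=ereal \<tau>0..ereal (momentum a b \<phi> \<tau>0 t). x / \<phi> x)"

text \<open>Charts of the total space; the index None is the fibre direction.\<close>

definition total_chart ::
  "'b set \<Rightarrow> ('b \<Rightarrow> 'a) \<Rightarrow> ('a, 'n::finite) chart \<Rightarrow> ('a, 'b) triv \<Rightarrow> ('b, 'n option) chart"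
  where "total_chart L p c s =
    ({v\<in>L. p v \<in> fst c \<inter> fst s},
     \<lambda>v. \<chi> a. case a of None \<Rightarrow> snd s v | Some i \<Rightarrow> snd c (p v) $ i)"

definition log_norm :: "('b \<Rightarrow> real) \<Rightarrow> 'b \<Rightarrow> real"
  where "log_norm r v = ln (r v) / 2"

text \<open>The part of the total space, minus the zero section, where t1 < t < t2.\<close>

definition induced_domain ::
  "'b set \<Rightarrow> ('b \<Rightarrow> real) \<Rightarrow> real \<Rightarrow> real \<Rightarrow> (real \<Rightarrow> real) \<Rightarrow> real \<Rightarrow> 'b set"
  where "induced_domain L r a b \<phi> \<tau>0 =
    {v\<in>L. r v \<noteq> 0 \<and> time_lower a \<phi> \<tau>0 < ereal (log_norm r v) \<and>
          ereal (log_norm r v) < time_upper b \<phi> \<tau>0}"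

text \<open>Components, in the chart of the total space determined by c and s, of the sum of the pullback
  of the Kaehler form of g and of 2 * i * del delbar (f(t)).\<close>

definition induced_metric ::
  "('a, 'n::finite) form11 \<Rightarrow> 'b set \<Rightarrow> ('b \<Rightarrow> 'a) \<Rightarrow> ('b \<Rightarrow> real) \<Rightarrow>
   real \<Rightarrow> real \<Rightarrow> (real \<Rightarrow> real) \<Rightarrow> real \<Rightarrow> ('a, 'n) chart \<Rightarrow> ('a, 'b) triv \<Rightarrow>
   complex^('n option) \<Rightarrow> complex^('n option)^('n option)"
  where "induced_metric g L p r a b \<phi> \<tau>0 c s w =
    (\<chi> k l. case (k, l) of
        (Some i, Some j) \<Rightarrow> g c (\<chi> m. w $ Some m) $ i $ j
      | _ \<Rightarrow> 0)
    + 2 *\<^sub>R ddbar_form (total_chart L p c s) (\<lambda>v. potential a b \<phi> \<tau>0 (log_norm r v)) w"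

definition induces_scalar_curvature ::
  "('a, 'n::finite) chart set \<Rightarrow> ('a, 'n) form11 \<Rightarrow>
   'b set \<Rightarrow> ('b \<Rightarrow> 'a) \<Rightarrow> ('a, 'b) triv set \<Rightarrow> ('b \<Rightarrow> real) \<Rightarrow>
   real \<Rightarrow> real \<Rightarrow> (real \<Rightarrow> real) \<Rightarrow> real \<Rightarrow> (real \<Rightarrow> real) \<Rightarrow> bool"
  where "induces_scalar_curvature A g L p T r a b \<phi> \<tau>0 \<sigma> \<longleftrightarrow>
    (\<forall>c\<in>A. \<forall>s\<in>T. \<forall>v\<in>induced_domain L r a b \<phi> \<tau>0. p v \<in> fst c \<inter> fst s \<longrightarrow>
       scalar_curvature (induced_metric g L p r a b \<phi> \<tau>0 c s) (snd (total_chart L p c s) v)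
         = complex_of_real (\<sigma> (momentum a b \<phi> \<tau>0 (log_norm r v))))"

end

theory Submission
  imports Defs
begin

text \<open>At a point z of a chart put D(tau) = det(g - tau gamma), and let R(tau) be the scalar curvature of
  g - tau gamma at z. A frame adapted to the splitting of the tangent space of L into the fibre direction
  and the kernel of dt shows that the metric induced by phi has scalar curvature
  R - (phi D)'' / (2 D). The difference psi of the two profiles thus satisfies
  (psi D)'' / D = 2 (sigma2 - sigma1), whose right-hand side does not depend on z. If P and Q are the
  polynomials D at two points, then (psi P)'' Q = (psi Q)'' P says that (Q' P - Q P') psi^2 is
  constant in tau, and it vanishes at 0 because psi does. Since psi is nonzero on some interval, Q is a
  constant multiple of P. Hence the characteristic polynomial of the curvature endomorphism is constant
  on M, and so is R = sigma1 + (phi1 D)'' / (2 D) for tau > 0; the case tau = 0 follows by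
  continuity.\<close>

section \<open>Calculus of smooth functions\<close>

text \<open>Two facts carry the frame computation. The fibre component of dt is 1/(2 z0), so the
  determinant of the induced metric is phi D / |z0|^2; and the inverse metric does not mix the fibre
  direction with the horizontal ones. Since ln |z0|^2 is pluriharmonic, the Ricci form sees only ln
  (phi D). The same pluriharmonicity, for transition functions, makes gamma independent of the
  trivialization. Two profiles are compared because R is an unknown function of the point, which
  cancels in the difference. The step from D to the eigenvalues rests on det(x - E) = x^n D(1/x) /
  D(0) for x \<noteq> 0, where E is the curvature endomorphism: D up to a constant factor determines
  this polynomial. The end point tau = 0 needs an argument of its own, because on the domain of an
  induced metric the momentum only takes values in the open interval. Proportional determinants make
  the Ricci form of g - tau gamma independent of tau, so only the inverse of the metric has to be
  followed to the limit.\<close>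

lemma frechet_derivative_cong_open:
  assumes "open S" "x \<in> S" "\<And>y. y \<in> S \<Longrightarrow> f y = g y"
  shows "frechet_derivative f (at x) = frechet_derivative g (at x)"
proof -
  have "(f has_derivative D) (at x) \<longleftrightarrow> (g has_derivative D) (at x)" for D
    using assms by (metis has_derivative_transform_within_open)
  then show ?thesis unfolding frechet_derivative_def by simp
qed

lemma frechet_derivative_eqI:
  "(f has_derivative f') (at x) \<Longrightarrow> frechet_derivative f (at x) v = f' v"
  using frechet_derivative_at by metis

lemma differentiable_cong_open:
  assumes "open S" "x \<in> S" "\<And>y. y \<in> S \<Longrightarrow> f y = g y"
  shows "f differentiable (at x) \<longleftrightarrow> g differentiable (at x)"
  using assms unfolding differentiable_def by (metis has_derivative_transform_within_open)

text \<open>A Frechet derivative at a point sees a whole neighbourhood, so agreement on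
  \<open>S\<close> passes to the derivatives only because \<open>S\<close> is open. The closure
  rules below assume open sets for the same reason: they rewrite the derivative by its formula on
  \<open>S\<close> before the induction hypothesis applies.\<close>

lemma Ck_on_cong:
  assumes "open S" "\<And>y. y \<in> S \<Longrightarrow> f y = g y"
  shows "Ck_on k f S \<longleftrightarrow> Ck_on k g S"
  using assms(2)
proof (induction k arbitrary: f g)
  case 0
  then show ?case by (simp cong: continuous_on_cong_simp)
next
  case (Suc k)
  have "Ck_on k (\<lambda>x. frechet_derivative f (at x) v) S \<longleftrightarrow>
        Ck_on k (\<lambda>x. frechet_derivative g (at x) v) S" for v
    by (rule Suc.IH) (simp add: frechet_derivative_cong_open[OF assms(1) _ Suc.prems])
  then show ?case
    using differentiable_cong_open[OF assms(1) _ Suc.prems] by auto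
qed

lemma Ck_on_subset: "Ck_on k f S \<Longrightarrow> T \<subseteq> S \<Longrightarrow> Ck_on k f T"
  by (induction k arbitrary: f) (auto intro: continuous_on_subset)

text \<open>The successor clause of \<open>Ck_on\<close> does not literally contain order k. The
  product and chain rules need the descent, because undifferentiated factors appear there next to
  derivatives.\<close>

lemma Ck_on_Suc_imp: "Ck_on (Suc k) f S \<Longrightarrow> Ck_on k f S"
proof (induction k arbitrary: f)
  case 0
  then show ?case
    by (auto intro!: continuous_at_imp_continuous_on differentiable_imp_continuous_within)
qed auto

lemma Ck_on_const: "Ck_on k (\<lambda>x. c) S"
  by (induction k arbitrary: c) auto

lemma Ck_on_linear_image:
  assumes "bounded_linear l" "open S" "Ck_on k f S"
  shows "Ck_on k (\<lambda>x. l (f x)) S"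
  using assms(3)
proof (induction k arbitrary: f)
  case 0
  then show ?case using assms by (auto intro: bounded_linear.continuous_on)
next
  case (Suc k)
  have d: "((\<lambda>x. l (f x)) has_derivative (\<lambda>v. l (frechet_derivative f (at x) v))) (at x)"
    if "x \<in> S" for x
    using Suc.prems that assms(1)
    by (auto intro!: bounded_linear.has_derivative[OF assms(1)] simp: frechet_derivative_works[symmetric])
  have "Ck_on k (\<lambda>x. frechet_derivative (\<lambda>x. l (f x)) (at x) v) S" for v
    by (subst Ck_on_cong[OF assms(2) frechet_derivative_eqI[OF d]]) (use Suc in auto)
  then show ?case using d by (auto simp: differentiable_def)
qed

lemma Ck_on_ident: "Ck_on k (\<lambda>x. x) S"
proof (cases k)
  case (Suc n)
  then show ?thesis by (simp add: Ck_on_const)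
qed (auto simp: continuous_on_id)

lemma Ck_on_add:
  assumes "open S" "Ck_on k f S" "Ck_on k g S"
  shows "Ck_on k (\<lambda>x. f x + g x) S"
  using assms(2,3)
proof (induction k arbitrary: f g)
  case 0
  then show ?case by (auto intro: continuous_on_add)
next
  case (Suc k)
  have d: "((\<lambda>x. f x + g x) has_derivative
      (\<lambda>v. frechet_derivative f (at x) v + frechet_derivative g (at x) v)) (at x)"
    if "x \<in> S" for x
    using Suc.prems that
    by (auto intro!: has_derivative_add simp: frechet_derivative_works[symmetric])
  have "Ck_on k (\<lambda>x. frechet_derivative (\<lambda>x. f x + g x) (at x) v) S" for v
    by (subst Ck_on_cong[OF assms(1) frechet_derivative_eqI[OF d]]) (use Suc in auto)
  then show ?case using d by (auto simp: differentiable_def)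
qed

lemma Ck_on_sum:
  assumes "open S" "\<And>i. i \<in> I \<Longrightarrow> Ck_on k (f i) S"
  shows "Ck_on k (\<lambda>x. \<Sum>i\<in>I. f i x) S"
  using assms(2)
  by (induction I rule: infinite_finite_induct) (auto intro: Ck_on_const Ck_on_add[OF assms(1)])

lemma Ck_on_bilinear:
  assumes "bounded_bilinear b" "open S" "Ck_on k f S" "Ck_on k g S"
  shows "Ck_on k (\<lambda>x. b (f x) (g x)) S"
  using assms(3,4)
proof (induction k arbitrary: f g)
  case 0
  then show ?case using assms(1) by (auto intro: bounded_bilinear.continuous_on)
next
  case (Suc k)
  have d: "((\<lambda>x. b (f x) (g x)) has_derivative
      (\<lambda>v. b (f x) (frechet_derivative g (at x) v) + b (frechet_derivative f (at x) v) (g x))) (at x)"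
    if "x \<in> S" for x
    using Suc.prems that
    by (auto intro!: bounded_bilinear.FDERIV[OF assms(1)] simp: frechet_derivative_works[symmetric])
  have "Ck_on k (\<lambda>x. frechet_derivative (\<lambda>x. b (f x) (g x)) (at x) v) S" for v
    by (subst Ck_on_cong[OF assms(2) frechet_derivative_eqI[OF d]])
       (assumption, intro Ck_on_add[OF assms(2)] Suc.IH Suc.prems[THEN Ck_on_Suc_imp]
          Suc.prems[unfolded Ck_on.simps, THEN conjunct2, THEN spec])
  then show ?case using d by (auto simp: differentiable_def)
qed

text \<open>In the chain rule the derivative of \<open>f\<close> is taken in the direction of the
  derivative of \<open>g\<close>, which varies with the point, whereas \<open>Ck_on\<close> speaks
  of fixed directions only. Expanding that direction in a basis turns the derivative into a finite
  sum of products with fixed directions; hence the Euclidean intermediate space.\<close>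

lemma Ck_on_compose:
  fixes g :: "'a::real_normed_vector \<Rightarrow> 'b::euclidean_space"
  assumes "open S" "open T" "g ` S \<subseteq> T" "Ck_on k f T" "Ck_on k g S"
  shows "Ck_on k (\<lambda>x. f (g x)) S"
  using assms(4,5)
proof (induction k arbitrary: f)
  case 0
  then show ?case using assms(3) by (auto intro: continuous_on_compose2)
next
  case (Suc k)
  have d: "((\<lambda>x. f (g x)) has_derivative
      (\<lambda>v. frechet_derivative f (at (g x)) (frechet_derivative g (at x) v))) (at x)"
    if "x \<in> S" for x
    by (rule diff_chain_at[of g, unfolded o_def])
       (use Suc.prems that assms(3) in \<open>auto simp: frechet_derivative_works[symmetric]\<close>)
  have e: "frechet_derivative f (at (g x)) (frechet_derivative g (at x) v) =
     (\<Sum>i\<in>Basis. (frechet_derivative g (at x) v \<bullet> i) *\<^sub>R frechet_derivative f (at (g x)) i)"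
    if "x \<in> S" for x v
  proof -
    have l: "linear (frechet_derivative f (at (g x)))"
      using Suc.prems that assms(3) by (auto intro!: linear_frechet_derivative)
    show ?thesis
      by (subst euclidean_representation[symmetric, of "frechet_derivative g (at x) v"])
         (simp only: linear_sum[OF l] linear_cmul[OF l])
  qed
  have "Ck_on k (\<lambda>x. frechet_derivative (\<lambda>x. f (g x)) (at x) v) S" for v
  proof -
    have "Ck_on k (\<lambda>x. (frechet_derivative g (at x) v \<bullet> i) *\<^sub>R frechet_derivative f (at (g x)) i) S" for i
    proof (rule Ck_on_bilinear[OF bounded_bilinear_scaleR assms(1)])
      show "Ck_on k (\<lambda>x. frechet_derivative g (at x) v \<bullet> i) S"
        by (rule Ck_on_linear_image[OF bounded_linear_inner_left assms(1)]) (use Suc.prems(2) in simp)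
      show "Ck_on k (\<lambda>x. frechet_derivative f (at (g x)) i) S"
        by (rule Suc.IH[OF _ Suc.prems(2)[THEN Ck_on_Suc_imp]]) (use Suc.prems(1) in simp)
    qed
    then show ?thesis
      by (subst Ck_on_cong[OF assms(1) trans[OF frechet_derivative_eqI[OF d] e]])
         (auto intro!: Ck_on_sum assms)
  qed
  then show ?case using d by (auto simp: differentiable_def)
qed

section \<open>Closure properties of smooth functions\<close>

lemma smooth_fun_on_cong:
  "open S \<Longrightarrow> (\<And>y. y \<in> S \<Longrightarrow> f y = g y) \<Longrightarrow> smooth_fun_on f S \<longleftrightarrow> smooth_fun_on g S"
  using Ck_on_cong[of S f g] by (simp add: smooth_fun_on_def)

lemma smooth_fun_on_subset: "smooth_fun_on f S \<Longrightarrow> T \<subseteq> S \<Longrightarrow> smooth_fun_on f T"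
  unfolding smooth_fun_on_def by (blast intro: Ck_on_subset)

lemma smooth_fun_on_differentiable: "smooth_fun_on f S \<Longrightarrow> x \<in> S \<Longrightarrow> f differentiable (at x)"
  unfolding smooth_fun_on_def by (metis Ck_on.simps(2))

lemma smooth_fun_on_frechet:
  "smooth_fun_on f S \<Longrightarrow> smooth_fun_on (\<lambda>x. frechet_derivative f (at x) v) S"
  unfolding smooth_fun_on_def by (metis Ck_on.simps(2))

lemma smooth_fun_on_continuous: "smooth_fun_on f S \<Longrightarrow> continuous_on S f"
  unfolding smooth_fun_on_def by (metis Ck_on.simps(1))

named_theorems smooth_intros

lemma smooth_fun_on_const [smooth_intros]: "smooth_fun_on (\<lambda>x. c) S"
  by (simp add: smooth_fun_on_def Ck_on_const)

lemma smooth_fun_on_ident [smooth_intros]: "smooth_fun_on (\<lambda>x. x) S"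
  by (simp add: smooth_fun_on_def Ck_on_ident)

lemma smooth_fun_on_linear_image:
  "bounded_linear l \<Longrightarrow> open S \<Longrightarrow> smooth_fun_on f S \<Longrightarrow> smooth_fun_on (\<lambda>x. l (f x)) S"
  by (simp add: smooth_fun_on_def Ck_on_linear_image)

lemma smooth_fun_on_bilinear:
  "bounded_bilinear b \<Longrightarrow> open S \<Longrightarrow> smooth_fun_on f S \<Longrightarrow> smooth_fun_on g S \<Longrightarrow>
    smooth_fun_on (\<lambda>x. b (f x) (g x)) S"
  by (simp add: smooth_fun_on_def Ck_on_bilinear)

lemma smooth_fun_on_compose:
  fixes g :: "'a::real_normed_vector \<Rightarrow> 'b::euclidean_space"
  shows "smooth_fun_on f T \<Longrightarrow> open T \<Longrightarrow> open S \<Longrightarrow> g ` S \<subseteq> T \<Longrightarrow> smooth_fun_on g S \<Longrightarrow>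
    smooth_fun_on (\<lambda>x. f (g x)) S"
  by (simp add: smooth_fun_on_def Ck_on_compose)

lemma smooth_fun_on_add [smooth_intros]:
  "open S \<Longrightarrow> smooth_fun_on f S \<Longrightarrow> smooth_fun_on g S \<Longrightarrow> smooth_fun_on (\<lambda>x. f x + g x) S"
  by (simp add: smooth_fun_on_def Ck_on_add)

lemma smooth_fun_on_sum [smooth_intros]:
  "open S \<Longrightarrow> (\<And>i. i \<in> I \<Longrightarrow> smooth_fun_on (f i) S) \<Longrightarrow> smooth_fun_on (\<lambda>x. \<Sum>i\<in>I. f i x) S"
  by (simp add: smooth_fun_on_def Ck_on_sum)

lemma smooth_fun_on_mult [smooth_intros]:
  fixes f g :: "'a::real_normed_vector \<Rightarrow> 'b::real_normed_algebra"
  shows "open S \<Longrightarrow> smooth_fun_on f S \<Longrightarrow> smooth_fun_on g S \<Longrightarrow> smooth_fun_on (\<lambda>x. f x * g x) S"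
  by (rule smooth_fun_on_bilinear[OF bounded_bilinear_mult])

lemma smooth_fun_on_scaleR [smooth_intros]:
  "open S \<Longrightarrow> smooth_fun_on f S \<Longrightarrow> smooth_fun_on g S \<Longrightarrow> smooth_fun_on (\<lambda>x. f x *\<^sub>R g x) S"
  by (rule smooth_fun_on_bilinear[OF bounded_bilinear_scaleR])

lemma smooth_fun_on_minus [smooth_intros]:
  "open S \<Longrightarrow> smooth_fun_on f S \<Longrightarrow> smooth_fun_on (\<lambda>x. - f x) S"
  by (rule smooth_fun_on_linear_image[OF bounded_linear_minus[OF bounded_linear_ident]])

lemma smooth_fun_on_diff [smooth_intros]:
  "open S \<Longrightarrow> smooth_fun_on f S \<Longrightarrow> smooth_fun_on g S \<Longrightarrow> smooth_fun_on (\<lambda>x. f x - g x) S"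
  using smooth_fun_on_add[of S f "\<lambda>x. - g x"] smooth_fun_on_minus[of S g] by simp

lemma smooth_fun_on_prod [smooth_intros]:
  fixes f :: "'i \<Rightarrow> 'a::real_normed_vector \<Rightarrow> 'b::{real_normed_algebra_1, comm_monoid_mult}"
  shows "open S \<Longrightarrow> (\<And>i. i \<in> I \<Longrightarrow> smooth_fun_on (f i) S) \<Longrightarrow> smooth_fun_on (\<lambda>x. \<Prod>i\<in>I. f i x) S"
  by (induction I rule: infinite_finite_induct) (auto intro: smooth_intros)

lemma smooth_fun_on_of_real [smooth_intros]:
  "open S \<Longrightarrow> smooth_fun_on f S \<Longrightarrow> smooth_fun_on (\<lambda>x. of_real (f x) :: 'b::real_normed_algebra_1) S"
  by (rule smooth_fun_on_linear_image[OF bounded_linear_of_real])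

lemma smooth_fun_on_Re [smooth_intros]:
  "open S \<Longrightarrow> smooth_fun_on f S \<Longrightarrow> smooth_fun_on (\<lambda>x. Re (f x)) S"
  by (rule smooth_fun_on_linear_image[OF bounded_linear_Re])

lemma smooth_fun_on_cnj [smooth_intros]:
  "open S \<Longrightarrow> smooth_fun_on f S \<Longrightarrow> smooth_fun_on (\<lambda>x. cnj (f x)) S"
  by (rule smooth_fun_on_linear_image[OF bounded_linear_cnj])

lemma smooth_fun_on_vec_nth [smooth_intros]:
  "open S \<Longrightarrow> smooth_fun_on f S \<Longrightarrow> smooth_fun_on (\<lambda>x. f x $ i) S"
  by (rule smooth_fun_on_linear_image[OF bounded_linear_vec_nth])

lemma smooth_fun_on_det [smooth_intros]:
  fixes f :: "'a::real_normed_vector \<Rightarrow> 'b::{real_normed_field}^'n^'n"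
  assumes "open S" "\<And>i j. smooth_fun_on (\<lambda>x. f x $ i $ j) S"
  shows "smooth_fun_on (\<lambda>x. det (f x)) S"
  unfolding det_def
  by (intro smooth_fun_on_sum smooth_fun_on_mult smooth_fun_on_const smooth_fun_on_prod assms)

text \<open>This links the two notions of smoothness: profiles come with a sequence of one-variable
  derivatives, while the calculus on the total space works with iterated Frechet
  derivatives.\<close>

lemma smooth_fun_on_real_derivative_sequence:
  fixes F :: "nat \<Rightarrow> real \<Rightarrow> real"
  assumes "open S" "\<And>k x. x \<in> S \<Longrightarrow> (F k has_real_derivative F (Suc k) x) (at x)"
  shows "smooth_fun_on (F n) S"
proof -
  have "Ck_on k (F n) S" for k
  proof (induction k arbitrary: n)
    case 0
    show ?case using assms(2) by (auto intro!: continuous_at_imp_continuous_on DERIV_isCont)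
  next
    case (Suc k)
    have d: "(F n has_derivative (\<lambda>v. F (Suc n) x * v)) (at x)" if "x \<in> S" for x
      using assms(2)[OF that, of n] by (simp add: has_field_derivative_def)
    have "Ck_on k (\<lambda>x. frechet_derivative (F n) (at x) v) S" for v
      by (subst Ck_on_cong[OF assms(1) frechet_derivative_eqI[OF d]])
         (auto intro!: Ck_on_bilinear[OF bounded_bilinear_mult] assms Suc Ck_on_const)
    then show ?case using d by (auto simp: differentiable_def)
  qed
  then show ?thesis by (simp add: smooth_fun_on_def)
qed

lemma Ck_on_inverse_real: "Ck_on k (inverse :: real \<Rightarrow> real) {0<..}"
proof (induction k)
  case 0
  show ?case by (auto intro!: continuous_intros)
next
  case (Suc k)
  have d: "(inverse has_derivative (\<lambda>v. - (inverse x * v * inverse x))) (at x)"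
    if "x \<in> {0<..}" for x :: real
    using that by (intro has_derivative_inverse') auto
  have "Ck_on k (\<lambda>x. frechet_derivative inverse (at x) v) {0<..}" for v :: real
    by (subst Ck_on_cong[OF open_greaterThan frechet_derivative_eqI[OF d]])
       (auto intro!: Ck_on_linear_image[OF bounded_linear_minus[OF bounded_linear_ident]]
          Ck_on_bilinear[OF bounded_bilinear_mult] Suc Ck_on_const)
  then show ?case using d by (auto simp: differentiable_def)
qed

lemma Ck_on_ln: "Ck_on k (ln :: real \<Rightarrow> real) {0<..}"
proof (cases k)
  case 0
  then show ?thesis by (auto intro!: continuous_intros)
next
  case (Suc n)
  have d: "(ln has_derivative (\<lambda>v. inverse x * v)) (at x)"
    if "x \<in> {0<..}" for x :: real
    using DERIV_ln[of x] that by (simp add: has_field_derivative_def)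
  have "Ck_on n (\<lambda>x. frechet_derivative ln (at x) v) {0<..}" for v :: real
    by (subst Ck_on_cong[OF open_greaterThan frechet_derivative_eqI[OF d]])
       (auto intro!: Ck_on_bilinear[OF bounded_bilinear_mult] Ck_on_inverse_real Ck_on_const)
  then show ?thesis using d Suc by (auto simp: differentiable_def)
qed

lemma smooth_fun_on_ln [smooth_intros]:
  fixes f :: "'a::real_normed_vector \<Rightarrow> real"
  shows "open S \<Longrightarrow> smooth_fun_on f S \<Longrightarrow> (\<And>x. x \<in> S \<Longrightarrow> 0 < f x) \<Longrightarrow>
    smooth_fun_on (\<lambda>x. ln (f x)) S"
  by (rule smooth_fun_on_compose[of ln "{0<..}"]) (auto simp: smooth_fun_on_def Ck_on_ln)

subsection \<open>Symmetry of second derivatives\<close>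

text \<open>The mean value theorem is applied twice, along \<open>v\<close> to the increment in
  direction \<open>w\<close>, and then along \<open>w\<close> to the derivative in direction
  \<open>v\<close>. The second difference itself is symmetric in \<open>v\<close> and
  \<open>w\<close>, although the right-hand side is not.\<close>

lemma second_difference_mean_value:
  fixes f :: "'a::real_normed_vector \<Rightarrow> real"
  assumes "0 < h"
    and box: "\<And>s t. 0 \<le> s \<Longrightarrow> s \<le> h \<Longrightarrow> 0 \<le> t \<Longrightarrow> t \<le> h \<Longrightarrow> x + s *\<^sub>R v + t *\<^sub>R w \<in> S"
    and d1: "\<And>y. y \<in> S \<Longrightarrow> f differentiable (at y)"
    and d2: "\<And>y. y \<in> S \<Longrightarrow> (\<lambda>y. frechet_derivative f (at y) v) differentiable (at y)"
  obtains s t where "0 < s" "s < h" "0 < t" "t < h"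
    "f (x + h *\<^sub>R v + h *\<^sub>R w) - f (x + h *\<^sub>R v) - f (x + h *\<^sub>R w) + f x =
     h^2 * frechet_derivative (\<lambda>y. frechet_derivative f (at y) v) (at (x + s *\<^sub>R v + t *\<^sub>R w)) w"
proof -
  define F where "F s = f (x + s *\<^sub>R v + h *\<^sub>R w) - f (x + s *\<^sub>R v + 0 *\<^sub>R w)" for s
  define fv where "fv y = frechet_derivative f (at y) v" for y
  have line: "((\<lambda>s. f (x + s *\<^sub>R v + t *\<^sub>R w)) has_real_derivative fv (x + s *\<^sub>R v + t *\<^sub>R w)) (at s)"
    if "0 \<le> s" "s \<le> h" "0 \<le> t" "t \<le> h" for s t
  proof -
    have "(f has_derivative frechet_derivative f (at (x + s *\<^sub>R v + t *\<^sub>R w)))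
       (at (x + s *\<^sub>R v + t *\<^sub>R w))"
      using d1[OF box[OF that]] frechet_derivative_works by blast
    moreover have "((\<lambda>s. x + s *\<^sub>R v + t *\<^sub>R w) has_derivative (\<lambda>a. a *\<^sub>R v)) (at s)"
      by (auto intro!: derivative_eq_intros)
    ultimately have "((\<lambda>s. f (x + s *\<^sub>R v + t *\<^sub>R w)) has_derivative
        (\<lambda>a. frechet_derivative f (at (x + s *\<^sub>R v + t *\<^sub>R w)) (a *\<^sub>R v))) (at s)"
      by (rule diff_chain_at[of "\<lambda>s. x + s *\<^sub>R v + t *\<^sub>R w", unfolded o_def, rotated])
    then show ?thesis
      using linear_cmul[OF linear_frechet_derivative[OF d1[OF box[OF that]]]]
      by (simp add: has_field_derivative_def fv_def mult_commute_abs)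
  qed
  have "\<exists>s. 0 < s \<and> s < h \<and> F h - F 0 =
     (h - 0) * (fv (x + s *\<^sub>R v + h *\<^sub>R w) - fv (x + s *\<^sub>R v + 0 *\<^sub>R w))"
    unfolding F_def by (rule MVT2[OF assms(1)]) (use assms(1) in \<open>intro DERIV_diff line; simp\<close>)
  then obtain s where s: "0 < s" "s < h"
    "F h - F 0 = h * (fv (x + s *\<^sub>R v + h *\<^sub>R w) - fv (x + s *\<^sub>R v + 0 *\<^sub>R w))" by auto
  have line2: "((\<lambda>t. fv (x + s *\<^sub>R v + t *\<^sub>R w)) has_real_derivative
     frechet_derivative fv (at (x + s *\<^sub>R v + t *\<^sub>R w)) w) (at t)"
    if "0 \<le> t" "t \<le> h" for t
  proof -
    have b: "x + s *\<^sub>R v + t *\<^sub>R w \<in> S" using box that s by simp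
    have dd: "fv differentiable (at (x + s *\<^sub>R v + t *\<^sub>R w))"
      using d2[OF b] unfolding fv_def .
    then have "(fv has_derivative frechet_derivative fv (at (x + s *\<^sub>R v + t *\<^sub>R w)))
       (at (x + s *\<^sub>R v + t *\<^sub>R w))"
      using frechet_derivative_works by blast
    moreover have "((\<lambda>t. x + s *\<^sub>R v + t *\<^sub>R w) has_derivative (\<lambda>a. a *\<^sub>R w)) (at t)"
      by (auto intro!: derivative_eq_intros)
    ultimately have "((\<lambda>t. fv (x + s *\<^sub>R v + t *\<^sub>R w)) has_derivative
        (\<lambda>a. frechet_derivative fv (at (x + s *\<^sub>R v + t *\<^sub>R w)) (a *\<^sub>R w))) (at t)"
      by (rule diff_chain_at[of "\<lambda>t. x + s *\<^sub>R v + t *\<^sub>R w", unfolded o_def, rotated])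
    then show ?thesis
      using linear_cmul[OF linear_frechet_derivative[OF dd]]
      by (simp add: has_field_derivative_def mult_commute_abs)
  qed
  have "\<exists>t. 0 < t \<and> t < h \<and> fv (x + s *\<^sub>R v + h *\<^sub>R w) - fv (x + s *\<^sub>R v + 0 *\<^sub>R w) =
     (h - 0) * frechet_derivative fv (at (x + s *\<^sub>R v + t *\<^sub>R w)) w"
    by (rule MVT2[OF assms(1)]) (use line2 in auto)
  then obtain t where t: "0 < t" "t < h"
    "fv (x + s *\<^sub>R v + h *\<^sub>R w) - fv (x + s *\<^sub>R v + 0 *\<^sub>R w) =
     h * frechet_derivative fv (at (x + s *\<^sub>R v + t *\<^sub>R w)) w" by auto
  have "f (x + h *\<^sub>R v + h *\<^sub>R w) - f (x + h *\<^sub>R v) - f (x + h *\<^sub>R w) + f x = F h - F 0"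
    by (simp add: F_def)
  also have "\<dots> = h^2 * frechet_derivative fv (at (x + s *\<^sub>R v + t *\<^sub>R w)) w"
    using s(3) t(3) by (simp add: power2_eq_square)
  finally show ?thesis using that[of s t] s t unfolding fv_def by blast
qed

text \<open>Both orders of the mean value argument evaluate the same second difference, so
  \<open>P\<close> at one point near \<open>x\<close> equals \<open>Q\<close> at another; continuity
  of both makes them agree at \<open>x\<close> up to any \<open>e\<close>.\<close>

lemma second_derivative_symmetric_real:
  fixes f :: "'a::real_normed_vector \<Rightarrow> real"
  assumes f: "smooth_fun_on f S" and "open S" "x \<in> S"
  shows "frechet_derivative (\<lambda>y. frechet_derivative f (at y) v) (at x) w =
         frechet_derivative (\<lambda>y. frechet_derivative f (at y) w) (at x) v"
proof -
  define P where "P y = frechet_derivative (\<lambda>y. frechet_derivative f (at y) v) (at y) w" for y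
  define Q where "Q y = frechet_derivative (\<lambda>y. frechet_derivative f (at y) w) (at y) v" for y
  have "smooth_fun_on P S" "smooth_fun_on Q S"
    unfolding P_def Q_def by (intro smooth_fun_on_frechet f)+
  then have "isCont P x" "isCont Q x"
    using assms by (meson smooth_fun_on_continuous continuous_on_eq_continuous_at)+
  have "\<bar>P x - Q x\<bar> \<le> e" if "e > 0" for e
  proof -
    obtain r where r: "r > 0" "ball x r \<subseteq> S" using assms openE by blast
    obtain d1 where d1: "d1 > 0" "\<And>y. dist y x < d1 \<Longrightarrow> dist (P y) (P x) < e/2"
      using \<open>isCont P x\<close> \<open>e > 0\<close> unfolding continuous_at_eps_delta by (meson half_gt_zero)
    obtain d2 where d2: "d2 > 0" "\<And>y. dist y x < d2 \<Longrightarrow> dist (Q y) (Q x) < e/2"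
      using \<open>isCont Q x\<close> \<open>e > 0\<close> unfolding continuous_at_eps_delta by (meson half_gt_zero)
    define d where "d = min r (min d1 d2)"
    have d: "d > 0" using r d1 d2 by (simp add: d_def)
    \<comment> \<open>This side length keeps the parallelogram spanned by
      \<open>h *\<^sub>R v\<close> and \<open>h *\<^sub>R w\<close> within distance
      \<open>d / 2\<close> of \<open>x\<close>; the summand 1 keeps the denominator positive when
      both vectors vanish.\<close>
    define h where "h = d / (2 * (norm v + norm w + 1))"
    have h: "h > 0" using d by (simp add: h_def add_nonneg_pos)
    have small: "dist (x + s *\<^sub>R v + t *\<^sub>R w) x < d" if "0 \<le> s" "s \<le> h" "0 \<le> t" "t \<le> h" for s t
    proof -
      have "dist (x + s *\<^sub>R v + t *\<^sub>R w) x = norm (s *\<^sub>R v + t *\<^sub>R w)"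
        by (simp add: dist_norm algebra_simps)
      also have "\<dots> \<le> s * norm v + t * norm w"
        using norm_triangle_ineq[of "s *\<^sub>R v" "t *\<^sub>R w"] that by simp
      also have "\<dots> \<le> h * norm v + h * norm w"
        using that by (intro add_mono mult_right_mono) auto
      also have "\<dots> \<le> h * (norm v + norm w + 1)" using h by (simp add: algebra_simps)
      also have "\<dots> = d / 2" unfolding h_def
        using add_nonneg_pos[of "norm v + norm w" 1] by (simp add: divide_simps)
      finally show ?thesis using d by simp
    qed
    have small': "dist (x + t *\<^sub>R w + s *\<^sub>R v) x < d" if "0 \<le> s" "s \<le> h" "0 \<le> t" "t \<le> h" for s t
      using small[OF that] by (simp add: add.commute add.left_commute)
    have inS: "y \<in> S" if "dist y x < d" for y
      using that r by (auto simp: d_def dist_commute)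
    have diff: "f differentiable (at y)" "(\<lambda>y. frechet_derivative f (at y) u) differentiable (at y)"
      if "y \<in> S" for y u
      using f that smooth_fun_on_differentiable smooth_fun_on_frechet by blast+
    obtain s t where st: "0 < s" "s < h" "0 < t" "t < h"
      "f (x + h *\<^sub>R v + h *\<^sub>R w) - f (x + h *\<^sub>R v) - f (x + h *\<^sub>R w) + f x =
        h^2 * P (x + s *\<^sub>R v + t *\<^sub>R w)"
      unfolding P_def
      by (rule second_difference_mean_value[of h x v w S f, OF h inS[OF small] diff(1) diff(2)])
    obtain s' t' where st': "0 < s'" "s' < h" "0 < t'" "t' < h"
      "f (x + h *\<^sub>R w + h *\<^sub>R v) - f (x + h *\<^sub>R w) - f (x + h *\<^sub>R v) + f x =
        h^2 * Q (x + s' *\<^sub>R w + t' *\<^sub>R v)"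
      unfolding Q_def
      by (rule second_difference_mean_value[of h x w v S f, OF h inS[OF small'] diff(1) diff(2)])
    have "h^2 * P (x + s *\<^sub>R v + t *\<^sub>R w) = h^2 * Q (x + s' *\<^sub>R w + t' *\<^sub>R v)"
      using st(5) st'(5) by (simp add: algebra_simps)
    then have eq: "P (x + s *\<^sub>R v + t *\<^sub>R w) = Q (x + s' *\<^sub>R w + t' *\<^sub>R v)" using h by simp
    have "dist (P (x + s *\<^sub>R v + t *\<^sub>R w)) (P x) < e/2"
      using small[of s t] st by (intro d1) (auto simp: d_def)
    moreover have "dist (Q (x + s' *\<^sub>R w + t' *\<^sub>R v)) (Q x) < e/2"
      using small'[of t' s'] st' by (intro d2) (auto simp: d_def)
    ultimately show ?thesis using eq unfolding dist_real_def by linarith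
  qed
  then have "P x = Q x" using field_le_epsilon[of "\<bar>P x - Q x\<bar>" 0] by simp
  then show ?thesis by (simp add: P_def Q_def)
qed

lemma frechet_derivative_linear_image:
  assumes "bounded_linear l" "f differentiable (at x)"
  shows "frechet_derivative (\<lambda>y. l (f y)) (at x) v = l (frechet_derivative f (at x) v)"
  by (rule frechet_derivative_eqI bounded_linear.has_derivative[OF assms(1)])+
     (use assms frechet_derivative_works in blast)

text \<open>Mean value points exist only for real functions, so the identity is tested against each
  basis vector.\<close>

lemma second_derivative_symmetric:
  fixes f :: "'a::real_normed_vector \<Rightarrow> 'b::euclidean_space"
  assumes f: "smooth_fun_on f S" and S: "open S" "x \<in> S"
  shows "frechet_derivative (\<lambda>y. frechet_derivative f (at y) v) (at x) w =
         frechet_derivative (\<lambda>y. frechet_derivative f (at y) w) (at x) v"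
proof (rule euclidean_eqI)
  fix b :: 'b
  have bl: "bounded_linear (\<lambda>u. u \<bullet> b)" by (rule bounded_linear_inner_left)
  have *: "frechet_derivative (\<lambda>y. frechet_derivative (\<lambda>y. f y \<bullet> b) (at y) v) (at x) w =
     frechet_derivative (\<lambda>y. frechet_derivative f (at y) v) (at x) w \<bullet> b" for v w
  proof -
    have "frechet_derivative (\<lambda>y. frechet_derivative (\<lambda>y. f y \<bullet> b) (at y) v) (at x) =
          frechet_derivative (\<lambda>y. frechet_derivative f (at y) v \<bullet> b) (at x)"
      using f by (intro frechet_derivative_cong_open[OF S] frechet_derivative_linear_image[OF bl]
          smooth_fun_on_differentiable)
    then show ?thesis
      using frechet_derivative_linear_image[OF bl smooth_fun_on_differentiable[OF smooth_fun_on_frechet[OF f] S(2)]]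
      by simp
  qed
  show "frechet_derivative (\<lambda>y. frechet_derivative f (at y) v) (at x) w \<bullet> b =
        frechet_derivative (\<lambda>y. frechet_derivative f (at y) w) (at x) v \<bullet> b"
    using second_derivative_symmetric_real[OF smooth_fun_on_linear_image[OF bl S(1) f] S, of v w]
    by (simp add: *)
qed

section \<open>Wirtinger calculus\<close>

lemma wirt_eqI:
  "(f has_derivative f') (at z) \<Longrightarrow> wirt k f z = (f' (axis k 1) - \<i> * f' (axis k \<i>)) / 2"
  by (simp add: wirt_def frechet_derivative_eqI)

lemma wirt_bar_eqI:
  "(f has_derivative f') (at z) \<Longrightarrow> wirt_bar k f z = (f' (axis k 1) + \<i> * f' (axis k \<i>)) / 2"
  by (simp add: wirt_bar_def frechet_derivative_eqI)

lemma wirt_cong_open: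
  assumes "open S" "z \<in> S" "\<And>y. y \<in> S \<Longrightarrow> f y = g y"
  shows "wirt k f z = wirt k g z" "wirt_bar k f z = wirt_bar k g z"
  using frechet_derivative_cong_open[OF assms] by (simp_all add: wirt_def wirt_bar_def)

lemma smooth_fun_on_wirt [smooth_intros]:
  "open S \<Longrightarrow> smooth_fun_on f S \<Longrightarrow> smooth_fun_on (wirt k f) S"
  unfolding wirt_def[abs_def] divide_inverse
  by (intro smooth_fun_on_mult smooth_fun_on_diff smooth_fun_on_frechet smooth_fun_on_const)

lemma smooth_fun_on_wirt_bar [smooth_intros]:
  "open S \<Longrightarrow> smooth_fun_on f S \<Longrightarrow> smooth_fun_on (wirt_bar k f) S"
  unfolding wirt_bar_def[abs_def] divide_inverse
  by (intro smooth_fun_on_mult smooth_fun_on_add smooth_fun_on_frechet smooth_fun_on_const)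

lemma has_derivative_frechet:
  "f differentiable (at x) \<Longrightarrow> (f has_derivative frechet_derivative f (at x)) (at x)"
  using frechet_derivative_works by blast

lemma wirt_const [simp]: "wirt k (\<lambda>x. c) z = 0" "wirt_bar k (\<lambda>x. c) z = 0"
  by (simp_all add: wirt_def wirt_bar_def)

lemma wirt_add:
  assumes "f differentiable (at z)" "g differentiable (at z)"
  shows "wirt k (\<lambda>x. f x + g x) z = wirt k f z + wirt k g z"
    and "wirt_bar k (\<lambda>x. f x + g x) z = wirt_bar k f z + wirt_bar k g z"
  using wirt_eqI[OF has_derivative_add[OF assms[THEN has_derivative_frechet]], of k]
    wirt_bar_eqI[OF has_derivative_add[OF assms[THEN has_derivative_frechet]], of k]
  by (simp_all add: wirt_def wirt_bar_def algebra_simps add_divide_distrib diff_divide_distrib)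

lemma wirt_mult:
  assumes "f differentiable (at z)" "g differentiable (at z)"
  shows "wirt k (\<lambda>x. f x * g x) z = f z * wirt k g z + wirt k f z * g z"
    and "wirt_bar k (\<lambda>x. f x * g x) z = f z * wirt_bar k g z + wirt_bar k f z * g z"
  using wirt_eqI[OF has_derivative_mult[OF assms[THEN has_derivative_frechet]], of k]
    wirt_bar_eqI[OF has_derivative_mult[OF assms[THEN has_derivative_frechet]], of k]
  by (simp_all add: wirt_def wirt_bar_def algebra_simps add_divide_distrib diff_divide_distrib)

lemma wirt_cmult:
  assumes "f differentiable (at z)"
  shows "wirt k (\<lambda>x. c * f x) z = c * wirt k f z"
    and "wirt_bar k (\<lambda>x. c * f x) z = c * wirt_bar k f z"
  using wirt_mult[OF differentiable_const assms, of k c] by simp_all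

lemma wirt_diff:
  assumes "f differentiable (at z)" "g differentiable (at z)"
  shows "wirt k (\<lambda>x. f x - g x) z = wirt k f z - wirt k g z"
    and "wirt_bar k (\<lambda>x. f x - g x) z = wirt_bar k f z - wirt_bar k g z"
  using wirt_eqI[OF has_derivative_diff[OF assms[THEN has_derivative_frechet]], of k]
    wirt_bar_eqI[OF has_derivative_diff[OF assms[THEN has_derivative_frechet]], of k]
  by (simp_all add: wirt_def wirt_bar_def algebra_simps add_divide_distrib diff_divide_distrib)

lemma wirt_cnj:
  assumes "f differentiable (at z)"
  shows "wirt k (\<lambda>x. cnj (f x)) z = cnj (wirt_bar k f z)"
    and "wirt_bar k (\<lambda>x. cnj (f x)) z = cnj (wirt k f z)"
  using wirt_eqI[OF has_derivative_cnj[OF has_derivative_frechet[OF assms]], of k]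
    wirt_bar_eqI[OF has_derivative_cnj[OF has_derivative_frechet[OF assms]], of k]
  by (simp_all add: wirt_def wirt_bar_def)

lemma wirt_bar_of_real:
  assumes "f differentiable (at z)"
  shows "wirt_bar k (\<lambda>x. complex_of_real (f x)) z = cnj (wirt k (\<lambda>x. complex_of_real (f x)) z)"
proof -
  have "(\<lambda>x. complex_of_real (f x)) differentiable (at z)"
    using has_derivative_of_real[OF has_derivative_frechet[OF assms]] differentiableI by blast
  from wirt_cnj(2)[OF this, of k] show ?thesis by simp
qed

lemma wirt_bar_wirt_commute:
  assumes f: "smooth_fun_on f S" and S: "open S" "z \<in> S"
  shows "wirt_bar i (wirt j f) z = wirt j (wirt_bar i f) z"
proof -
  have d: "(\<lambda>y. frechet_derivative f (at y) v) differentiable (at z)" for v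
    using smooth_fun_on_differentiable[OF smooth_fun_on_frechet[OF f] S(2)] .
  have 1: "((wirt j f) has_derivative
     (\<lambda>u. (frechet_derivative (\<lambda>y. frechet_derivative f (at y) (axis j 1)) (at z) u -
       \<i> * frechet_derivative (\<lambda>y. frechet_derivative f (at y) (axis j \<i>)) (at z) u) / 2)) (at z)"
    unfolding wirt_def[abs_def]
    by (rule bounded_linear.has_derivative[OF bounded_linear_divide] has_derivative_diff
        bounded_linear.has_derivative[OF bounded_linear_mult_right] has_derivative_frechet[OF d])+
  have 2: "((wirt_bar i f) has_derivative
     (\<lambda>u. (frechet_derivative (\<lambda>y. frechet_derivative f (at y) (axis i 1)) (at z) u +
       \<i> * frechet_derivative (\<lambda>y. frechet_derivative f (at y) (axis i \<i>)) (at z) u) / 2)) (at z)"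
    unfolding wirt_bar_def[abs_def]
    by (rule bounded_linear.has_derivative[OF bounded_linear_divide] has_derivative_add
        bounded_linear.has_derivative[OF bounded_linear_mult_right] has_derivative_frechet[OF d])+
  show ?thesis
    unfolding wirt_eqI[OF 2] wirt_bar_eqI[OF 1]
    by (simp add: second_derivative_symmetric[OF f S, of "axis j _" "axis i _"] algebra_simps diff_divide_distrib add_divide_distrib)
qed

subsection \<open>Pluriharmonicity of the logarithm of a squared modulus\<close>

lemma wirt_holomorphic:
  fixes a :: "complex^'n"
  assumes "(q has_derivative (\<lambda>v. \<Sum>i\<in>UNIV. a $ i * v $ i)) (at z)"
  shows "wirt k q z = a $ k" "wirt_bar k q z = 0"
proof -
  have s: "(\<Sum>i\<in>UNIV. a $ i * axis k c $ i) = a $ k * c" for c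
    by (simp add: axis_def if_distrib[of "\<lambda>x. _ * x"] cong: if_cong)
  show "wirt k q z = a $ k" "wirt_bar k q z = 0"
    by (simp_all add: wirt_eqI[OF assms] wirt_bar_eqI[OF assms] s algebra_simps)
qed

text \<open>Formally, delbar of log (q * cnj q) is the conjugate of the logarithmic derivative of q.
  The real inner product expresses the squared modulus without a branch of the complex
  logarithm.\<close>

lemma wirt_bar_ln_norm_holomorphic:
  assumes "holo_fun_on q S" "z \<in> S" "q z \<noteq> 0"
  shows "wirt_bar j (\<lambda>w. complex_of_real (ln ((cmod (q w))\<^sup>2))) z = cnj (wirt j q z / q z)"
proof -
  obtain a :: "complex^'a" where a: "(q has_derivative (\<lambda>v. \<Sum>i\<in>UNIV. a $ i * v $ i)) (at z)"
    using assms unfolding holo_fun_on_def by blast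
  define b where "b = a $ j / q z"
  have s: "(\<Sum>i\<in>UNIV. a $ i * axis j c $ i) = a $ j * c" for c
    by (simp add: axis_def if_distrib[of "\<lambda>x. _ * x"] cong: if_cong)
  have "((\<lambda>w. ln (q w \<bullet> q w)) has_derivative
     (\<lambda>v. (2 * (q z \<bullet> (\<Sum>i\<in>UNIV. a $ i * v $ i))) / (q z \<bullet> q z))) (at z)"
    using assms(3) by (auto intro!: derivative_eq_intros a simp: inner_commute fun_eq_iff divide_inverse)
  then have "((\<lambda>w. complex_of_real (ln ((cmod (q w))\<^sup>2))) has_derivative
     (\<lambda>v. complex_of_real ((2 * (q z \<bullet> (\<Sum>i\<in>UNIV. a $ i * v $ i))) / (q z \<bullet> q z)))) (at z)"
    unfolding power2_norm_eq_inner by (rule has_derivative_of_real)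
  from wirt_bar_eqI[OF this, of j]
  have "wirt_bar j (\<lambda>w. complex_of_real (ln ((cmod (q w))\<^sup>2))) z =
    (of_real (2 * (q z \<bullet> (a $ j))) + \<i> * of_real (2 * (q z \<bullet> (a $ j * \<i>)))) / of_real (q z \<bullet> q z) / 2"
    by (simp add: s add_divide_distrib)
  also have "\<dots> = cnj b"
  proof -
    \<comment> \<open>Written as multiples of \<open>q z\<close>, the derivatives in the directions
      1 and \<open>\<i>\<close> pick out the real part of \<open>b\<close> and minus its imaginary
      part.\<close>
    have aj: "a $ j = b * q z" "a $ j * \<i> = (b * \<i>) * q z"
      using assms(3) by (simp_all add: b_def)
    have re: "x \<bullet> (c * x) = Re c * (x \<bullet> x)" for c x :: complex
      by (simp add: inner_complex_def algebra_simps)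
    have n: "q z \<bullet> q z \<noteq> 0" using assms(3) by simp
    have 1: "q z \<bullet> (a $ j) = Re b * (q z \<bullet> q z)" unfolding aj(1) re ..
    have 2: "q z \<bullet> (a $ j * \<i>) = - Im b * (q z \<bullet> q z)" unfolding aj(2) re by simp
    show ?thesis unfolding 1 2 using n by (simp add: complex_eq_iff)
  qed
  finally show ?thesis by (simp add: b_def wirt_holomorphic[OF a])
qed

text \<open>The definition of a holomorphic function asks only for complex differentiability, so the
  smoothness of q has to be bootstrapped: the first derivatives of q are q times the conjugates of
  the derivatives of the smooth function log of the squared modulus of q.\<close>

lemma wirt_wirt_bar_ln_norm_holomorphic:
  assumes q: "holo_fun_on q S" "\<And>w. w \<in> S \<Longrightarrow> q w \<noteq> 0"
    and S: "open S" "z \<in> S"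
    and u: "smooth_fun_on (\<lambda>w. ln ((cmod (q w))\<^sup>2)) S"
  shows "wirt i (wirt_bar j (\<lambda>w. complex_of_real (ln ((cmod (q w))\<^sup>2)))) z = 0"
proof -
  define b where "b j w = cnj (wirt_bar j (\<lambda>w. complex_of_real (ln ((cmod (q w))\<^sup>2))) w)" for j w
  have b_smooth: "smooth_fun_on (b j) S" for j
    unfolding b_def by (intro smooth_intros u S)
  have wb: "wirt j q w = q w * b j w" if "w \<in> S" for j w
    using wirt_bar_ln_norm_holomorphic[OF q(1) that q(2)[OF that]] q(2)[OF that] by (simp add: b_def)
  have qd: "(q has_derivative (\<lambda>v. \<Sum>i\<in>UNIV. v $ i * (q w * b i w))) (at w)" if w: "w \<in> S" for w
  proof -
    obtain a where a: "(q has_derivative (\<lambda>v. \<Sum>i\<in>UNIV. a $ i * v $ i)) (at w)"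
      using q(1) w unfolding holo_fun_on_def by blast
    then have "a $ i = q w * b i w" for i using wirt_holomorphic(1)[OF a, of i] wb[OF w] by simp
    then show ?thesis using a by (simp add: mult.commute)
  qed
  \<comment> \<open>The derivative formula \<open>qd\<close> involves only \<open>q\<close> itself
    and the smooth functions \<open>b i\<close>, so order k of \<open>q\<close> gives order k of its
    derivatives.\<close>
  have "Ck_on k q S" for k
  proof (induction k)
    case 0
    show ?case using qd by (auto intro!: continuous_at_imp_continuous_on has_derivative_continuous)
  next
    case (Suc k)
    have "Ck_on k (\<lambda>x. frechet_derivative q (at x) v) S" for v
    proof (subst Ck_on_cong[OF S(1) frechet_derivative_eqI[OF qd]], assumption)
      show "Ck_on k (\<lambda>y. \<Sum>i\<in>UNIV. v $ i * (q y * b i y)) S"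
        using b_smooth
        by (intro Ck_on_sum Ck_on_bilinear[OF bounded_bilinear_mult] Ck_on_const Suc S)
           (simp add: smooth_fun_on_def)
    qed
    then show ?case using qd by (auto simp: differentiable_def)
  qed
  then have q_smooth: "smooth_fun_on q S" by (simp add: smooth_fun_on_def)
  have bar0: "wirt_bar i q w = 0" if "w \<in> S" for w i
    using q(1) that wirt_holomorphic(2) unfolding holo_fun_on_def by blast
  \<comment> \<open>Now that \<open>q\<close> is smooth, mixed derivatives may be exchanged, and
    delbar of \<open>q\<close> vanishes. Applied to the product \<open>q * b j\<close>, this leaves
    only \<open>q\<close> times delbar of \<open>b j\<close>.\<close>
  have "wirt_bar i (wirt j q) z = wirt j (wirt_bar i q) z"
    by (rule wirt_bar_wirt_commute[OF q_smooth S])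
  also have "\<dots> = wirt j (\<lambda>x. 0) z"
    by (rule wirt_cong_open[OF S]) (rule bar0)
  finally have "wirt_bar i (wirt j q) z = 0" by simp
  moreover have "wirt_bar i (wirt j q) z = wirt_bar i (\<lambda>w. q w * b j w) z"
    by (rule wirt_cong_open[OF S]) (rule wb)
  ultimately have "q z * wirt_bar i (b j) z = 0"
    using wirt_mult(2)[OF smooth_fun_on_differentiable[OF q_smooth S(2)]
        smooth_fun_on_differentiable[OF b_smooth S(2)]] bar0[OF S(2)] by simp
  then have "wirt_bar i (b j) z = 0" using q(2) S by simp
  moreover have "wirt i (\<lambda>w. cnj (b j w)) z = cnj (wirt_bar i (b j) z)"
    by (rule wirt_cnj smooth_fun_on_differentiable[OF b_smooth S(2)])+
  ultimately show ?thesis by (simp add: b_def)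
qed

subsection \<open>Chain rule over a base coordinate patch\<close>

definition base_coord :: "complex^('m option) \<Rightarrow> complex^'m::finite"
  where "base_coord w = (\<chi> m. w $ Some m)"

lemma bounded_linear_base_coord: "bounded_linear (base_coord :: complex^('m option) \<Rightarrow> complex^'m::finite)"
  unfolding linear_conv_bounded_linear[symmetric]
  by (rule linearI) (simp_all add: base_coord_def vec_eq_iff)

lemma base_coord_axis [simp]:
  "base_coord (axis None c) = 0" "base_coord (axis (Some i) c) = axis i c"
  by (simp_all add: base_coord_def axis_def vec_eq_iff)

definition first_deriv :: "(real \<times> 'a::real_normed_vector \<Rightarrow> 'b::real_normed_vector) \<Rightarrow> real \<times> 'a \<Rightarrow> 'b"
  where "first_deriv H p = frechet_derivative H (at p) (1, 0)"

lemma has_vector_derivative_first_deriv: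
  assumes "H differentiable (at (s, z))"
  shows "((\<lambda>s. H (s, z)) has_vector_derivative first_deriv H (s, z)) (at s)"
proof -
  have "((\<lambda>s. (s, z)) has_derivative (\<lambda>a. (a, 0))) (at s)"
    by (auto intro!: derivative_eq_intros)
  from diff_chain_at[OF this, unfolded o_def, OF has_derivative_frechet[OF assms]]
  have d: "((\<lambda>s. H (s, z)) has_derivative (\<lambda>a. frechet_derivative H (at (s, z)) (a, 0))) (at s)" .
  have "frechet_derivative H (at (s, z)) (a, 0) = a *\<^sub>R frechet_derivative H (at (s, z)) (1, 0)" for a
    using linear_cmul[OF linear_frechet_derivative[OF assms], of a "(1, 0)"] by simp
  then have "(\<lambda>a. frechet_derivative H (at (s, z)) (a, 0)) = (\<lambda>a. a *\<^sub>R first_deriv H (s, z))"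
    unfolding first_deriv_def by (rule ext)
  then show ?thesis using d by (simp only: has_vector_derivative_def)
qed

lemma frechet_derivative_second:
  assumes "H differentiable (at (s, z))"
  shows "frechet_derivative (\<lambda>z. H (s, z)) (at z) v = frechet_derivative H (at (s, z)) (0, v)"
proof -
  have "((\<lambda>z. (s, z)) has_derivative (\<lambda>a. (0, a))) (at z)"
    by (auto intro!: derivative_eq_intros)
  from diff_chain_at[OF this, unfolded o_def, OF has_derivative_frechet[OF assms]]
  show ?thesis by (rule frechet_derivative_eqI)
qed

text \<open>The real variable of \<open>H\<close> is itself a function on the total space. Because
  it is real valued, both Wirtinger derivatives meet the same factor \<open>first_deriv H\<close>,
  even though \<open>H\<close> is complex valued.\<close>

lemma wirt_compose_base:
  fixes H :: "real \<times> (complex^'m::finite) \<Rightarrow> complex" and \<tau> :: "complex^('m option) \<Rightarrow> real"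
  assumes H: "H differentiable (at (\<tau> w, base_coord w))" and \<tau>: "\<tau> differentiable (at w)"
  shows "wirt k (\<lambda>w. H (\<tau> w, base_coord w)) w =
      first_deriv H (\<tau> w, base_coord w) * wirt k (\<lambda>w. complex_of_real (\<tau> w)) w +
      (case k of None \<Rightarrow> 0 | Some i \<Rightarrow> wirt i (\<lambda>z. H (\<tau> w, z)) (base_coord w))"
    and "wirt_bar k (\<lambda>w. H (\<tau> w, base_coord w)) w =
      first_deriv H (\<tau> w, base_coord w) * wirt_bar k (\<lambda>w. complex_of_real (\<tau> w)) w +
      (case k of None \<Rightarrow> 0 | Some i \<Rightarrow> wirt_bar i (\<lambda>z. H (\<tau> w, z)) (base_coord w))"
proof -
  define H' where "H' = frechet_derivative H (at (\<tau> w, base_coord w))"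
  define \<tau>' where "\<tau>' = frechet_derivative \<tau> (at w)"
  have \<tau>'d: "(\<tau> has_derivative \<tau>') (at w)"
    unfolding \<tau>'_def by (rule has_derivative_frechet[OF \<tau>])
  have "((\<lambda>w. (\<tau> w, base_coord w)) has_derivative (\<lambda>v. (\<tau>' v, base_coord v))) (at w)"
    by (intro has_derivative_Pair \<tau>'d bounded_linear.has_derivative[OF bounded_linear_base_coord]
        has_derivative_ident)
  from diff_chain_at[OF this, unfolded o_def, OF has_derivative_frechet[OF H]]
  have d: "((\<lambda>w. H (\<tau> w, base_coord w)) has_derivative (\<lambda>v. H' (\<tau>' v, base_coord v))) (at w)"
    by (simp add: H'_def)
  have l: "linear H'" unfolding H'_def by (rule linear_frechet_derivative[OF H])
  have H': "H' (a, v) = of_real a * first_deriv H (\<tau> w, base_coord w) +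
      frechet_derivative (\<lambda>z. H (\<tau> w, z)) (at (base_coord w)) v" for a v
    using linear_add[OF l, of "(a, 0)" "(0, v)"] linear_cmul[OF l, of a "(1, 0)"]
    unfolding frechet_derivative_second[OF H] H'_def[symmetric] first_deriv_def
    by (simp add: scaleR_conv_of_real)
  have fd0: "frechet_derivative (\<lambda>z. H (\<tau> w, z)) (at (base_coord w)) 0 = 0"
    unfolding frechet_derivative_second[OF H] H'_def[symmetric]
    using linear_0[OF l] by (simp add: zero_prod_def)
  note \<tau>d = has_derivative_of_real[OF \<tau>'d]
  show "wirt k (\<lambda>w. H (\<tau> w, base_coord w)) w =
      first_deriv H (\<tau> w, base_coord w) * wirt k (\<lambda>w. complex_of_real (\<tau> w)) w +
      (case k of None \<Rightarrow> 0 | Some i \<Rightarrow> wirt i (\<lambda>z. H (\<tau> w, z)) (base_coord w))"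
    "wirt_bar k (\<lambda>w. H (\<tau> w, base_coord w)) w =
      first_deriv H (\<tau> w, base_coord w) * wirt_bar k (\<lambda>w. complex_of_real (\<tau> w)) w +
      (case k of None \<Rightarrow> 0 | Some i \<Rightarrow> wirt_bar i (\<lambda>z. H (\<tau> w, z)) (base_coord w))"
    unfolding wirt_eqI[OF d] wirt_bar_eqI[OF d] wirt_eqI[OF \<tau>d] wirt_bar_eqI[OF \<tau>d] H'
    by (cases k; simp add: fd0 wirt_def wirt_bar_def field_simps)+
qed

section \<open>Determinants and inverse matrices\<close>

text \<open>\<open>matrix_inv\<close> is a choice; over a field a one-sided inverse is two-sided and
  unique, which pins the choice down.\<close>

lemma matrix_inv_eqI:
  fixes A B :: "'a::field^'n^'n"
  assumes "A ** B = mat 1"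
  shows "matrix_inv A = B"
proof -
  have "B ** A = mat 1" using assms matrix_left_right_inverse by blast
  have "A ** matrix_inv A = mat 1 \<and> matrix_inv A ** A = mat 1"
    unfolding matrix_inv_def by (rule someI[of _ B]) (use assms \<open>B ** A = mat 1\<close> in simp)
  then have "B ** (A ** matrix_inv A) = B" by simp
  then show ?thesis using \<open>B ** A = mat 1\<close> by (simp add: matrix_mul_assoc)
qed

lemma matrix_inv_mult:
  fixes A :: "'a::field^'n^'n"
  assumes "det A \<noteq> 0"
  shows "A ** matrix_inv A = mat 1" "matrix_inv A ** A = mat 1"
proof -
  obtain B where "A ** B = mat 1" "B ** A = mat 1"
    using assms unfolding invertible_det_nz[symmetric] invertible_def by blast
  then show "A ** matrix_inv A = mat 1" "matrix_inv A ** A = mat 1"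
    using matrix_inv_eqI by metis+
qed

lemma matrix_diff_rdistrib:
  fixes A B :: "'a::comm_ring_1^'n^'m"
  shows "(A - B) ** C = A ** C - B ** C"
  by (simp add: matrix_matrix_mult_def vec_eq_iff left_diff_distrib sum_subtractf)

lemma sum_UNIV_option: "(\<Sum>x\<in>UNIV. f x) = f None + (\<Sum>i\<in>(UNIV::'n::finite set). f (Some i))"
proof -
  have "(\<Sum>x\<in>UNIV. f x) = f None + (\<Sum>x\<in>range Some. f x)"
    by (subst UNIV_option_conv) (simp add: sum.insert)
  then show ?thesis by (simp add: sum.reindex)
qed

text \<open>Expansion along the \<open>None\<close> row, carried out on the Leibniz sum.
  Permutations are sorted by the image of \<open>None\<close>; an image \<open>Some j\<close>
  contributes a zero entry, so only the permutations fixing \<open>None\<close> survive.\<close>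

lemma det_option_block:
  fixes A :: "'a::comm_ring_1^('n::finite option)^('n option)"
  assumes "\<And>j. A $ None $ Some j = 0"
  shows "det A = A $ None $ None * det (\<chi> i j. A $ Some i $ Some j)"
proof -
  define S where "S = range (Some :: 'n \<Rightarrow> 'n option)"
  have S: "finite S" "None \<notin> S" "UNIV = insert None S" by (auto simp: S_def UNIV_option_conv)
  define f where "f p = of_int (sign p) * (\<Prod>i\<in>UNIV. A $ i $ p i)" for p
  have inner0: "(\<Sum>q | q permutes S. f (Transposition.transpose None b \<circ> q)) = 0" if "b \<in> S" for b
  proof (rule sum.neutral, clarify)
    fix q assume "q permutes S"
    then have "(Transposition.transpose None b \<circ> q) None = b" using S permutes_not_in by fastforce
    moreover obtain j where "b = Some j" using \<open>b \<in> S\<close> by (auto simp: S_def)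
    ultimately have "A $ None $ (Transposition.transpose None b \<circ> q) None = 0" using assms by simp
    then show "f (Transposition.transpose None b \<circ> q) = 0"
      unfolding f_def by (subst prod_zero[OF _ bexI[of _ None]]) auto
  qed
  have bij: "bij_betw Some (UNIV :: 'n set) S" by (auto simp: bij_betw_def S_def)
  have "det A = (\<Sum>p | p permutes (insert None S). f p)"
    by (simp add: det_def f_def S(3))
  also have "\<dots> = (\<Sum>b\<in>insert None S. \<Sum>q | q permutes S. f (Transposition.transpose None b \<circ> q))"
    by (rule sum_over_permutations_insert[OF S(1,2)])
  also have "\<dots> = (\<Sum>q | q permutes S. f q)"
    by (simp only: sum.insert[OF S(1,2)] sum.neutral[OF ballI[OF inner0]]) simp
  \<comment> \<open>Conjugation with \<open>Some\<close> identifies the permutations of the original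
    index type with those of its copy \<open>S\<close>; it preserves signs.\<close>
  also have "\<dots> = (\<Sum>q | q permutes (UNIV :: 'n set). f (map_permutation UNIV Some q))"
  proof (rule sum.reindex_bij_witness[where j = "map_permutation S the" and i = "map_permutation UNIV Some"])
    fix q assume q: "q \<in> {q. q permutes S}"
    have bij': "bij_betw the S (UNIV :: 'n set)"
      by (rule bij_betw_byWitness[where f' = Some]) (auto simp: S_def)
    show "map_permutation UNIV Some (map_permutation S the q) = q"
      using q by (intro map_permutation_compose_inv[OF bij']) (auto simp: S_def)
    show "map_permutation S the q \<in> {q. q permutes (UNIV :: 'n set)}"
      using map_permutation_permutes[OF bij'] q by blast
    then show "f (map_permutation UNIV Some (map_permutation S the q)) = f q"
      using \<open>map_permutation UNIV Some (map_permutation S the q) = q\<close> by simp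
  next
    fix q assume q: "q \<in> {q. q permutes (UNIV :: 'n set)}"
    show "map_permutation S the (map_permutation UNIV Some q) = q"
      using q by (intro map_permutation_compose_inv[OF bij]) auto
    show "map_permutation UNIV Some q \<in> {q. q permutes S}"
      using map_permutation_permutes[OF bij] q by blast
  qed
  also have "\<dots> = (\<Sum>q | q permutes (UNIV :: 'n set). A $ None $ None *
      (of_int (sign q) * (\<Prod>i\<in>UNIV. (\<chi> i j. A $ Some i $ Some j) $ i $ q i)))"
  proof (rule sum.cong[OF refl], clarify)
    fix q :: "'n \<Rightarrow> 'n" assume q: "q permutes UNIV"
    define r where "r = map_permutation UNIV Some q"
    have "r permutes S" unfolding r_def by (rule map_permutation_permutes[OF bij q])
    then have r0: "r None = None" using S permutes_not_in by fast
    have rs: "r (Some i) = Some (q i)" for i unfolding r_def by (rule map_permutation_apply) auto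
    have "(\<Prod>i\<in>UNIV. A $ i $ r i) = A $ None $ None * (\<Prod>i\<in>S. A $ i $ r i)"
      by (simp only: S(3) prod.insert[OF S(1,2)] r0)
    also have "(\<Prod>i\<in>S. A $ i $ r i) = (\<Prod>i\<in>UNIV. A $ Some i $ Some (q i))"
      unfolding S_def by (subst prod.reindex) (auto simp: rs)
    finally show "f (map_permutation UNIV Some q) = A $ None $ None *
      (of_int (sign q) * (\<Prod>i\<in>UNIV. (\<chi> i j. A $ Some i $ Some j) $ i $ q i))"
      using q by (simp add: f_def r_def[symmetric]) (simp add: r_def sign_map_permutation)
  qed
  also have "\<dots> = A $ None $ None * det (\<chi> i j. A $ Some i $ Some j)"
    by (simp only: det_def sum_distrib_left)
  finally show ?thesis .
qed

subsection \<open>Positive definite Hermitian matrices\<close>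

lemma det_cnj: "det (\<chi> i j. cnj (A $ i $ j)) = cnj (det A)"
  by (simp add: det_def)

lemma hermitian_mat_det_real:
  assumes "hermitian_mat G"
  shows "Im (det G) = 0"
proof -
  have "cnj (G $ i $ j) = G $ j $ i" for i j
    using assms unfolding hermitian_mat_def by metis
  then have "(\<chi> i j. cnj (G $ i $ j)) = transpose G"
    by (simp add: transpose_def vec_eq_iff)
  then have "cnj (det G) = det G" using det_cnj[of G] by simp
  then show ?thesis by (simp add: complex_eq_iff)
qed

text \<open>A kernel vector would make the quadratic form vanish. The transpose enters because the
  unconjugated vector is paired with the row index of \<open>G\<close>.\<close>

lemma pos_def_mat_det_nonzero:
  assumes "pos_def_mat G"
  shows "det G \<noteq> 0"
proof
  assume "det G = 0"
  then have "det (transpose G) = 0" by simp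
  then obtain v where v: "transpose G *v v = 0" "v \<noteq> 0"
    using matrix_left_invertible_ker[of "transpose G"] invertible_det_nz[of "transpose G"]
      invertible_left_inverse[of "transpose G"] by auto
  have "(\<Sum>i\<in>UNIV. \<Sum>j\<in>UNIV. G $ i $ j * v $ i * cnj (v $ j)) =
     (\<Sum>j\<in>UNIV. (transpose G *v v) $ j * cnj (v $ j))"
    by (subst sum.swap) (simp add: matrix_vector_mult_def transpose_def sum_distrib_right)
  also have "\<dots> = 0" using v by simp
  finally have "Re (\<Sum>i\<in>UNIV. \<Sum>j\<in>UNIV. G $ i $ j * v $ i * cnj (v $ j)) = 0" by simp
  then show False using assms v(2) unfolding pos_def_mat_def by fastforce
qed

lemma pos_def_mat_1: "pos_def_mat (mat 1 :: complex^'n^'n)"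
proof -
  have "0 < Re (\<Sum>i\<in>UNIV. \<Sum>j\<in>UNIV. (mat 1 :: complex^'n^'n) $ i $ j * v $ i * cnj (v $ j))"
    if "v \<noteq> 0" for v :: "complex^'n"
  proof -
    have "(\<Sum>j\<in>UNIV. (mat 1 :: complex^'n^'n) $ i $ j * v $ i * cnj (v $ j)) = v $ i * cnj (v $ i)" for i
      by (simp add: mat_def if_distrib[of "\<lambda>x. x * _"] cong: if_cong)
    then have "Re (\<Sum>i\<in>UNIV. \<Sum>j\<in>UNIV. (mat 1 :: complex^'n^'n) $ i $ j * v $ i * cnj (v $ j))
       = (\<Sum>i\<in>UNIV. (cmod (v $ i))\<^sup>2)"
      by (simp add: complex_mult_cnj cmod_power2)
    moreover obtain i where "v $ i \<noteq> 0" using \<open>v \<noteq> 0\<close> by (auto simp: vec_eq_iff)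
    ultimately show ?thesis by (auto intro!: sum_pos2[of UNIV i])
  qed
  then show ?thesis by (auto simp: pos_def_mat_def hermitian_mat_def mat_def)
qed

lemma pos_def_mat_convex:
  fixes G H :: "complex^'n^'n"
  assumes "pos_def_mat G" "pos_def_mat H" "0 \<le> a" "0 \<le> b" "a + b = 1"
  shows "pos_def_mat (a *\<^sub>R G + b *\<^sub>R H)"
proof -
  define q where "q M v = Re (\<Sum>i\<in>UNIV. \<Sum>j\<in>UNIV. M $ i $ j * v $ i * cnj (v $ j))" for M :: "complex^'n^'n" and v
  have lin: "q (a *\<^sub>R G + b *\<^sub>R H) v = a * q G v + b * q H v" for v
  proof -
    have "(\<Sum>i\<in>UNIV. \<Sum>j\<in>UNIV. (a *\<^sub>R G + b *\<^sub>R H) $ i $ j * v $ i * cnj (v $ j)) =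
      a *\<^sub>R (\<Sum>i\<in>UNIV. \<Sum>j\<in>UNIV. G $ i $ j * v $ i * cnj (v $ j)) +
      b *\<^sub>R (\<Sum>i\<in>UNIV. \<Sum>j\<in>UNIV. H $ i $ j * v $ i * cnj (v $ j))"
      by (simp add: scaleR_sum_right sum.distrib[symmetric] algebra_simps)
    then show ?thesis unfolding q_def by simp
  qed
  have "0 < a * q G v + b * q H v" if "v \<noteq> 0" for v
  proof -
    have "0 < q G v" "0 < q H v" using assms(1,2) that unfolding pos_def_mat_def q_def by auto
    then show ?thesis using assms(3-5)
      by (cases "a = 0") (auto intro: add_pos_nonneg)
  qed
  moreover have "hermitian_mat (a *\<^sub>R G + b *\<^sub>R H)"
    using assms(1,2) unfolding pos_def_mat_def hermitian_mat_def
    by (metis (no_types, lifting) complex_cnj_add complex_cnj_scaleR vector_add_component vector_scaleR_component)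
  ultimately show ?thesis unfolding pos_def_mat_def q_def[symmetric] lin by simp
qed

text \<open>The segment from the identity to \<open>G\<close> consists of positive definite
  matrices, so along it the determinant is real and never zero; starting at 1, it cannot change
  sign.\<close>

lemma pos_def_mat_det_pos:
  fixes G :: "complex^'n^'n"
  assumes "pos_def_mat G"
  shows "0 < Re (det G)" "det G = of_real (Re (det G))"
proof -
  define M where "M t = (1 - t) *\<^sub>R (mat 1 :: complex^'n^'n) + t *\<^sub>R G" for t
  have nz: "Re (det (M t)) \<noteq> 0" if "0 \<le> t" "t \<le> 1" for t
  proof -
    have "pos_def_mat (M t)"
      unfolding M_def by (rule pos_def_mat_convex[OF pos_def_mat_1 assms]) (use that in auto)
    then show ?thesis
      using pos_def_mat_det_nonzero hermitian_mat_det_real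
      by (auto simp: complex_eq_iff pos_def_mat_def)
  qed
  have cont: "continuous_on {0..1} (\<lambda>t. Re (det (M t)))"
    unfolding M_def det_def by (auto intro!: continuous_intros)
  show "0 < Re (det G)"
  proof (rule ccontr)
    assume "\<not> 0 < Re (det G)"
    then have "\<exists>t. 0 \<le> t \<and> t \<le> 1 \<and> Re (det (M t)) = 0"
      by (intro IVT2'[OF _ _ _ cont]) (auto simp: M_def)
    then show False using nz by blast
  qed
  show "det G = of_real (Re (det G))"
    using hermitian_mat_det_real assms by (auto simp: complex_eq_iff pos_def_mat_def)
qed

subsection \<open>Determinants of pencils\<close>

text \<open>The parameter lives in the ring of entries: differentiation in the field and reciprocals
  of spectral parameters call for complex values, although metrics only occur at real ones.\<close>

definition pencil :: "'a::comm_ring_1^'n^'n \<Rightarrow> 'a^'n^'n \<Rightarrow> 'a \<Rightarrow> 'a^'n^'n"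
  where "pencil G C x = (\<chi> i j. G $ i $ j - x * C $ i $ j)"

lemma pencil_of_real: "pencil G C (complex_of_real \<tau>) = G - \<tau> *\<^sub>R C"
  by (simp add: pencil_def vec_eq_iff) (simp add: scaleR_conv_of_real)

text \<open>A permutation other than the identity moves at least two indices, so after one factor of
  its product is differentiated, another off-diagonal entry of the identity matrix remains, and the
  term vanishes at 0.\<close>

lemma has_field_derivative_det_near_identity:
  fixes M :: "'a::real_normed_field^'n^'n"
  shows "((\<lambda>s. det (pencil (mat 1) M s)) has_field_derivative - trace M) (at 0)"
proof -
  define d where "d i j = (mat 1 :: 'a^'n^'n) $ i $ j" for i j
  have d1: "d i i = 1" and d0: "i \<noteq> j \<Longrightarrow> d i j = 0" for i j by (simp_all add: d_def mat_def)
  have "((\<lambda>s. \<Sum>p | p permutes (UNIV::'n set). of_int (sign p) * (\<Prod>i\<in>UNIV. d i (p i) - s * M $ i $ p i))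
     has_field_derivative (\<Sum>p | p permutes (UNIV::'n set). of_int (sign p) *
       (\<Sum>i\<in>UNIV. - M $ i $ p i * (\<Prod>j\<in>UNIV-{i}. d j (p j) - 0 * M $ j $ p j)))) (at 0)"
    by (intro DERIV_sum DERIV_cmult has_field_derivative_prod)
       (auto intro!: derivative_eq_intros)
  moreover have "(\<Sum>p | p permutes (UNIV::'n set). of_int (sign p) *
       (\<Sum>i\<in>UNIV. - M $ i $ p i * (\<Prod>j\<in>UNIV-{i}. d j (p j) - 0 * M $ j $ p j))) = - trace M"
  proof -
    have "(\<Sum>i\<in>UNIV. - M $ i $ p i * (\<Prod>j\<in>UNIV-{i}. d j (p j) - 0 * M $ j $ p j)) = 0"
      if p: "p permutes UNIV" "p \<noteq> id" for p :: "'n \<Rightarrow> 'n"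
    proof (rule sum.neutral, rule ballI)
      fix i :: 'n
      have "\<exists>j. j \<noteq> i \<and> p j \<noteq> j"
      proof (rule ccontr)
        assume "\<not> ?thesis"
        then have *: "p j = j" if "j \<noteq> i" for j using that by blast
        have "p i = i" using permutes_inj[OF p(1)] *[of "p i"] by (metis injD)
        with * have "p = id" by (metis eq_id_iff)
        then show False using p by simp
      qed
      then obtain j where "j \<in> UNIV - {i}" "d j (p j) - 0 * M $ j $ p j = 0"
        using d0 by (metis DiffI UNIV_I diff_0_right mult_zero_left singletonD)
      then show "- M $ i $ p i * (\<Prod>j\<in>UNIV-{i}. d j (p j) - 0 * M $ j $ p j) = 0"
        by (subst prod_zero) auto
    qed
    then have "(\<Sum>p | p permutes (UNIV::'n set). of_int (sign p) *
       (\<Sum>i\<in>UNIV. - M $ i $ p i * (\<Prod>j\<in>UNIV-{i}. d j (p j) - 0 * M $ j $ p j))) =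
      (\<Sum>p\<in>{id}. of_int (sign p) *
       (\<Sum>i\<in>UNIV. - M $ i $ p i * (\<Prod>j\<in>UNIV-{i}. d j (p j) - 0 * M $ j $ p j)))"
      by (intro sum.mono_neutral_right) (auto simp: permutes_id)
    then show ?thesis by (simp add: d1 trace_def sum_negf)
  qed
  ultimately show ?thesis by (simp add: det_def pencil_def d_def)
qed

text \<open>Jacobi's formula. With \<open>B\<close> the pencil at \<open>x\<close> and
  \<open>M = C ** matrix_inv B\<close>, the pencil at \<open>y\<close> is (1 - (y - x) M) times
  \<open>B\<close>, which reduces the claim to a pencil through the identity.\<close>

lemma has_field_derivative_det_pencil:
  fixes G C :: "'a::real_normed_field^'n^'n"
  assumes "det (pencil G C x) \<noteq> 0"
  shows "((\<lambda>x. det (pencil G C x)) has_field_derivative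
    - (det (pencil G C x) * trace (C ** matrix_inv (pencil G C x)))) (at x)"
proof -
  define B where "B = pencil G C x"
  define M where "M = C ** matrix_inv B"
  have inv: "matrix_inv B ** B = mat 1" using assms by (intro matrix_inv_mult) (simp add: B_def)
  have "pencil G C y = pencil (mat 1) M (y - x) ** B" for y
  proof -
    have "M ** B = C" unfolding M_def by (simp add: matrix_mul_assoc[symmetric] inv)
    have "pencil (mat 1) M (y - x) = mat 1 - (\<chi> i j. (y - x) * M $ i $ j)"
      by (simp add: pencil_def vec_eq_iff)
    then have "pencil (mat 1) M (y - x) ** B = B - (\<chi> i j. (y - x) * M $ i $ j) ** B"
      by (simp add: matrix_diff_rdistrib)
    also have "(\<chi> i j. (y - x) * M $ i $ j) ** B = (\<chi> i j. (y - x) * (M ** B) $ i $ j)"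
      by (simp add: matrix_matrix_mult_def vec_eq_iff sum_distrib_left mult.assoc)
    also have "B - \<dots> = pencil G C y"
      unfolding \<open>M ** B = C\<close> by (simp add: B_def pencil_def vec_eq_iff algebra_simps)
    finally show ?thesis by simp
  qed
  then have eq: "(\<lambda>y. det (pencil G C y)) = (\<lambda>y. det (pencil (mat 1) M (y - x)) * det B)"
    by (simp add: det_mul)
  have "((\<lambda>y. det (pencil (mat 1) M (y - x))) has_field_derivative - trace M) (at x)"
    using DERIV_chain2[where f = "\<lambda>s. det (pencil (mat 1) M s)" and g = "\<lambda>y. y - x" and x = x,
        OF _ DERIV_diff[OF DERIV_ident DERIV_const]] has_field_derivative_det_near_identity[of M]
    by simp
  then have "((\<lambda>y. det (pencil (mat 1) M (y - x)) * det B) has_field_derivative - trace M * det B) (at x)"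
    by (rule DERIV_cmult_right)
  then show ?thesis unfolding eq by (simp add: B_def[symmetric] M_def mult.commute)
qed

text \<open>The determinant of the matrix of linear polynomials may have complex coefficients;
  taking their real parts commutes with evaluation at real points.\<close>

lemma det_pencil_polynomial:
  fixes G C :: "complex^'n^'n"
  obtains P :: "real poly" where "\<And>\<tau>. poly P \<tau> = Re (det (G - \<tau> *\<^sub>R C))"
proof -
  have Re_poly: "poly (map_poly Re Q) \<tau> = Re (poly Q (of_real \<tau>))" for Q and \<tau> :: real
    by (induction Q) (simp_all add: map_poly_pCons)
  define Q where "Q = det (\<chi> i j. [:G $ i $ j, - C $ i $ j:])"
  have "poly Q x = det (pencil G C x)" for x
    unfolding Q_def det_def pencil_def
    by (simp add: poly_sum poly_prod algebra_simps)
  then have "poly (map_poly Re Q) \<tau> = Re (det (G - \<tau> *\<^sub>R C))" for \<tau>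
    by (simp add: Re_poly pencil_of_real)
  then show ?thesis using that by blast
qed

lemma poly_mat_char_poly:
  "poly (mat_char_poly E) x = det (\<chi> i j. (if i = j then x else 0) - E $ i $ j)"
  unfolding mat_char_poly_def det_def
  by (simp add: poly_sum poly_prod if_distrib[of "\<lambda>p. poly p x"] cong: if_cong)

text \<open>Multiplying x - C G^(-1) by \<open>G\<close> gives x G - C, and x can be pulled out of
  each row, which leaves the pencil at 1/x. The transpose in \<open>form_endo\<close> does not
  affect the determinant.\<close>

lemma poly_mat_char_poly_form_endo:
  fixes G C :: "complex^'n^'n"
  assumes "det G \<noteq> 0" "x \<noteq> 0"
  shows "poly (mat_char_poly (form_endo G C)) x = x ^ CARD('n) * det (pencil G C (inverse x)) / det G"
proof -
  define M where "M = C ** matrix_inv G"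
  have "(\<chi> i j. (if i = j then x else 0) - transpose M $ i $ j) =
     transpose (\<chi> i j. (if i = j then x else 0) - M $ i $ j)"
    by (auto simp: transpose_def vec_eq_iff)
  then have "poly (mat_char_poly (form_endo G C)) x = det (\<chi> i j. (if i = j then x else 0) - M $ i $ j)"
    by (simp add: poly_mat_char_poly form_endo_def M_def)
  moreover have "det (\<chi> i j. (if i = j then x else 0) - M $ i $ j) * det G =
      x ^ CARD('n) * det (pencil G C (inverse x))"
  proof -
    have MG: "M ** G = C"
      unfolding M_def using matrix_inv_mult[OF assms(1)] by (simp add: matrix_mul_assoc[symmetric])
    have "(\<chi> i j. (if i = j then x else 0) - M $ i $ j) = (\<chi> i j. (if i = j then x else 0)) - M"
      by (simp add: vec_eq_iff)
    then have "(\<chi> i j. (if i = j then x else 0) - M $ i $ j) ** G =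
        (\<chi> i j. (if i = j then x else 0)) ** G - C"
      by (simp add: matrix_diff_rdistrib MG)
    also have "(\<chi> i j. (if i = j then x else 0)) ** G = (\<chi> i j. x * G $ i $ j)"
      by (simp add: matrix_matrix_mult_def vec_eq_iff if_distrib[of "\<lambda>y. y * _"] cong: if_cong)
    also have "\<dots> - C = (\<chi> i. x *s (pencil G C (inverse x) $ i))"
      using assms(2) by (simp add: vec_eq_iff pencil_def algebra_simps)
    finally have *: "(\<chi> i j. (if i = j then x else 0) - M $ i $ j) ** G =
      (\<chi> i. x *s (pencil G C (inverse x) $ i))" .
    have "(\<chi> i. pencil G C (inverse x) $ i) = pencil G C (inverse x)" by simp
    then show ?thesis
      unfolding det_mul[symmetric] * det_rows_mul by simp
  qed
  ultimately show ?thesis using assms(1) by (simp add: field_simps)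
qed

lemma mat_eigenvalue_iff_root: "mat_eigenvalue E l \<longleftrightarrow> poly (mat_char_poly E) l = 0"
proof -
  define N where "N = (\<chi> i j. (if i = j then l else 0) - E $ i $ j)"
  have N: "N *v v = l *s v - E *v v" for v
    by (simp add: N_def matrix_vector_mult_def vec_eq_iff left_diff_distrib sum_subtractf
        if_distrib[of "\<lambda>y. y * _"] cong: if_cong)
  have "det N = 0 \<longleftrightarrow> (\<exists>v. v \<noteq> 0 \<and> N *v v = 0)"
    using matrix_left_invertible_ker[of N] invertible_det_nz[of N] invertible_left_inverse[of N] by auto
  then show ?thesis
    unfolding mat_eigenvalue_def poly_mat_char_poly N_def[symmetric] N by auto
qed

subsection \<open>Contraction in an adapted frame\<close>

definition block_part :: "complex^'n^'n \<Rightarrow> 'n option \<Rightarrow> 'n option \<Rightarrow> complex"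
  where "block_part S k l = (case (k, l) of (Some i, Some j) \<Rightarrow> S $ i $ j | _ \<Rightarrow> 0)"

lemma block_part_simps [simp]:
  "block_part S None l = 0" "block_part S k None = 0" "block_part S (Some i) (Some j) = S $ i $ j"
  by (auto simp: block_part_def split: option.split)

definition base_part :: "('n \<Rightarrow> complex) \<Rightarrow> 'n option \<Rightarrow> complex"
  where "base_part x k = (case k of None \<Rightarrow> 0 | Some i \<Rightarrow> x i)"

lemma base_part_simps [simp]: "base_part x None = 0" "base_part x (Some i) = x i"
  by (auto simp: base_part_def)

text \<open>The common shape of the induced metric and of its Ricci form: with \<open>t\<close> the
  components of dt, it has a vertical part \<open>a dt dtbar\<close>, mixed parts of dt with base
  forms \<open>x\<close> and \<open>y\<close>, and a base part \<open>S\<close>.\<close>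

definition fibre_matrix ::
  "('n::finite option \<Rightarrow> complex) \<Rightarrow> complex \<Rightarrow> ('n \<Rightarrow> complex) \<Rightarrow> ('n \<Rightarrow> complex) \<Rightarrow> complex^'n^'n \<Rightarrow>
    complex^('n option)^('n option)"
  where "fibre_matrix t a x y S = (\<chi> k l. a * t k * cnj (t l) + base_part x k * cnj (t l) +
     t k * base_part y l + block_part S k l)"

text \<open>The rows of this matrix are the fibre direction and the horizontal directions, which are
  annihilated by the covector t.\<close>

definition frame_matrix :: "('n::finite option \<Rightarrow> complex) \<Rightarrow> complex^('n option)^('n option)"
  where "frame_matrix t = (\<chi> a k. case a of
      None \<Rightarrow> if k = None then 1 else 0
    | Some i \<Rightarrow> if k = None then - t (Some i) / t None else if k = Some i then 1 else 0)"

definition adjoint_matrix :: "complex^'n^'m \<Rightarrow> complex^'m^'n"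
  where "adjoint_matrix P = (\<chi> i j. cnj (P $ j $ i))"

text \<open>The covector \<open>t\<close> vanishes on the horizontal rows, while \<open>x\<close>,
  \<open>y\<close> and \<open>S\<close> have no \<open>None\<close> component and so vanish on the
  fibre direction. Thus each of the four terms lands in a single block.\<close>

lemma frame_fibre_matrix:
  fixes t :: "'n::finite option \<Rightarrow> complex" and a x y S
  assumes "t None \<noteq> 0"
  defines "N \<equiv> frame_matrix t ** fibre_matrix t a x y S ** adjoint_matrix (frame_matrix t)"
  shows "N $ None $ None = a * t None * cnj (t None)"
    and "N $ None $ Some j = t None * y j"
    and "N $ Some i $ None = x i * cnj (t None)"
    and "N $ Some i $ Some j = S $ i $ j"
  using assms(1) unfolding N_def
  by (simp_all add: matrix_matrix_mult_def sum_UNIV_option frame_matrix_def fibre_matrix_def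
      adjoint_matrix_def if_distrib[of cnj] if_distrib[of "\<lambda>x. x * _"] if_distrib[of "\<lambda>x. _ * x"]
      algebra_simps sum.distrib sum_subtractf sum_distrib_left[symmetric] sum_distrib_right[symmetric]
      sum_negf sum_divide_distrib[symmetric] if_distrib[of uminus] if_distrib[of "\<lambda>x. x / _"]
      cong: if_cong)

lemma det_frame_matrix:
  fixes t :: "'n::finite option \<Rightarrow> complex"
  shows "det (frame_matrix t) = 1" "det (adjoint_matrix (frame_matrix t)) = 1"
proof -
  have "(\<chi> i j. frame_matrix t $ Some i $ Some j) = mat 1"
    by (auto simp: frame_matrix_def mat_def vec_eq_iff)
  then show 1: "det (frame_matrix t) = 1"
    by (subst det_option_block) (simp_all add: frame_matrix_def)
  have "adjoint_matrix (frame_matrix t) = transpose (\<chi> i j. cnj (frame_matrix t $ i $ j))"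
    by (simp add: adjoint_matrix_def transpose_def)
  then show "det (adjoint_matrix (frame_matrix t)) = 1"
    by (simp add: det_cnj 1)
qed

lemma det_fibre_metric:
  fixes t :: "'n::finite option \<Rightarrow> complex"
  assumes "t None \<noteq> 0"
  shows "det (fibre_matrix t c (\<lambda>_. 0) (\<lambda>_. 0) B) = c * (cmod (t None))\<^sup>2 * det B"
proof -
  define N where "N = frame_matrix t ** fibre_matrix t c (\<lambda>_. 0) (\<lambda>_. 0) B ** adjoint_matrix (frame_matrix t)"
  note e = frame_fibre_matrix[where t = t, OF assms, of c "\<lambda>_. 0" "\<lambda>_. 0" B, folded N_def]
  have "det (fibre_matrix t c (\<lambda>_. 0) (\<lambda>_. 0) B) = det N"
    by (simp add: N_def det_mul det_frame_matrix)
  also have "\<dots> = N $ None $ None * det (\<chi> i j. N $ Some i $ Some j)"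
    by (rule det_option_block) (simp add: e)
  also have "(\<chi> i j. N $ Some i $ Some j) = B" by (simp add: e vec_eq_iff)
  finally show ?thesis by (simp add: e mult.assoc flip: complex_norm_square)
qed

text \<open>In the adapted frame the metric is block diagonal. Its inverse therefore pairs only the
  diagonal blocks of the second matrix, and the mixed entries \<open>x\<close> and \<open>y\<close>
  drop out of the trace.\<close>

lemma trace_fibre_metric:
  fixes t :: "'n::finite option \<Rightarrow> complex"
  assumes t: "t None \<noteq> 0" and "c \<noteq> 0" and B: "det B \<noteq> 0"
  shows "trace (form_endo (fibre_matrix t c (\<lambda>_. 0) (\<lambda>_. 0) B) (fibre_matrix t a x y S)) =
    a / c + trace (S ** matrix_inv B)"
proof -
  define G where "G = fibre_matrix t c (\<lambda>_. 0) (\<lambda>_. 0) B"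
  define R where "R = fibre_matrix t a x y S"
  define P where "P = frame_matrix t"
  define Q where "Q = adjoint_matrix P"
  define n where "n = t None * cnj (t None)"
  have n: "n \<noteq> 0" using t by (simp add: n_def)
  \<comment> \<open>The inverse of the metric in the adapted frame; undoing the change of frame
    turns it into the inverse \<open>Q ** K ** P\<close> of \<open>G\<close>.\<close>
  define K :: "complex^('n option)^('n option)" where "K = (\<chi> k l. if k = None \<and> l = None then inverse (c * n)
      else block_part (matrix_inv B) k l)"
  have e: "(P ** G ** Q) $ None $ None = c * n" "(P ** G ** Q) $ None $ Some j = 0"
    "(P ** G ** Q) $ Some i $ None = 0" "(P ** G ** Q) $ Some i $ Some j = B $ i $ j" for i j
    using frame_fibre_matrix[where t = t, OF t, of c "\<lambda>_. 0" "\<lambda>_. 0" B] unfolding P_def Q_def G_def n_def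
    by (auto simp: mult.assoc)
  have e': "(P ** R ** Q) $ None $ None = a * n" "(P ** R ** Q) $ Some i $ Some j = S $ i $ j" for i j
    using frame_fibre_matrix[where t = t, OF t, of a x y S] unfolding P_def Q_def R_def n_def
    by (auto simp: mult.assoc)
  have BB: "(\<Sum>k\<in>UNIV. B $ i $ k * matrix_inv B $ k $ j) = (if i = j then 1 else 0)" for i j
    using matrix_inv_mult(1)[OF B] by (simp add: matrix_matrix_mult_def mat_def vec_eq_iff)
  have K: "(P ** G ** Q) ** K = mat 1"
  proof -
    have "((P ** G ** Q) ** K) $ k $ l = (mat 1 :: complex^('n option)^('n option)) $ k $ l" for k l
      using n \<open>c \<noteq> 0\<close>
      unfolding matrix_matrix_mult_def[of "P ** G ** Q" K]
      by (cases k; cases l)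
         (auto simp: sum_UNIV_option e K_def mat_def BB simp del: inverse_mult_distrib cong: if_cong)
    then show ?thesis by (simp add: vec_eq_iff)
  qed
  have dP: "det P \<noteq> 0" by (simp add: P_def det_frame_matrix)
  have "P ** (G ** (Q ** K ** P)) = ((P ** G ** Q) ** K) ** P" by (simp add: matrix_mul_assoc)
  also have "\<dots> = P" by (simp add: K)
  finally have "matrix_inv P ** (P ** (G ** (Q ** K ** P))) = matrix_inv P ** P" by simp
  then have "G ** (Q ** K ** P) = mat 1"
    unfolding matrix_mul_assoc[of "matrix_inv P" P] matrix_inv_mult(2)[OF dP] by simp
  then have inv: "matrix_inv G = Q ** K ** P" by (rule matrix_inv_eqI)
  have "trace (form_endo G R) = trace (R ** matrix_inv G)"
    by (simp add: form_endo_def trace_def transpose_def)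
  also have "\<dots> = trace ((R ** Q ** K) ** P)" by (simp add: inv matrix_mul_assoc)
  also have "\<dots> = trace ((P ** R ** Q) ** K)" by (subst trace_mul_sym) (simp add: matrix_mul_assoc)
  also have "\<dots> = a * n * inverse (c * n) + (\<Sum>i\<in>UNIV. \<Sum>j\<in>UNIV. S $ i $ j * matrix_inv B $ j $ i)"
    unfolding trace_def matrix_matrix_mult_def[of "P ** R ** Q"]
    by (simp add: sum_UNIV_option e' K_def)
  also have "(\<Sum>i\<in>UNIV. \<Sum>j\<in>UNIV. S $ i $ j * matrix_inv B $ j $ i) = trace (S ** matrix_inv B)"
    by (simp add: trace_def matrix_matrix_mult_def)
  finally show ?thesis using n \<open>c \<noteq> 0\<close> by (simp add: G_def R_def field_simps)
qed

section \<open>The scalar curvature of an induced metric\<close>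

lemma scalar_curvature_cong_open:
  assumes "open S" "z \<in> S" "\<And>y. y \<in> S \<Longrightarrow> G y = H y"
  shows "scalar_curvature G z = scalar_curvature H z"
proof -
  have "wirt_bar j (\<lambda>w. complex_of_real (ln (Re (det (G w))))) y =
      wirt_bar j (\<lambda>w. complex_of_real (ln (Re (det (H w))))) y" if "y \<in> S" for j y
    by (rule wirt_cong_open(2)[OF assms(1) that]) (simp add: assms(3))
  then have "wirt i (wirt_bar j (\<lambda>w. complex_of_real (ln (Re (det (G w)))))) z =
      wirt i (wirt_bar j (\<lambda>w. complex_of_real (ln (Re (det (H w)))))) z" for i j
    by (rule wirt_cong_open(1)[OF assms(1,2)])
  then have "ricci_form G z = ricci_form H z"
    by (simp add: ricci_form_def)
  then show ?thesis by (simp add: scalar_curvature_def assms)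
qed

lemma differentiable_of_real:
  "f differentiable (at z) \<Longrightarrow> (\<lambda>x. complex_of_real (f x)) differentiable (at z)"
  using has_derivative_of_real[OF has_derivative_frechet] differentiableI by blast

lemma wirt_real_chain:
  assumes u: "u differentiable (at z)" and h: "(h has_real_derivative d) (at (u z))"
  shows "wirt k (\<lambda>x. complex_of_real (h (u x))) z = of_real d * wirt k (\<lambda>x. complex_of_real (u x)) z"
    and "wirt_bar k (\<lambda>x. complex_of_real (h (u x))) z = of_real d * wirt_bar k (\<lambda>x. complex_of_real (u x)) z"
    and "(\<lambda>x. h (u x)) differentiable (at z)"
proof -
  have c: "((\<lambda>x. h (u x)) has_derivative (\<lambda>v. d * frechet_derivative u (at z) v)) (at z)"
    using diff_chain_at[of u _ z h, OF has_derivative_frechet[OF u]] h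
    by (simp add: has_field_derivative_def o_def)
  note e = has_derivative_of_real[OF c] and e' = has_derivative_of_real[OF has_derivative_frechet[OF u]]
  show "wirt k (\<lambda>x. complex_of_real (h (u x))) z = of_real d * wirt k (\<lambda>x. complex_of_real (u x)) z"
    "wirt_bar k (\<lambda>x. complex_of_real (h (u x))) z = of_real d * wirt_bar k (\<lambda>x. complex_of_real (u x)) z"
    unfolding wirt_eqI[OF e] wirt_eqI[OF e'] wirt_bar_eqI[OF e] wirt_bar_eqI[OF e']
    by (simp_all add: algebra_simps)
  show "(\<lambda>x. h (u x)) differentiable (at z)" using c by (rule differentiableI)
qed

text \<open>The case of \<open>wirt_compose_base\<close> in which the real variable is a dummy, kept
  at 0.\<close>

lemma wirt_base_coord:
  fixes h :: "complex^'m::finite \<Rightarrow> complex"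
  assumes "h differentiable (at (base_coord w))"
  shows "wirt k (\<lambda>w. h (base_coord w)) w = base_part (\<lambda>i. wirt i h (base_coord w)) k"
    and "wirt_bar k (\<lambda>w. h (base_coord w)) w = base_part (\<lambda>i. wirt_bar i h (base_coord w)) k"
proof -
  have "((\<lambda>p::real \<times> _. h (snd p)) has_derivative (\<lambda>v. frechet_derivative h (at (base_coord w)) (snd v)))
     (at (0, base_coord w))"
    by (rule diff_chain_at[of snd snd _ h, unfolded o_def])
       (auto intro!: has_derivative_snd has_derivative_frechet[OF assms])
  then have d: "(\<lambda>p::real \<times> _. h (snd p)) differentiable (at (0, base_coord w))" by (rule differentiableI)
  show "wirt k (\<lambda>w. h (base_coord w)) w = base_part (\<lambda>i. wirt i h (base_coord w)) k"
    "wirt_bar k (\<lambda>w. h (base_coord w)) w = base_part (\<lambda>i. wirt_bar i h (base_coord w)) k"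
    using wirt_compose_base[where \<tau> = "\<lambda>_. 0", OF d differentiable_const, of k]
    by (cases k; simp)+
qed

lemma smooth_fun_on_base_coord:
  fixes h :: "complex^'m::finite \<Rightarrow> 'b::real_normed_vector"
  assumes "smooth_fun_on h U" "open U" "open S" "base_coord ` S \<subseteq> U"
  shows "smooth_fun_on (\<lambda>w. h (base_coord w)) S"
  by (rule smooth_fun_on_compose[OF assms])
     (intro smooth_fun_on_linear_image[OF bounded_linear_base_coord assms(3)] smooth_fun_on_ident)

text \<open>This makes the fibre coordinate an instance of the function \<open>q\<close> in the
  pluriharmonicity lemmas.\<close>

lemma holo_fun_on_fibre_coord: "holo_fun_on (\<lambda>w::complex^'k. w $ k) S"
proof -
  have "((\<lambda>w::complex^'k. w $ k) has_derivative (\<lambda>v. \<Sum>i\<in>UNIV. axis k 1 $ i * v $ i)) (at z)" for z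
  proof -
    have "(\<lambda>v::complex^'k. \<Sum>i\<in>UNIV. axis k 1 $ i * v $ i) = (\<lambda>v. v $ k)"
      by (simp add: axis_def if_distrib[of "\<lambda>x. x * _"] cong: if_cong)
    then show ?thesis
      by (simp add: bounded_linear.has_derivative[OF bounded_linear_vec_nth has_derivative_ident])
  qed
  then show ?thesis unfolding holo_fun_on_def by blast
qed

lemma has_vector_derivative_complex_of_real:
  "(h has_real_derivative d) (at s) \<Longrightarrow>
    ((\<lambda>s. complex_of_real (h s)) has_vector_derivative of_real d) (at s)"
  using has_derivative_of_real[of h "(*) d" "at s"]
  by (simp add: has_field_derivative_def has_vector_derivative_def scaleR_conv_of_real mult.commute)

text \<open>One coordinate patch of the base with one trivialization. \<open>l\<close> is the
  logarithm of the local weight, \<open>C\<close> the curvature form written through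
  \<open>l\<close>, and \<open>F n\<close> the n-th derivative of the profile \<open>F 0\<close>. Of
  the integrals defining the momentum \<open>\<mu>\<close> and the potential \<open>f\<close>, only
  the range of \<open>\<mu>\<close> and the equations \<mu>' = \<open>F 0\<close> (\<mu>) and f' =
  \<mu> are kept, on an open set \<open>J\<close> of times.\<close>

locale momentum_patch =
  fixes U :: "(complex^'m::finite) set" and l :: "complex^'m \<Rightarrow> real"
    and G :: "complex^'m \<Rightarrow> complex^'m^'m" and C :: "complex^'m \<Rightarrow> complex^'m^'m"
    and F :: "nat \<Rightarrow> real \<Rightarrow> real" and \<epsilon> :: real
    and J :: "real set" and \<mu> f :: "real \<Rightarrow> real"
  assumes U: "open U" and l: "smooth_fun_on l U" and G: "smooth_fun_on G U"
    and C: "\<And>z. z \<in> U \<Longrightarrow> C z = (\<chi> i j. - 2 * wirt i (wirt_bar j (\<lambda>z. complex_of_real (l z))) z)"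
    and pos: "\<And>\<tau> z. \<tau> \<in> {0<..<\<epsilon>} \<Longrightarrow> z \<in> U \<Longrightarrow> pos_def_mat (G z - \<tau> *\<^sub>R C z)"
    and F: "\<And>n \<tau>. \<tau> \<in> {0<..<\<epsilon>} \<Longrightarrow> (F n has_real_derivative F (Suc n) \<tau>) (at \<tau>)"
    and F_pos: "\<And>\<tau>. \<tau> \<in> {0<..<\<epsilon>} \<Longrightarrow> 0 < F 0 \<tau>"
    and J: "open J" and \<mu>_in: "\<And>t. t \<in> J \<Longrightarrow> \<mu> t \<in> {0<..<\<epsilon>}"
    and \<mu>: "\<And>t. t \<in> J \<Longrightarrow> (\<mu> has_real_derivative F 0 (\<mu> t)) (at t)"
    and f: "\<And>t. t \<in> J \<Longrightarrow> (f has_real_derivative \<mu> t) (at t)"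
begin

definition logt :: "complex^('m option) \<Rightarrow> real"
  where "logt w = (ln ((cmod (w $ None))\<^sup>2) + l (base_coord w)) / 2"

definition patch :: "(complex^('m option)) set"
  where "patch = {w. w $ None \<noteq> 0 \<and> base_coord w \<in> U}"

definition time_dom :: "(complex^('m option)) set"
  where "time_dom = {w \<in> patch. logt w \<in> J}"

definition dt :: "complex^('m option) \<Rightarrow> 'm option \<Rightarrow> complex"
  where "dt w k = wirt k (\<lambda>w. complex_of_real (logt w)) w"

text \<open>The factor 4 is the 2 in 2 i del delbar f times another 2, because a component matrix
  stands for i/2 times the form.\<close>

definition metric :: "complex^('m option) \<Rightarrow> complex^('m option)^('m option)"
  where "metric w = (\<chi> k l. block_part (G (base_coord w)) k l +
     4 * wirt k (wirt_bar l (\<lambda>w. complex_of_real (f (logt w)))) w)"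

lemma open_patch: "open patch"
proof -
  have "open {w::complex^('m option). w $ None \<noteq> 0}"
    by (intro open_Collect_neq continuous_intros)
  moreover have "open (base_coord -` U :: (complex^('m option)) set)"
    using U by (intro continuous_open_vimage linear_continuous_at bounded_linear_base_coord)
  ultimately have "open ({w. w $ None \<noteq> 0} \<inter> base_coord -` U)" by (rule open_Int)
  then show ?thesis by (simp add: patch_def vimage_def Collect_conj_eq)
qed

lemma smooth_ln_fibre: "smooth_fun_on (\<lambda>w. ln ((cmod (w $ None))\<^sup>2)) patch"
proof -
  \<comment> \<open>In this form the squared modulus is a polynomial in the coordinate and its
    conjugate, to which the closure rules apply; the modulus itself is not smooth at 0.\<close>
  have eq: "(cmod c)\<^sup>2 = Re (c * cnj c)" for c
    by (metis Re_complex_of_real complex_norm_square)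
  have "smooth_fun_on (\<lambda>w::complex^('m option). w $ None) patch"
    by (rule smooth_fun_on_vec_nth[OF open_patch smooth_fun_on_ident])
  moreover have "0 < Re (w $ None * cnj (w $ None))" if "w \<in> patch" for w
    unfolding eq[symmetric] using that by (simp add: patch_def)
  ultimately show ?thesis unfolding eq
    by (intro smooth_fun_on_ln smooth_fun_on_Re smooth_fun_on_mult smooth_fun_on_cnj open_patch)
qed

lemma smooth_l_base: "smooth_fun_on (\<lambda>w. l (base_coord w)) patch"
  by (rule smooth_fun_on_base_coord[OF l U open_patch]) (auto simp: patch_def)

lemma smooth_logt: "smooth_fun_on logt patch"
  unfolding logt_def[abs_def] divide_inverse
  by (intro smooth_fun_on_mult smooth_fun_on_add smooth_fun_on_const smooth_ln_fibre smooth_l_base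
      open_patch)

lemma open_time_dom: "open time_dom"
proof -
  have "open (patch \<inter> logt -` J)"
    using smooth_fun_on_continuous[OF smooth_logt] open_patch J by (rule continuous_open_preimage)
  moreover have "patch \<inter> logt -` J = time_dom" by (auto simp: time_dom_def)
  ultimately show ?thesis by simp
qed

lemma time_dom_patch: "w \<in> time_dom \<Longrightarrow> w \<in> patch" and time_dom_J: "w \<in> time_dom \<Longrightarrow> logt w \<in> J"
  by (auto simp: time_dom_def)

lemma logt_differentiable: "w \<in> patch \<Longrightarrow> logt differentiable (at w)"
  by (rule smooth_fun_on_differentiable[OF smooth_logt])

lemma l_differentiable: "z \<in> U \<Longrightarrow> (\<lambda>z. complex_of_real (l z)) differentiable (at z)"
  by (rule differentiable_of_real[OF smooth_fun_on_differentiable[OF l]])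

lemma wirt_bar_logt:
  assumes "w \<in> patch"
  shows "wirt_bar k (\<lambda>w. complex_of_real (logt w)) w =
    (1 / 2) * wirt_bar k (\<lambda>w. complex_of_real (ln ((cmod (w $ None))\<^sup>2))) w +
    (1 / 2) * base_part (\<lambda>i. wirt_bar i (\<lambda>z. complex_of_real (l z)) (base_coord w)) k"
proof -
  have 1: "(\<lambda>w. complex_of_real (ln ((cmod (w $ None))\<^sup>2))) differentiable (at w)"
    using assms by (intro differentiable_of_real smooth_fun_on_differentiable[OF smooth_ln_fibre])
  have 2: "(\<lambda>w. complex_of_real (l (base_coord w))) differentiable (at w)"
    using assms by (intro differentiable_of_real smooth_fun_on_differentiable[OF smooth_l_base])
  have eq: "(\<lambda>w. complex_of_real (logt w)) = (\<lambda>w. (1 / 2) * (complex_of_real (ln ((cmod (w $ None))\<^sup>2)) +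
      complex_of_real (l (base_coord w))))"
    by (simp add: logt_def fun_eq_iff)
  have lb: "wirt_bar k (\<lambda>w. complex_of_real (l (base_coord w))) w =
      base_part (\<lambda>i. wirt_bar i (\<lambda>z. complex_of_real (l z)) (base_coord w)) k"
    using assms by (intro wirt_base_coord l_differentiable) (simp add: patch_def)
  show ?thesis
    unfolding eq wirt_cmult(2)[OF differentiable_add[OF 1 2]] wirt_add(2)[OF 1 2] lb
    by (rule distrib_left)
qed

lemma wirt_bar_logt_dt:
  "w \<in> patch \<Longrightarrow> wirt_bar k (\<lambda>w. complex_of_real (logt w)) w = cnj (dt w k)"
  unfolding dt_def by (rule wirt_bar_of_real[OF logt_differentiable])

lemma dt_None:
  assumes "w \<in> patch"
  shows "dt w None = 1 / (2 * w $ None)"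
proof -
  have "wirt_bar None (\<lambda>w. complex_of_real (ln ((cmod (w $ None))\<^sup>2))) w = cnj (1 / w $ None)"
  proof -
    have "((\<lambda>w. w $ None) has_derivative (\<lambda>v. v $ None)) (at w)"
      by (rule bounded_linear.has_derivative[OF bounded_linear_vec_nth has_derivative_ident])
    from wirt_eqI[OF this, of None] have "wirt None (\<lambda>w::complex^('m option). w $ None) w = 1"
      by (simp add: axis_def)
    then show ?thesis
      using wirt_bar_ln_norm_holomorphic[OF holo_fun_on_fibre_coord, of w UNIV None None] assms
      by (simp add: patch_def)
  qed
  then have "cnj (dt w None) = cnj (1 / (2 * w $ None))"
    using wirt_bar_logt[OF assms, of None] wirt_bar_logt_dt[OF assms, of None] by simp
  then show ?thesis by (simp only: complex_cnj_cancel_iff)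
qed

lemma wirt_wirt_bar_ln_fibre:
  "w \<in> patch \<Longrightarrow> wirt k (wirt_bar j (\<lambda>w. complex_of_real (ln ((cmod (w $ None))\<^sup>2)))) w = 0"
  using wirt_wirt_bar_ln_norm_holomorphic[OF holo_fun_on_fibre_coord _ open_patch _ smooth_ln_fibre]
  by (simp add: patch_def)

lemma cnj_dt_differentiable:
  assumes "w \<in> patch"
  shows "(\<lambda>w. cnj (dt w k)) differentiable (at w)"
proof -
  have "smooth_fun_on (\<lambda>w. cnj (dt w k)) patch"
    unfolding dt_def by (intro smooth_fun_on_cnj smooth_fun_on_wirt smooth_fun_on_of_real open_patch smooth_logt)
  then show ?thesis using assms by (rule smooth_fun_on_differentiable)
qed

text \<open>As t is half of log r and the fibre term is pluriharmonic, del delbar t is half of del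
  delbar \<open>l\<close>. Since \<open>C\<close> is -2 times the latter, the coefficient is
  -1/4.\<close>

lemma wirt_cnj_dt:
  assumes w: "w \<in> patch"
  shows "wirt k (\<lambda>w. cnj (dt w j)) w = - (1 / 4) * block_part (C (base_coord w)) k j"
proof -
  define h where "h i z = wirt_bar i (\<lambda>z. complex_of_real (l z)) z" for i z
  have bU: "base_coord w \<in> U" using w by (simp add: patch_def)
  have h_smooth: "smooth_fun_on (h i) U" for i
    unfolding h_def[abs_def] by (intro smooth_intros U l)
  define b where "b w = base_part (\<lambda>i. h i (base_coord w)) j" for w :: "complex^('m option)"
  have b: "b differentiable (at w)" "wirt k b w = - (1 / 2) * block_part (C (base_coord w)) k j"
  proof -
    show "b differentiable (at w)"
    proof (cases j)
      case (Some i)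
      have "smooth_fun_on (\<lambda>w. h i (base_coord w)) patch"
        by (rule smooth_fun_on_base_coord[OF h_smooth U open_patch]) (auto simp: patch_def)
      then show ?thesis using smooth_fun_on_differentiable w Some by (auto simp: b_def[abs_def])
    qed (simp add: b_def[abs_def])
    show "wirt k b w = - (1 / 2) * block_part (C (base_coord w)) k j"
    proof (cases j)
      case (Some i)
      then have "b = (\<lambda>w. h i (base_coord w))" by (simp add: b_def[abs_def])
      then have "wirt k b w = base_part (\<lambda>k. wirt k (h i) (base_coord w)) k"
        using wirt_base_coord(1)[OF smooth_fun_on_differentiable[OF h_smooth bU]] by simp
      then show ?thesis using Some by (cases k) (simp_all add: C[OF bU] h_def[abs_def])
    qed (simp add: b_def[abs_def])
  qed
  define a where "a = wirt_bar j (\<lambda>w::complex^('m option). complex_of_real (ln ((cmod (w $ None))\<^sup>2)))"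
  have a: "a differentiable (at w)" "wirt k a w = 0"
  proof -
    have "smooth_fun_on a patch"
      unfolding a_def by (intro smooth_fun_on_wirt_bar smooth_fun_on_of_real open_patch smooth_ln_fibre)
    then show "a differentiable (at w)" using w by (rule smooth_fun_on_differentiable)
    show "wirt k a w = 0" unfolding a_def by (rule wirt_wirt_bar_ln_fibre[OF w])
  qed
  have "wirt k (\<lambda>w. cnj (dt w j)) w = wirt k (\<lambda>w. (1 / 2) * (a w + b w)) w"
    using wirt_bar_logt wirt_bar_logt_dt
    by (intro wirt_cong_open[OF open_patch w]) (simp add: a_def b_def h_def algebra_simps)
  also have "\<dots> = (1 / 2) * (wirt k a w + wirt k b w)"
    unfolding wirt_cmult(1)[OF differentiable_add[OF a(1) b(1)]] wirt_add(1)[OF a(1) b(1)] ..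
  finally show ?thesis by (simp add: a b)
qed

text \<open>Since f' = tau and f'' = d tau / dt = \<open>F 0\<close> (tau), del delbar f(t) is
  \<open>F 0\<close> (tau) dt dtbar + tau del delbar t. Four times the last term is -tau
  \<open>C\<close>, which merges with \<open>G\<close> into the base metric at momentum tau.\<close>

lemma metric_eq:
  assumes w: "w \<in> time_dom"
  defines "\<tau> \<equiv> \<mu> (logt w)"
  shows "metric w = fibre_matrix (dt w) (of_real (4 * F 0 \<tau>)) (\<lambda>_. 0) (\<lambda>_. 0)
    (G (base_coord w) - \<tau> *\<^sub>R C (base_coord w))"
proof -
  have wp: "w \<in> patch" and wJ: "logt w \<in> J" using w by (auto simp: time_dom_def)
  have 1: "wirt k (wirt_bar j (\<lambda>w. complex_of_real (f (logt w)))) w =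
     of_real (F 0 \<tau>) * dt w k * cnj (dt w j) - of_real \<tau> * (1 / 4) * block_part (C (base_coord w)) k j" for k j
  proof -
    have "wirt k (wirt_bar j (\<lambda>w. complex_of_real (f (logt w)))) w =
       wirt k (\<lambda>w. complex_of_real (\<mu> (logt w)) * cnj (dt w j)) w"
    proof (rule wirt_cong_open[OF open_time_dom w])
      fix v assume v: "v \<in> time_dom"
      show "wirt_bar j (\<lambda>w. complex_of_real (f (logt w))) v = complex_of_real (\<mu> (logt v)) * cnj (dt v j)"
        using wirt_real_chain(2)[OF logt_differentiable[OF time_dom_patch[OF v]] f[OF time_dom_J[OF v]]]
          wirt_bar_logt_dt[OF time_dom_patch[OF v]] by simp
    qed
    also have "\<dots> = complex_of_real (\<mu> (logt w)) * wirt k (\<lambda>w. cnj (dt w j)) w +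
       wirt k (\<lambda>w. complex_of_real (\<mu> (logt w))) w * cnj (dt w j)"
      by (intro wirt_mult differentiable_of_real wirt_real_chain(3)[OF logt_differentiable[OF wp] \<mu>[OF wJ]]
          cnj_dt_differentiable wp)
    also have "wirt k (\<lambda>w. complex_of_real (\<mu> (logt w))) w = of_real (F 0 \<tau>) * dt w k"
      using wirt_real_chain(1)[OF logt_differentiable[OF wp] \<mu>[OF wJ]] by (simp add: \<tau>_def dt_def)
    finally show ?thesis by (simp add: wirt_cnj_dt[OF wp] \<tau>_def)
  qed
  have 2: "block_part (G z - \<tau> *\<^sub>R C z) k j = block_part (G z) k j - of_real \<tau> * block_part (C z) k j" for z k j
    by (cases k; cases j; simp) (simp add: scaleR_conv_of_real)
  have 3: "base_part (\<lambda>_. 0) k = 0" for k :: "'m option" by (cases k) simp_all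
  show ?thesis
    by (simp add: metric_def fibre_matrix_def vec_eq_iff 1 2 3)
qed

section \<open>Determinant, Ricci form and scalar curvature of the induced metric on a patch\<close>

definition Dt :: "real \<Rightarrow> complex^'m \<Rightarrow> real"
  where "Dt \<tau> z = Re (det (G z - \<tau> *\<^sub>R C z))"

definition V :: "real \<times> (complex^'m) \<Rightarrow> real"
  where "V p = ln (F 0 (fst p)) + ln (Dt (fst p) (snd p))"

abbreviation "\<Omega> \<equiv> {0<..<\<epsilon>} \<times> U"

lemma Dt_pos: "\<tau> \<in> {0<..<\<epsilon>} \<Longrightarrow> z \<in> U \<Longrightarrow> 0 < Dt \<tau> z"
  unfolding Dt_def by (intro pos_def_mat_det_pos pos)

lemma open_\<Omega>: "open \<Omega>"
  using U by (intro open_Times) auto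

lemma smooth_fst: "smooth_fun_on fst \<Omega>" and smooth_snd: "smooth_fun_on snd \<Omega>"
  using smooth_fun_on_linear_image[OF bounded_linear_fst open_\<Omega> smooth_fun_on_ident]
    smooth_fun_on_linear_image[OF bounded_linear_snd open_\<Omega> smooth_fun_on_ident] by simp_all

lemma smooth_compose_fst:
  "smooth_fun_on (\<lambda>p. F n (fst p)) \<Omega>"
  by (rule smooth_fun_on_compose[OF smooth_fun_on_real_derivative_sequence[of "{0<..<\<epsilon>}" F n, OF _ F] _ open_\<Omega> _ smooth_fst])
     auto

lemma smooth_compose_snd: "smooth_fun_on h U \<Longrightarrow> smooth_fun_on (\<lambda>p. h (snd p)) \<Omega>"
  by (rule smooth_fun_on_compose[OF _ U open_\<Omega> _ smooth_snd]) auto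

lemma smooth_V: "smooth_fun_on V \<Omega>"
proof -
  have G': "smooth_fun_on (\<lambda>p. G (snd p) $ i $ j) \<Omega>" for i j
    by (intro smooth_fun_on_vec_nth open_\<Omega> smooth_compose_snd G)
  have "smooth_fun_on (\<lambda>z. C z $ i $ j) U" for i j
  proof -
    have "smooth_fun_on (\<lambda>z. - 2 * wirt i (wirt_bar j (\<lambda>z. complex_of_real (l z))) z) U"
      by (intro smooth_fun_on_mult smooth_fun_on_const smooth_fun_on_wirt smooth_fun_on_wirt_bar
          smooth_fun_on_of_real l U)
    then show ?thesis by (subst smooth_fun_on_cong[OF U]) (auto simp: C)
  qed
  then have C': "smooth_fun_on (\<lambda>p. C (snd p) $ i $ j) \<Omega>" for i j
    by (rule smooth_compose_snd)
  have "smooth_fun_on (\<lambda>p. (G (snd p) - fst p *\<^sub>R C (snd p)) $ i $ j) \<Omega>" for i j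
    using G' C' open_\<Omega> smooth_fst by (simp, intro smooth_fun_on_diff smooth_fun_on_scaleR)
  then have "smooth_fun_on (\<lambda>p. Dt (fst p) (snd p)) \<Omega>"
    unfolding Dt_def by (intro smooth_fun_on_Re smooth_fun_on_det open_\<Omega>)
  then show ?thesis
    unfolding V_def[abs_def]
    by (intro smooth_fun_on_add smooth_fun_on_ln open_\<Omega> smooth_compose_fst) (auto simp: F_pos Dt_pos)
qed

text \<open>The determinant is 4 \<open>F 0\<close> |\<open>dt w None\<close>|^2 times the base
  determinant. The fibre component of dt is 1 / (2 \<open>w $ None\<close>), so the 4 cancels and
  \<open>V\<close> carries everything except a pluriharmonic term.\<close>

lemma ln_det_metric:
  assumes w: "w \<in> time_dom"
  shows "ln (Re (det (metric w))) = V (\<mu> (logt w), base_coord w) - ln ((cmod (w $ None))\<^sup>2)"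
proof -
  define \<tau> where "\<tau> = \<mu> (logt w)"
  have wp: "w \<in> patch" using w by (rule time_dom_patch)
  have \<tau>: "\<tau> \<in> {0<..<\<epsilon>}" using \<mu>_in[OF time_dom_J[OF w]] by (simp add: \<tau>_def)
  have bU: "base_coord w \<in> U" and w0: "w $ None \<noteq> 0" using wp by (auto simp: patch_def)
  have d: "det (G (base_coord w) - \<tau> *\<^sub>R C (base_coord w)) = of_real (Dt \<tau> (base_coord w))"
    unfolding Dt_def by (rule pos_def_mat_det_pos(2)[OF pos[OF \<tau> bU]])
  have "det (metric w) = of_real (4 * F 0 \<tau>) * (cmod (dt w None))\<^sup>2 * of_real (Dt \<tau> (base_coord w))"
    using w0 by (simp add: metric_eq[OF w] det_fibre_metric dt_None[OF wp] d flip: \<tau>_def)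
  also have "\<dots> = of_real (F 0 \<tau> * Dt \<tau> (base_coord w) / (cmod (w $ None))\<^sup>2)"
    using w0 by (simp add: dt_None[OF wp] norm_divide norm_mult power_mult_distrib power_divide)
  finally have "Re (det (metric w)) = F 0 \<tau> * Dt \<tau> (base_coord w) / (cmod (w $ None))\<^sup>2"
    by simp
  then show ?thesis
    using F_pos[OF \<tau>] Dt_pos[OF \<tau> bU] w0 by (simp add: V_def ln_div ln_mult flip: \<tau>_def)
qed

lemma wirt_compose_momentum:
  assumes H: "smooth_fun_on H \<Omega>" and w: "w \<in> time_dom"
  defines "p \<equiv> (\<mu> (logt w), base_coord w)"
  shows "wirt k (\<lambda>w. H (\<mu> (logt w), base_coord w)) w =
      first_deriv H p * of_real (F 0 (fst p)) * dt w k + base_part (\<lambda>i. wirt i (\<lambda>z. H (fst p, z)) (snd p)) k"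
    and "wirt_bar k (\<lambda>w. H (\<mu> (logt w), base_coord w)) w =
      first_deriv H p * of_real (F 0 (fst p)) * cnj (dt w k) + base_part (\<lambda>i. wirt_bar i (\<lambda>z. H (fst p, z)) (snd p)) k"
    and "(\<lambda>w. H (\<mu> (logt w), base_coord w)) differentiable (at w)"
proof -
  have wp: "w \<in> patch" and wJ: "logt w \<in> J" using w by (auto simp: time_dom_def)
  have p: "p \<in> \<Omega>" using \<mu>_in[OF wJ] wp by (simp add: p_def patch_def)
  have Hd: "H differentiable (at (\<mu> (logt w), base_coord w))"
    using smooth_fun_on_differentiable[OF H p] by (simp add: p_def)
  note ch = wirt_real_chain[OF logt_differentiable[OF wp] \<mu>[OF wJ]]
  show "wirt k (\<lambda>w. H (\<mu> (logt w), base_coord w)) w =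
      first_deriv H p * of_real (F 0 (fst p)) * dt w k + base_part (\<lambda>i. wirt i (\<lambda>z. H (fst p, z)) (snd p)) k"
    "wirt_bar k (\<lambda>w. H (\<mu> (logt w), base_coord w)) w =
      first_deriv H p * of_real (F 0 (fst p)) * cnj (dt w k) + base_part (\<lambda>i. wirt_bar i (\<lambda>z. H (fst p, z)) (snd p)) k"
    using wirt_compose_base[where \<tau> = "\<lambda>w. \<mu> (logt w)", OF Hd ch(3), of k] wirt_bar_logt_dt[OF wp]
    unfolding ch(1,2) by (simp_all add: p_def base_part_def dt_def)
  have "((\<lambda>w. (\<mu> (logt w), base_coord w)) has_derivative
      (\<lambda>v. (frechet_derivative (\<lambda>w. \<mu> (logt w)) (at w) v, base_coord v))) (at w)"
    by (intro has_derivative_Pair has_derivative_frechet ch(3)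
        bounded_linear.has_derivative[OF bounded_linear_base_coord] has_derivative_ident)
  from diff_chain_at[OF this has_derivative_frechet[OF Hd]]
  show "(\<lambda>w. H (\<mu> (logt w), base_coord w)) differentiable (at w)"
    unfolding o_def by (rule differentiableI)
qed

text \<open>The derivative of \<open>V\<close> with respect to t at a fixed base point, since d tau
  / dt = \<open>F 0\<close> (tau).\<close>

definition H1 :: "real \<times> (complex^'m) \<Rightarrow> complex"
  where "H1 p = first_deriv (\<lambda>p. complex_of_real (V p)) p * of_real (F 0 (fst p))"

definition H2 :: "'m \<Rightarrow> real \<times> (complex^'m) \<Rightarrow> complex"
  where "H2 j p = wirt_bar j (\<lambda>z. complex_of_real (V (fst p, z))) (snd p)"

lemma smooth_Vc: "smooth_fun_on (\<lambda>p. complex_of_real (V p)) \<Omega>"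
  by (intro smooth_fun_on_of_real open_\<Omega> smooth_V)

lemma smooth_H1: "smooth_fun_on H1 \<Omega>"
  unfolding H1_def[abs_def] first_deriv_def
  by (intro smooth_fun_on_mult smooth_fun_on_of_real smooth_fun_on_frechet smooth_Vc open_\<Omega> smooth_compose_fst)

text \<open>\<open>H2\<close> is defined on slices of constant momentum. Joint smoothness becomes
  visible once it is rewritten through directional derivatives of \<open>V\<close> along vectors (0,
  v).\<close>

lemma smooth_H2: "smooth_fun_on (H2 j) \<Omega>"
proof -
  have "smooth_fun_on (\<lambda>p. (frechet_derivative (\<lambda>p. complex_of_real (V p)) (at p) (0, axis j 1) +
      \<i> * frechet_derivative (\<lambda>p. complex_of_real (V p)) (at p) (0, axis j \<i>)) * (1 / 2)) \<Omega>"
    by (intro smooth_fun_on_mult smooth_fun_on_add smooth_fun_on_const smooth_fun_on_frechet smooth_Vc open_\<Omega>)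
  moreover have "H2 j p = (frechet_derivative (\<lambda>p. complex_of_real (V p)) (at p) (0, axis j 1) +
      \<i> * frechet_derivative (\<lambda>p. complex_of_real (V p)) (at p) (0, axis j \<i>)) * (1 / 2)"
    if "p \<in> \<Omega>" for p
    using frechet_derivative_second[of "\<lambda>p. complex_of_real (V p)" "fst p" "snd p"]
      smooth_fun_on_differentiable[OF smooth_Vc that]
    by (simp add: H2_def wirt_bar_def)
  ultimately show ?thesis by (subst smooth_fun_on_cong[OF open_\<Omega>])
qed

text \<open>The mixed coefficients are left existential because the trace discards them. The term
  with \<open>C\<close> in the base block is -2 \<open>H1\<close> del delbar t, where del delbar t =
  -\<open>C\<close>/4.\<close>

lemma ricci_metric:
  assumes w: "w \<in> time_dom"
  defines "p \<equiv> (\<mu> (logt w), base_coord w)"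
  obtains x y where "ricci_form metric w = fibre_matrix (dt w) (- 2 * first_deriv H1 p * of_real (F 0 (fst p))) x y
    (\<chi> i j. 1 / 2 * H1 p * C (snd p) $ i $ j + ricci_form (\<lambda>z. G z - fst p *\<^sub>R C z) (snd p) $ i $ j)"
proof -
  have wp: "w \<in> patch" and wJ: "logt w \<in> J" using w by (auto simp: time_dom_def)
  have p: "p \<in> \<Omega>" using \<mu>_in[OF wJ] wp by (simp add: p_def patch_def)
  define x where "x i = wirt i (\<lambda>z. H1 (fst p, z)) (snd p)" for i
  define y where "y j = first_deriv (H2 j) p * of_real (F 0 (fst p))" for j
  have bar: "wirt_bar j (\<lambda>w. complex_of_real (ln (Re (det (metric w))))) v =
      H1 (\<mu> (logt v), base_coord v) * cnj (dt v j) + base_part (\<lambda>j. H2 j (\<mu> (logt v), base_coord v)) j -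
      wirt_bar j (\<lambda>w. complex_of_real (ln ((cmod (w $ None))\<^sup>2))) v" if v: "v \<in> time_dom" for v j
  proof -
    have "wirt_bar j (\<lambda>w. complex_of_real (ln (Re (det (metric w))))) v =
      wirt_bar j (\<lambda>w. complex_of_real (V (\<mu> (logt w), base_coord w)) - complex_of_real (ln ((cmod (w $ None))\<^sup>2))) v"
      by (rule wirt_cong_open[OF open_time_dom v]) (simp add: ln_det_metric)
    also have "\<dots> = wirt_bar j (\<lambda>w. complex_of_real (V (\<mu> (logt w), base_coord w))) v -
       wirt_bar j (\<lambda>w. complex_of_real (ln ((cmod (w $ None))\<^sup>2))) v"
      using v by (intro wirt_diff wirt_compose_momentum(3)[OF smooth_Vc] differentiable_of_real
          smooth_fun_on_differentiable[OF smooth_ln_fibre] time_dom_patch)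
    finally show ?thesis
      using wirt_compose_momentum(2)[OF smooth_Vc v, of j] by (simp add: H1_def H2_def)
  qed
  have W: "wirt k (wirt_bar j (\<lambda>w. complex_of_real (ln (Re (det (metric w)))))) w =
     first_deriv H1 p * of_real (F 0 (fst p)) * dt w k * cnj (dt w j) + base_part x k * cnj (dt w j) +
     dt w k * base_part y j + (- (1 / 4) * H1 p * block_part (C (snd p)) k j +
       block_part (\<chi> i j. wirt i (\<lambda>z. H2 j (fst p, z)) (snd p)) k j)" for k j
  proof -
    define a where "a v = H1 (\<mu> (logt v), base_coord v)" for v
    define b where "b v = base_part (\<lambda>j. H2 j (\<mu> (logt v), base_coord v)) j" for v
    define c where "c = wirt_bar j (\<lambda>w::complex^('m option). complex_of_real (ln ((cmod (w $ None))\<^sup>2)))"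
    have a: "a differentiable (at w)"
      "wirt k a w = first_deriv H1 p * of_real (F 0 (fst p)) * dt w k + base_part x k"
      unfolding a_def[abs_def] x_def[abs_def] p_def
      using wirt_compose_momentum[OF smooth_H1 w] by simp_all
    have b: "b differentiable (at w) \<and>
      wirt k b w = dt w k * base_part y j + block_part (\<chi> i j. wirt i (\<lambda>z. H2 j (fst p, z)) (snd p)) k j"
    proof (cases j)
      case (Some i)
      then have "b = (\<lambda>v. H2 i (\<mu> (logt v), base_coord v))" by (simp add: b_def[abs_def])
      then show ?thesis
        using wirt_compose_momentum(1)[OF smooth_H2[of i] w, of k]
          wirt_compose_momentum(3)[OF smooth_H2[of i] w] Some
        by (cases k) (simp_all add: p_def y_def)
    qed (simp add: b_def[abs_def])
    have c: "c differentiable (at w)" "wirt k c w = 0"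
    proof -
      have "smooth_fun_on c patch"
        unfolding c_def by (intro smooth_fun_on_wirt_bar smooth_fun_on_of_real open_patch smooth_ln_fibre)
      then show "c differentiable (at w)" using wp by (rule smooth_fun_on_differentiable)
      show "wirt k c w = 0" unfolding c_def by (rule wirt_wirt_bar_ln_fibre[OF wp])
    qed
    have "wirt k (wirt_bar j (\<lambda>w. complex_of_real (ln (Re (det (metric w)))))) w =
       wirt k (\<lambda>v. a v * cnj (dt v j) + b v - c v) w"
      by (rule wirt_cong_open[OF open_time_dom w]) (simp add: bar a_def b_def c_def)
    also have "\<dots> = a w * wirt k (\<lambda>v. cnj (dt v j)) w + wirt k a w * cnj (dt w j) + wirt k b w - wirt k c w"
      using a(1) b c(1) cnj_dt_differentiable[OF wp]
      by (simp add: wirt_diff wirt_add wirt_mult differentiable_mult differentiable_add)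
    finally show ?thesis
      using a(2) b c(2) wirt_cnj_dt[OF wp] by (simp add: a_def p_def algebra_simps)
  qed
  have R: "ricci_form (\<lambda>z. G z - fst p *\<^sub>R C z) (snd p) $ i $ j = - 2 * wirt i (\<lambda>z. H2 j (fst p, z)) (snd p)" for i j
  proof -
    have sp: "snd p \<in> U" and fp: "fst p \<in> {0<..<\<epsilon>}" using p by auto
    have "wirt i (wirt_bar j (\<lambda>z. complex_of_real (ln (Re (det (G z - fst p *\<^sub>R C z)))))) (snd p) =
        wirt i (\<lambda>z. H2 j (fst p, z)) (snd p)"
    proof (rule wirt_cong_open[OF U sp])
      fix z assume z: "z \<in> U"
      \<comment> \<open>At fixed momentum ln (\<open>F 0\<close>) is constant on the base, so
        \<open>V\<close> and the logarithm of the base determinant have the same derivatives in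
        z.\<close>
      have e: "(\<lambda>z. complex_of_real (V (fst p, z))) =
        (\<lambda>z. complex_of_real (ln (F 0 (fst p))) + complex_of_real (ln (Re (det (G z - fst p *\<^sub>R C z)))))"
        by (simp add: V_def Dt_def)
      have "(\<lambda>z. complex_of_real (V (fst p, z))) differentiable (at z)"
      proof -
        have "(\<lambda>p. complex_of_real (V p)) differentiable (at (fst p, z))"
          using smooth_fun_on_differentiable[OF smooth_Vc] fp z by simp
        from has_derivative_frechet[OF this]
        show ?thesis
          by (intro differentiableI) (rule diff_chain_at[of "\<lambda>z. (fst p, z)" "\<lambda>v. (0, v)" z, unfolded o_def],
            auto intro!: derivative_eq_intros)
      qed
      from differentiable_diff[OF this differentiable_const[of "complex_of_real (ln (F 0 (fst p)))"]]
      have d: "(\<lambda>z. complex_of_real (ln (Re (det (G z - fst p *\<^sub>R C z))))) differentiable (at z)"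
        by (simp add: V_def Dt_def)
      show "wirt_bar j (\<lambda>z. complex_of_real (ln (Re (det (G z - fst p *\<^sub>R C z))))) z = H2 j (fst p, z)"
        unfolding H2_def using wirt_add(2)[OF differentiable_const d] by (simp add: e)
    qed
    then show ?thesis by (simp add: ricci_form_def)
  qed
  have "ricci_form metric w = fibre_matrix (dt w) (- 2 * first_deriv H1 p * of_real (F 0 (fst p)))
      (\<lambda>i. - 2 * x i) (\<lambda>j. - 2 * y j)
      (\<chi> i j. 1 / 2 * H1 p * C (snd p) $ i $ j + ricci_form (\<lambda>z. G z - fst p *\<^sub>R C z) (snd p) $ i $ j)"
    unfolding ricci_form_def[of metric] fibre_matrix_def
    by (simp add: vec_eq_iff split_option_all W R)
  then show ?thesis by (rule that)
qed

text \<open>Let D be the base determinant, here \<open>P\<close>, and E = (\<open>F 0\<close> D)' /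
  D, the value of \<open>H1\<close> at the base point. The trace formula gives the base scalar
  curvature minus (E' + E D'/D) / 2. As E D = (\<open>F 0\<close> D)', the bracket is (E D)' / D =
  (\<open>F 0\<close> D)'' / D.\<close>

lemma scalar_curvature_metric:
  assumes w: "w \<in> time_dom" and P: "\<And>\<tau>. poly P \<tau> = Dt \<tau> (base_coord w)"
  defines "\<tau> \<equiv> \<mu> (logt w)"
  shows "scalar_curvature metric w =
    scalar_curvature (\<lambda>z. G z - \<tau> *\<^sub>R C z) (base_coord w) -
    of_real ((F 2 \<tau> * poly P \<tau> + 2 * F 1 \<tau> * poly (pderiv P) \<tau> + F 0 \<tau> * poly (pderiv (pderiv P)) \<tau>)
      / (2 * poly P \<tau>))"
proof -
  define z where "z = base_coord w"
  define B where "B = G z - \<tau> *\<^sub>R C z"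
  have wp: "w \<in> patch" and wJ: "logt w \<in> J" using w by (auto simp: time_dom_def)
  have \<tau>: "\<tau> \<in> {0<..<\<epsilon>}" and z: "z \<in> U" using \<mu>_in[OF wJ] wp by (simp_all add: \<tau>_def z_def patch_def)
  have P_pos: "0 < poly P s" if "s \<in> {0<..<\<epsilon>}" for s
    unfolding P using Dt_pos[OF that z] by (simp add: z_def)
  have det_real: "det (G z - s *\<^sub>R C z) = of_real (poly P s)" if "s \<in> {0<..<\<epsilon>}" for s
    using pos_def_mat_det_pos(2)[OF pos[OF that z]] by (simp add: P Dt_def z_def)
  have detB: "det B = of_real (poly P \<tau>)" "det B \<noteq> 0"
    using det_real[OF \<tau>] P_pos[OF \<tau>] by (simp_all add: B_def)
  \<comment> \<open>Jacobi's formula gives the complex derivative of the determinant; along the real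
    axis it is compared with the derivative of the real polynomial \<open>P\<close>.\<close>
  have trC: "trace (C z ** matrix_inv B) = - of_real (poly (pderiv P) \<tau> / poly P \<tau>)"
  proof -
    have "pencil (G z) (C z) (of_real \<tau>) = B" by (simp add: pencil_of_real B_def)
    with has_field_derivative_det_pencil[of "G z" "C z" "of_real \<tau>"] detB(2)
    have "((\<lambda>x. det (pencil (G z) (C z) x)) has_field_derivative
      - (det B * trace (C z ** matrix_inv B))) (at (of_real \<tau>))" by simp
    from has_vector_derivative_real_field[OF this]
    have "((\<lambda>s. det (G z - s *\<^sub>R C z)) has_vector_derivative - (det B * trace (C z ** matrix_inv B))) (at \<tau>)"
      by (simp add: pencil_of_real)
    then have "((\<lambda>s. complex_of_real (poly P s)) has_vector_derivative - (det B * trace (C z ** matrix_inv B))) (at \<tau>)"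
      by (rule has_vector_derivative_transform_within_open[of _ _ _ "{0<..<\<epsilon>}"]) (use \<tau> det_real in auto)
    moreover have "((\<lambda>s. complex_of_real (poly P s)) has_vector_derivative of_real (poly (pderiv P) \<tau>)) (at \<tau>)"
      by (intro has_vector_derivative_complex_of_real poly_DERIV)
    ultimately have "- (det B * trace (C z ** matrix_inv B)) = of_real (poly (pderiv P) \<tau>)"
      by (rule vector_derivative_unique_at)
    then have "complex_of_real (poly P \<tau>) * trace (C z ** matrix_inv B) = - of_real (poly (pderiv P) \<tau>)"
      unfolding detB(1) by (metis minus_minus)
    then show ?thesis using P_pos[OF \<tau>] by (simp add: field_simps)
  qed
  define E where "E s = F 1 s + F 0 s * poly (pderiv P) s / poly P s" for s
  have H1: "H1 (s, z) = of_real (E s)" if s: "s \<in> {0<..<\<epsilon>}" for s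
  proof -
    have "(\<lambda>p. complex_of_real (V p)) differentiable (at (s, z))"
      using smooth_fun_on_differentiable[OF smooth_Vc] s z by simp
    from has_vector_derivative_first_deriv[OF this]
    have "((\<lambda>s. complex_of_real (ln (F 0 s) + ln (poly P s))) has_vector_derivative
      first_deriv (\<lambda>p. complex_of_real (V p)) (s, z)) (at s)"
      by (simp add: V_def P z_def)
    moreover have "((\<lambda>s. complex_of_real (ln (F 0 s) + ln (poly P s))) has_vector_derivative
        complex_of_real (F 1 s / F 0 s + poly (pderiv P) s / poly P s)) (at s)"
      using F_pos[OF s] P_pos[OF s]
      by (intro has_vector_derivative_complex_of_real)
         (auto intro!: derivative_eq_intros F[OF s] poly_DERIV)
    ultimately have "first_deriv (\<lambda>p. complex_of_real (V p)) (s, z) =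
        of_real (F 1 s / F 0 s + poly (pderiv P) s / poly P s)"
      by (rule vector_derivative_unique_at)
    then show ?thesis using F_pos[OF s] by (simp add: H1_def E_def field_simps flip: of_real_mult of_real_add of_real_divide)
  qed
  define E' where "E' = F 2 \<tau> + F 1 \<tau> * poly (pderiv P) \<tau> / poly P \<tau> +
     F 0 \<tau> * (poly (pderiv (pderiv P)) \<tau> / poly P \<tau> - (poly (pderiv P) \<tau> / poly P \<tau>)\<^sup>2)"
  have E': "first_deriv H1 (\<tau>, z) = of_real E'"
  proof -
    have "H1 differentiable (at (\<tau>, z))"
      using smooth_fun_on_differentiable[OF smooth_H1] \<tau> z by simp
    from has_vector_derivative_first_deriv[OF this]
    have "((\<lambda>s. complex_of_real (E s)) has_vector_derivative first_deriv H1 (\<tau>, z)) (at \<tau>)"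
      by (rule has_vector_derivative_transform_within_open[of _ _ _ "{0<..<\<epsilon>}"]) (use \<tau> H1 in auto)
    moreover have "(E has_real_derivative E') (at \<tau>)"
      unfolding E_def[abs_def] E'_def
      using P_pos[OF \<tau>] F[OF \<tau>, of 1] F[OF \<tau>, of 0]
      by (auto intro!: derivative_eq_intros poly_DERIV simp: numeral_2_eq_2 power2_eq_square field_simps)
    then have "((\<lambda>s. complex_of_real (E s)) has_vector_derivative of_real E') (at \<tau>)"
      by (rule has_vector_derivative_complex_of_real)
    ultimately show ?thesis by (rule vector_derivative_unique_at)
  qed
  obtain x y where ricci: "ricci_form metric w =
    fibre_matrix (dt w) (- 2 * first_deriv H1 (\<tau>, z) * of_real (F 0 \<tau>)) x y
      (\<chi> i j. 1 / 2 * H1 (\<tau>, z) * C z $ i $ j + ricci_form (\<lambda>z. G z - \<tau> *\<^sub>R C z) z $ i $ j)"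
    using ricci_metric[OF w] by (auto simp: \<tau>_def z_def)
  have "dt w None \<noteq> 0" using dt_None[OF wp] wp by (simp add: patch_def)
  moreover have "complex_of_real (4 * F 0 \<tau>) \<noteq> 0" using F_pos[OF \<tau>] by simp
  ultimately have "scalar_curvature metric w =
     - 2 * first_deriv H1 (\<tau>, z) * of_real (F 0 \<tau>) / of_real (4 * F 0 \<tau>) +
     trace ((\<chi> i j. 1 / 2 * H1 (\<tau>, z) * C z $ i $ j + ricci_form (\<lambda>z. G z - \<tau> *\<^sub>R C z) z $ i $ j) ** matrix_inv B)"
    unfolding scalar_curvature_def ricci metric_eq[OF w] \<tau>_def[symmetric] z_def[symmetric] B_def[symmetric]
    using detB(2) by (rule trace_fibre_metric)
  also have "- 2 * first_deriv H1 (\<tau>, z) * of_real (F 0 \<tau>) / of_real (4 * F 0 \<tau>) = - of_real (E' / 2)"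
    using F_pos[OF \<tau>] by (simp add: E')
  also have "trace ((\<chi> i j. 1 / 2 * H1 (\<tau>, z) * C z $ i $ j + ricci_form (\<lambda>z. G z - \<tau> *\<^sub>R C z) z $ i $ j) ** matrix_inv B)
     = 1 / 2 * H1 (\<tau>, z) * trace (C z ** matrix_inv B) + trace (ricci_form (\<lambda>z. G z - \<tau> *\<^sub>R C z) z ** matrix_inv B)"
    by (simp add: trace_def matrix_matrix_mult_def sum.distrib sum_distrib_left distrib_right mult.assoc)
  also have "trace (ricci_form (\<lambda>z. G z - \<tau> *\<^sub>R C z) z ** matrix_inv B) = scalar_curvature (\<lambda>z. G z - \<tau> *\<^sub>R C z) z"
    by (simp add: scalar_curvature_def form_endo_def trace_def transpose_def B_def)
  also have "- of_real (E' / 2) + (1 / 2 * H1 (\<tau>, z) * trace (C z ** matrix_inv B) + scalar_curvature (\<lambda>z. G z - \<tau> *\<^sub>R C z) z) =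
     scalar_curvature (\<lambda>z. G z - \<tau> *\<^sub>R C z) z - of_real (E' / 2 + E \<tau> / 2 * (poly (pderiv P) \<tau> / poly P \<tau>))"
    by (simp add: H1[OF \<tau>] trC)
  also have "E' / 2 + E \<tau> / 2 * (poly (pderiv P) \<tau> / poly P \<tau>) =
     (F 2 \<tau> * poly P \<tau> + 2 * F 1 \<tau> * poly (pderiv P) \<tau> + F 0 \<tau> * poly (pderiv (pderiv P)) \<tau>) / (2 * poly P \<tau>)"
    using P_pos[OF \<tau>] by (simp add: E'_def E_def power2_eq_square field_simps)
  finally show ?thesis by (simp add: z_def)
qed

end

section \<open>The momentum map of a profile\<close>

text \<open>The integrands are controlled only inside the interval, as a profile may vanish at its
  ends. The fundamental theorem is therefore applied on a compact subinterval whose ends lie halfway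
  between {c, x} and the end points.\<close>

lemma has_real_derivative_interval_integral:
  fixes g :: "real \<Rightarrow> real"
  assumes g: "continuous_on {a<..<b} g" and c: "c \<in> {a<..<b}" and x: "x \<in> {a<..<b}"
  shows "((\<lambda>u. LBINT y=ereal c..ereal u. g y) has_real_derivative g x) (at x)"
proof -
  define d e where "d = (a + min c x) / 2" and "e = (b + max c x) / 2"
  have de: "a < d" "d < c" "d < x" "c < e" "x < e" "e < b"
    using c x by (auto simp: d_def e_def min_def max_def field_simps)
  have "continuous_on {d..e} g" by (rule continuous_on_subset[OF g]) (use de in auto)
  then have "((\<lambda>u. LBINT y=ereal c..ereal u. g y) has_vector_derivative g x) (at x within {d..e})"
    using de by (intro interval_integral_FTC2) auto
  moreover have "at x within {d..e} = at x"
    using de by (intro at_within_interior) (simp add: interior_atLeastAtMost_real)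
  ultimately show ?thesis by (simp add: has_real_derivative_iff_has_vector_derivative)
qed

locale profile =
  fixes \<phi> :: "real \<Rightarrow> real" and a b \<tau>0 :: real
  assumes cont: "continuous_on {a<..<b} \<phi>" and pos: "\<And>\<tau>. \<tau> \<in> {a<..<b} \<Longrightarrow> 0 < \<phi> \<tau>"
    and base: "\<tau>0 \<in> {a<..<b}"
begin

abbreviation "time \<equiv> profile_time \<phi> \<tau>0"

lemma DERIV_time: "\<tau> \<in> {a<..<b} \<Longrightarrow> (time has_real_derivative 1 / \<phi> \<tau>) (at \<tau>)"
  unfolding profile_time_def[abs_def]
  by (rule has_real_derivative_interval_integral[OF _ base])
     (use pos in \<open>force intro!: continuous_intros cont\<close>)+

lemma time_less:
  assumes "x \<in> {a<..<b}" "y \<in> {a<..<b}" "x < y"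
  shows "time x < time y"
proof (rule DERIV_pos_imp_increasing[OF assms(3)])
  fix u assume "x \<le> u" "u \<le> y"
  then have "u \<in> {a<..<b}" using assms by auto
  then show "\<exists>d. (time has_real_derivative d) (at u) \<and> 0 < d" using DERIV_time pos by fastforce
qed

lemma inj_on_time: "inj_on time {a<..<b}"
  by (rule linorder_inj_onI) (use time_less in \<open>auto simp: less_imp_neq\<close>)

lemma continuous_on_time: "continuous_on {a<..<b} time"
  by (auto intro!: continuous_at_imp_continuous_on DERIV_isCont DERIV_time)

lemma open_time_image: "open (time ` {a<..<b})"
  by (rule invariance_of_domain[OF continuous_on_time _ inj_on_time]) auto

lemma momentum_time: "\<tau> \<in> {a<..<b} \<Longrightarrow> momentum a b \<phi> \<tau>0 (time \<tau>) = \<tau>"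
  unfolding momentum_def by (rule the_equality) (use inj_on_time in \<open>auto dest: inj_onD\<close>)

lemma DERIV_momentum:
  assumes "t \<in> time ` {a<..<b}"
  shows "(momentum a b \<phi> \<tau>0 has_real_derivative \<phi> (momentum a b \<phi> \<tau>0 t)) (at t)"
proof -
  obtain \<tau> where \<tau>: "\<tau> \<in> {a<..<b}" "t = time \<tau>" using assms by auto
  have "(momentum a b \<phi> \<tau>0 has_derivative (*) (\<phi> \<tau>)) (at (time \<tau>))"
  proof (rule has_derivative_inverse_strong[OF _ \<tau>(1) continuous_on_time])
    show "(time has_derivative (*) (1 / \<phi> \<tau>)) (at \<tau>)"
      using DERIV_time[OF \<tau>(1)] by (simp add: has_field_derivative_def)
  qed (use pos[OF \<tau>(1)] momentum_time in \<open>auto simp: fun_eq_iff\<close>)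
  then show ?thesis using \<tau> by (simp add: momentum_time has_field_derivative_def)
qed

lemma DERIV_potential:
  assumes "t \<in> time ` {a<..<b}"
  shows "(potential a b \<phi> \<tau>0 has_real_derivative momentum a b \<phi> \<tau>0 t) (at t)"
proof -
  define \<tau> where "\<tau> = momentum a b \<phi> \<tau>0 t"
  have \<tau>: "\<tau> \<in> {a<..<b}" using assms momentum_time by (auto simp: \<tau>_def)
  have "continuous_on {a<..<b} (\<lambda>x. x / \<phi> x)"
    using pos by (force intro!: continuous_intros cont)
  then have "((\<lambda>u. LBINT x=ereal \<tau>0..ereal u. x / \<phi> x) has_real_derivative \<tau> / \<phi> \<tau>) (at \<tau>)"
    using base \<tau> by (rule has_real_derivative_interval_integral)
  from DERIV_chain2[OF this[unfolded \<tau>_def] DERIV_momentum[OF assms]]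
  show ?thesis unfolding potential_def[abs_def] using pos[OF \<tau>] by (simp add: \<tau>_def)
qed

text \<open>As \<open>time\<close> is increasing, its limit in \<open>ereal\<close> is an infimum,
  also when the integral diverges. The midpoint of \<open>a\<close> and \<open>\<tau>\<close> makes
  the inequality strict. With the matching upper bound this puts every interior momentum level into
  the induced domain.\<close>

lemma time_lower_less:
  assumes \<tau>: "\<tau> \<in> {a<..<b}"
  shows "time_lower a \<phi> \<tau>0 < ereal (time \<tau>)"
proof -
  define m where "m = (INF x\<in>{a<..<b}. ereal (time x))"
  have "((\<lambda>x. ereal (time x)) \<longlongrightarrow> m) (at_right a)"
  proof (rule order_tendstoI)
    fix y assume "y < m"
    moreover have "m \<le> ereal (time x)" if "x \<in> {a<..<b}" for x
      unfolding m_def by (rule INF_lower[OF that])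
    ultimately have "\<forall>x\<in>{a<..<b}. y < ereal (time x)" by (meson less_le_trans)
    then show "eventually (\<lambda>x. y < ereal (time x)) (at_right a)"
      using \<tau> by (auto simp: eventually_at_right_field intro!: exI[of _ b])
  next
    fix y assume "m < y"
    then obtain x where x: "x \<in> {a<..<b}" "ereal (time x) < y" unfolding m_def INF_less_iff by auto
    have "ereal (time u) < y" if "a < u" "u < x" for u
      using time_less[of u x] x that by (meson ereal_less_eq(3) greaterThanLessThan_iff le_less_trans less_imp_le less_trans)
    then show "eventually (\<lambda>x. ereal (time x) < y) (at_right a)"
      using x by (auto simp: eventually_at_right_field intro!: exI[of _ x])
  qed
  then have "time_lower a \<phi> \<tau>0 = m" unfolding time_lower_def by (intro tendsto_Lim) auto
  also have "m \<le> ereal (time ((a + \<tau>) / 2))"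
    unfolding m_def by (rule INF_lower) (use \<tau> in auto)
  also have "\<dots> < ereal (time \<tau>)"
    using \<tau> by (auto intro!: time_less)
  finally show ?thesis .
qed

lemma less_time_upper:
  assumes \<tau>: "\<tau> \<in> {a<..<b}"
  shows "ereal (time \<tau>) < time_upper b \<phi> \<tau>0"
proof -
  define m where "m = (SUP x\<in>{a<..<b}. ereal (time x))"
  have "((\<lambda>x. ereal (time x)) \<longlongrightarrow> m) (at_left b)"
  proof (rule order_tendstoI)
    fix y assume "m < y"
    moreover have "ereal (time x) \<le> m" if "x \<in> {a<..<b}" for x
      unfolding m_def by (rule SUP_upper[OF that])
    ultimately have "\<forall>x\<in>{a<..<b}. ereal (time x) < y" by (meson le_less_trans)
    then show "eventually (\<lambda>x. ereal (time x) < y) (at_left b)"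
      using \<tau> by (auto simp: eventually_at_left_field intro!: exI[of _ a])
  next
    fix y assume "y < m"
    then obtain x where x: "x \<in> {a<..<b}" "y < ereal (time x)" unfolding m_def less_SUP_iff by auto
    have "y < ereal (time u)" if "x < u" "u < b" for u
      using time_less[of x u] x that by (meson ereal_less_eq(3) greaterThanLessThan_iff less_le_trans less_imp_le less_trans)
    then show "eventually (\<lambda>x. y < ereal (time x)) (at_left b)"
      using x by (auto simp: eventually_at_left_field intro!: exI[of _ x])
  qed
  then have "time_upper b \<phi> \<tau>0 = m" unfolding time_upper_def by (intro tendsto_Lim) auto
  have "ereal (time \<tau>) < ereal (time ((b + \<tau>) / 2))"
    using \<tau> by (auto intro!: time_less)
  also have "\<dots> \<le> m"
    unfolding m_def by (rule SUP_upper) (use \<tau> in auto)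
  finally show ?thesis using \<open>time_upper b \<phi> \<tau>0 = m\<close> by simp
qed

end

section \<open>Charts and local weights\<close>

locale hermitian_line_bundle =
  fixes X :: "'a topology" and A :: "('a, 'm::finite) chart set"
    and L :: "'b set" and p :: "'b \<Rightarrow> 'a" and T :: "('a, 'b) triv set" and r :: "'b \<Rightarrow> real"
  assumes manifold: "complex_manifold X A" and line_bundle: "holo_line_bundle X A L p T"
    and norm_sq: "hermitian_norm_sq A L p T r"
begin

lemma inj_on_chart: "c \<in> A \<Longrightarrow> inj_on (snd c) (fst c)"
  and openin_chart: "c \<in> A \<Longrightarrow> openin X (fst c)"
  and open_chart_image: "c \<in> A \<Longrightarrow> openin X S \<Longrightarrow> open (snd c ` (fst c \<inter> S))"
proof -
  assume c: "c \<in> A"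
  obtain V \<psi> where cV: "c = (V, \<psi>)" by (cases c)
  have V: "openin X V" "open (\<psi> ` V)" "homeomorphic_map (subtopology X V) (top_of_set (\<psi> ` V)) \<psi>"
    using manifold c cV unfolding complex_manifold_def by auto
  have sub: "topspace (subtopology X V) = V"
    using openin_subset[OF V(1)] by auto
  show "inj_on (snd c) (fst c)"
    using homeomorphic_imp_injective_map[OF V(3)] unfolding sub by (simp add: cV)
  show "openin X (fst c)" using V by (simp add: cV)
  show "open (snd c ` (fst c \<inter> S))" if S: "openin X S"
  proof -
    have "openin (subtopology X V) (V \<inter> S)"
      using S by (metis openin_subtopology_Int2)
    then have "openin (top_of_set (\<psi> ` V)) (\<psi> ` (V \<inter> S))"
      using homeomorphic_imp_open_map[OF V(3)] unfolding open_map_def by blast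
    then have "open (\<psi> ` (V \<inter> S))" using V(2) openin_open_trans by blast
    then show ?thesis by (simp add: cV)
  qed
qed

lemma chart_inv_chart: "c \<in> A \<Longrightarrow> x \<in> fst c \<Longrightarrow> chart_inv c (snd c x) = x"
  unfolding chart_inv_def by (rule inv_into_f_f[OF inj_on_chart])

lemma openin_triv: "s \<in> T \<Longrightarrow> openin X (fst s)"
  using line_bundle unfolding holo_line_bundle_def by fastforce

lemma triv_bij: "s \<in> T \<Longrightarrow> bij_betw (\<lambda>v. (p v, snd s v)) {v\<in>L. p v \<in> fst s} (fst s \<times> UNIV)"
  using line_bundle unfolding holo_line_bundle_def by fastforce

lemma triv_point:
  assumes "s \<in> T" "x \<in> fst s"
  obtains v where "v \<in> L" "p v = x" "snd s v = \<zeta>"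
proof -
  have "(x, \<zeta>) \<in> (\<lambda>v. (p v, snd s v)) ` {v\<in>L. p v \<in> fst s}"
    using triv_bij[OF assms(1)] assms(2) unfolding bij_betw_def by auto
  then show ?thesis using that by auto
qed

lemma triv_unique:
  assumes "s \<in> T" "p v \<in> fst s" "v \<in> L" "w \<in> L" "p v = p w" "snd s v = snd s w"
  shows "v = w"
  using triv_bij[OF assms(1)] assms unfolding bij_betw_def inj_on_def by auto

lemma chart_triv:
  assumes "c \<in> A" "x \<in> fst c"
  obtains s where "s \<in> T" "x \<in> fst s"
proof -
  have "x \<in> topspace X" using openin_subset[OF openin_chart[OF assms(1)]] assms(2) by auto
  also have "topspace X = (\<Union>s\<in>T. fst s)"
    using line_bundle unfolding holo_line_bundle_def by blast
  finally show ?thesis using that by blast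
qed

lemma weight_pos: "s \<in> T \<Longrightarrow> x \<in> fst s \<Longrightarrow> 0 < local_weight L p r s x"
  using norm_sq unfolding hermitian_norm_sq_def by blast

lemma norm_sq_weight:
  "s \<in> T \<Longrightarrow> v \<in> L \<Longrightarrow> p v \<in> fst s \<Longrightarrow> r v = (cmod (snd s v))\<^sup>2 * local_weight L p r s (p v)"
  using norm_sq unfolding hermitian_norm_sq_def by blast

definition log_weight :: "('a, 'm) chart \<Rightarrow> ('a, 'b) triv \<Rightarrow> complex^'m \<Rightarrow> real"
  where "log_weight c s z = ln (local_weight L p r s (chart_inv c z))"

lemma smooth_log_weight:
  assumes "c \<in> A" "s \<in> T"
  shows "smooth_fun_on (log_weight c s) (snd c ` (fst c \<inter> fst s))"
proof -
  have "smooth_fun_on (\<lambda>z. local_weight L p r s (chart_inv c z)) (snd c ` (fst c \<inter> fst s))"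
    using norm_sq assms unfolding hermitian_norm_sq_def o_def by blast
  then show ?thesis
    unfolding log_weight_def[abs_def]
    by (intro smooth_fun_on_ln open_chart_image openin_triv assms)
       (auto simp: chart_inv_chart assms intro: weight_pos)
qed

lemma ddbar_log_weight:
  assumes c: "c \<in> A" and s: "s \<in> T" "s' \<in> T" and z: "z \<in> snd c ` (fst c \<inter> (fst s \<inter> fst s'))"
  shows "wirt i (wirt_bar j (\<lambda>z. complex_of_real (log_weight c s z))) z =
    wirt i (wirt_bar j (\<lambda>z. complex_of_real (log_weight c s' z))) z"
proof -
  define U where "U = snd c ` (fst c \<inter> (fst s \<inter> fst s'))"
  have U: "open U" "z \<in> U"
    unfolding U_def using z by (auto intro!: open_chart_image openin_Int openin_triv c s)
  have sub: "U \<subseteq> snd c ` (fst c \<inter> fst s)" "U \<subseteq> snd c ` (fst c \<inter> fst s')" by (auto simp: U_def)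
  obtain q where q: "\<And>x. x \<in> fst s \<inter> fst s' \<Longrightarrow> q x \<noteq> 0"
    "holo_fun_on (q \<circ> chart_inv c) U"
    "\<And>v. v \<in> L \<Longrightarrow> p v \<in> fst s \<inter> fst s' \<Longrightarrow> snd s' v = q (p v) * snd s v"
  proof -
    have "\<forall>(V, \<zeta>)\<in>T. \<forall>(V', \<zeta>')\<in>T. \<exists>q :: 'a \<Rightarrow> complex.
       (\<forall>x\<in>V \<inter> V'. q x \<noteq> 0) \<and>
       (\<forall>c\<in>A. holo_fun_on (q \<circ> chart_inv c) (snd c ` (fst c \<inter> (V \<inter> V')))) \<and>
       (\<forall>v\<in>L. p v \<in> V \<inter> V' \<longrightarrow> \<zeta>' v = q (p v) * \<zeta> v)"
      using line_bundle unfolding holo_line_bundle_def by (elim conjE)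
    from this[THEN bspec, OF s(1), unfolded case_prod_unfold, THEN bspec, OF s(2)]
    show ?thesis using that c unfolding U_def by blast
  qed
  define u where "u y = ln ((cmod ((q \<circ> chart_inv c) y))\<^sup>2)" for y
  have q0: "(q \<circ> chart_inv c) y \<noteq> 0" if "y \<in> U" for y
    using that q(1) chart_inv_chart[OF c] by (auto simp: U_def)
  have rel: "log_weight c s y = u y + log_weight c s' y" if "y \<in> U" for y
  proof -
    obtain x where x: "x \<in> fst c" "x \<in> fst s" "x \<in> fst s'" "y = snd c x"
      using \<open>y \<in> U\<close> by (auto simp: U_def)
    obtain v where v: "v \<in> L" "p v = x" "snd s v = 1" using triv_point[OF s(1) x(2)] by metis
    have "local_weight L p r s x = (cmod (q x))\<^sup>2 * local_weight L p r s' x"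
      using norm_sq_weight[OF s(1) v(1)] norm_sq_weight[OF s(2) v(1)] q(3)[OF v(1)] v x by simp
    then show ?thesis
      using q(1)[of x] weight_pos[OF s(2) x(3)] x
      by (simp add: log_weight_def u_def chart_inv_chart[OF c] ln_mult)
  qed
  \<comment> \<open>As a difference of two logarithmic weights, ln |q|^2 is smooth; this supplies
    the regularity from which pluriharmonicity is derived.\<close>
  have u: "smooth_fun_on u U"
  proof -
    have "smooth_fun_on (\<lambda>y. log_weight c s y - log_weight c s' y) U"
      by (intro smooth_fun_on_diff U smooth_fun_on_subset[OF smooth_log_weight] sub c s)
    then show ?thesis by (subst smooth_fun_on_cong[OF U(1)]) (auto simp: rel)
  qed
  have s': "smooth_fun_on (log_weight c s') U"
    by (rule smooth_fun_on_subset[OF smooth_log_weight[OF c s(2)] sub(2)])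
  have "wirt_bar j (\<lambda>z. complex_of_real (log_weight c s z)) y =
     wirt_bar j (\<lambda>z. complex_of_real (u z)) y + wirt_bar j (\<lambda>z. complex_of_real (log_weight c s' z)) y" if y: "y \<in> U" for y
  proof -
    have "wirt_bar j (\<lambda>z. complex_of_real (log_weight c s z)) y =
      wirt_bar j (\<lambda>z. complex_of_real (u z) + complex_of_real (log_weight c s' z)) y"
      by (rule wirt_cong_open[OF U(1) y]) (simp add: rel)
    then show ?thesis
      using wirt_add(2)[OF differentiable_of_real[OF smooth_fun_on_differentiable[OF u y]]
          differentiable_of_real[OF smooth_fun_on_differentiable[OF s' y]]] by simp
  qed
  then have "wirt i (wirt_bar j (\<lambda>z. complex_of_real (log_weight c s z))) z =
     wirt i (\<lambda>y. wirt_bar j (\<lambda>z. complex_of_real (u z)) y + wirt_bar j (\<lambda>z. complex_of_real (log_weight c s' z)) y) z"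
    by (rule wirt_cong_open[OF U])
  also have "\<dots> = wirt i (wirt_bar j (\<lambda>z. complex_of_real (u z))) z +
      wirt i (wirt_bar j (\<lambda>z. complex_of_real (log_weight c s' z))) z"
    by (intro wirt_add smooth_fun_on_differentiable[OF _ U(2)] smooth_fun_on_wirt_bar smooth_fun_on_of_real U u s')
  also have "wirt i (wirt_bar j (\<lambda>z. complex_of_real (u z))) z = 0"
    unfolding u_def
    by (rule wirt_wirt_bar_ln_norm_holomorphic[OF q(2) q0 U u[unfolded u_def]])
  finally show ?thesis by simp
qed

text \<open>The definition chooses a trivialization anew at every point. With one fixed
  \<open>s\<close> on the whole overlap, the form becomes a smooth expression in the
  coordinates.\<close>

lemma curvature_form_eq:
  assumes c: "c \<in> A" and s: "s \<in> T" and z: "z \<in> snd c ` (fst c \<inter> fst s)"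
  shows "curvature_form L p T r c z =
    (\<chi> i j. - 2 * wirt i (wirt_bar j (\<lambda>z. complex_of_real (log_weight c s z))) z)"
proof -
  define s' where "s' = (SOME s. s \<in> T \<and> chart_inv c z \<in> fst s)"
  obtain x where x: "x \<in> fst c" "x \<in> fst s" "z = snd c x" using z by auto
  have "s' \<in> T \<and> chart_inv c z \<in> fst s'"
    unfolding s'_def by (rule someI[of _ s]) (use s x chart_inv_chart[OF c] in auto)
  then have s': "s' \<in> T" "x \<in> fst s'" using x chart_inv_chart[OF c] by auto
  have "curvature_form L p T r c z = (\<chi> i j. - 2 * wirt i (wirt_bar j (\<lambda>z. complex_of_real (log_weight c s' z))) z)"
    unfolding curvature_form_def Let_def s'_def[symmetric] ddbar_form_def log_weight_def
    by (simp add: vec_eq_iff)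
  moreover have "wirt i (wirt_bar j (\<lambda>z. complex_of_real (log_weight c s z))) z =
      wirt i (wirt_bar j (\<lambda>z. complex_of_real (log_weight c s' z))) z" for i j
    by (rule ddbar_log_weight[OF c s s'(1)]) (use x s' in simp)
  ultimately show ?thesis by simp
qed

lemma total_chart_inv:
  assumes c: "c \<in> A" and s: "s \<in> T" and w: "base_coord w \<in> snd c ` (fst c \<inter> fst s)"
  obtains v where "chart_inv (total_chart L p c s) w = v" "v \<in> L" "p v = chart_inv c (base_coord w)"
    "p v \<in> fst c \<inter> fst s" "snd s v = w $ None"
proof -
  obtain x where x: "x \<in> fst c" "x \<in> fst s" "base_coord w = snd c x" using w by auto
  obtain v where v: "v \<in> L" "p v = x" "snd s v = w $ None" using triv_point[OF s x(2)] by metis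
  have im: "snd (total_chart L p c s) v = w"
    using v x(3) by (auto simp: total_chart_def vec_eq_iff base_coord_def split: option.split)
  have inj: "inj_on (snd (total_chart L p c s)) (fst (total_chart L p c s))"
  proof (rule inj_onI)
    fix v v' assume a: "v \<in> fst (total_chart L p c s)" "v' \<in> fst (total_chart L p c s)"
      "snd (total_chart L p c s) v = snd (total_chart L p c s) v'"
    from a(3) have n: "snd s v = snd s v'" and "\<And>i. snd c (p v) $ i = snd c (p v') $ i"
      by (auto simp: total_chart_def vec_eq_iff split_option_all)
    then have "snd c (p v) = snd c (p v')" by (simp add: vec_eq_iff)
    then have "p v = p v'"
      using a(1,2) inj_on_chart[OF c] by (auto simp: total_chart_def inj_on_def)
    then show "v = v'" using triv_unique[OF s] a(1,2) n by (auto simp: total_chart_def)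
  qed
  have "chart_inv (total_chart L p c s) w = v"
    unfolding chart_inv_def im[symmetric]
    by (rule inv_into_f_f[OF inj]) (use v x in \<open>auto simp: total_chart_def\<close>)
  then show ?thesis using that v x chart_inv_chart[OF c] by auto
qed

end

section \<open>From the curvature of the total space to an identity on the base\<close>

context hermitian_line_bundle
begin

text \<open>Every base point carries, over each level \<open>\<tau>\<close> of the open interval, a
  point of the induced domain. The hypothesis on the total space thus becomes, at each base point
  separately, an identity in \<open>\<tau>\<close>.\<close>

lemma scalar_curvature_induced:
  fixes F :: "nat \<Rightarrow> real \<Rightarrow> real"
  assumes g: "\<And>c. c \<in> A \<Longrightarrow> smooth_fun_on (g c) (snd c ` fst c)"
    and pos: "\<And>\<tau>. \<tau> \<in> {0<..<\<epsilon>} \<Longrightarrow> positive_form A (base_metric g L p T r \<tau>)"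
    and F: "\<And>n \<tau>. \<tau> \<in> {0<..<\<epsilon>} \<Longrightarrow> (F n has_real_derivative F (Suc n) \<tau>) (at \<tau>)"
    and F_pos: "\<And>\<tau>. \<tau> \<in> {0<..<\<epsilon>} \<Longrightarrow> 0 < F 0 \<tau>"
    and \<tau>0: "\<tau>0 \<in> {0<..<\<epsilon>}"
    and ind: "induces_scalar_curvature A g L p T r 0 \<epsilon> (F 0) \<tau>0 \<sigma>"
    and c: "c \<in> A" and x: "x \<in> fst c" and \<tau>: "\<tau> \<in> {0<..<\<epsilon>}"
    and P: "\<And>s. poly P s = Re (det (base_metric g L p T r s c (snd c x)))"
  shows "scalar_curvature (base_metric g L p T r \<tau> c) (snd c x) =
    of_real (\<sigma> \<tau> + (F 2 \<tau> * poly P \<tau> + 2 * F 1 \<tau> * poly (pderiv P) \<tau> +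
      F 0 \<tau> * poly (pderiv (pderiv P)) \<tau>) / (2 * poly P \<tau>))"
proof -
  obtain s where s: "s \<in> T" "x \<in> fst s" using chart_triv[OF c x] .
  define U where "U = snd c ` (fst c \<inter> fst s)"
  have xU: "snd c x \<in> U" using x s by (simp add: U_def)
  interpret prof: profile "F 0" 0 \<epsilon> \<tau>0
    by unfold_locales (auto intro!: continuous_at_imp_continuous_on DERIV_isCont[OF F] F_pos simp: \<tau>0[simplified])
  define \<mu> where "\<mu> = momentum 0 \<epsilon> (F 0) \<tau>0"
  define f where "f = potential 0 \<epsilon> (F 0) \<tau>0"
  define J where "J = prof.time ` {0<..<\<epsilon>}"
  interpret patch: momentum_patch U "log_weight c s" "g c" "curvature_form L p T r c" F \<epsilon> J \<mu> f
  proof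
    show "open U" unfolding U_def by (rule open_chart_image[OF c openin_triv[OF s(1)]])
    show "smooth_fun_on (log_weight c s) U" unfolding U_def by (rule smooth_log_weight[OF c s(1)])
    show "smooth_fun_on (g c) U" by (rule smooth_fun_on_subset[OF g[OF c]]) (auto simp: U_def)
    show "pos_def_mat (g c z - \<tau> *\<^sub>R curvature_form L p T r c z)" if "\<tau> \<in> {0<..<\<epsilon>}" "z \<in> U" for \<tau> z
      using pos[OF that(1)] c that(2) unfolding positive_form_def base_metric_def U_def by auto
    show "curvature_form L p T r c z =
      (\<chi> i j. - 2 * wirt i (wirt_bar j (\<lambda>z. complex_of_real (log_weight c s z))) z)" if "z \<in> U" for z
      using that unfolding U_def by (rule curvature_form_eq[OF c s(1)])
    show "open J" unfolding J_def by (rule prof.open_time_image)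
    show "\<mu> t \<in> {0<..<\<epsilon>}" if "t \<in> J" for t
      using that prof.momentum_time by (auto simp: J_def \<mu>_def)
  qed (use F F_pos prof.DERIV_momentum prof.DERIV_potential in \<open>auto simp: J_def \<mu>_def f_def\<close>)
  have logt: "log_norm r (chart_inv (total_chart L p c s) w) = patch.logt w" if "w \<in> patch.patch" for w
  proof -
    have w: "base_coord w \<in> snd c ` (fst c \<inter> fst s)" "w $ None \<noteq> 0"
      using that[unfolded patch.patch_def] by (simp_all add: U_def)
    obtain v where v: "chart_inv (total_chart L p c s) w = v" "v \<in> L" "p v = chart_inv c (base_coord w)"
      "p v \<in> fst c \<inter> fst s" "snd s v = w $ None" using total_chart_inv[OF c s(1) w(1)] .
    have pv: "p v \<in> fst s" using v(4) by simp
    have "ln (r v) = ln ((cmod (w $ None))\<^sup>2) + ln (local_weight L p r s (p v))"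
      unfolding norm_sq_weight[OF s(1) v(2) pv] v(5)
      using w(2) weight_pos[OF s(1) pv] by (simp add: ln_mult)
    then show ?thesis
      unfolding v(1) by (simp add: log_norm_def patch.logt_def log_weight_def v(3))
  qed
  \<comment> \<open>Equality is needed on the whole open patch, since the scalar curvature involves
    derivatives of the metric.\<close>
  have metric: "induced_metric g L p r 0 \<epsilon> (F 0) \<tau>0 c s w = patch.metric w" if w: "w \<in> patch.patch" for w
  proof -
    have "wirt k (wirt_bar l (\<lambda>w. complex_of_real (potential 0 \<epsilon> (F 0) \<tau>0
        (log_norm r (chart_inv (total_chart L p c s) w))))) w =
      wirt k (wirt_bar l (\<lambda>w. complex_of_real (f (patch.logt w)))) w" for k l
    proof (rule wirt_cong_open(1)[OF patch.open_patch w], rule wirt_cong_open(2)[OF patch.open_patch])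
      show "complex_of_real (potential 0 \<epsilon> (F 0) \<tau>0 (log_norm r (chart_inv (total_chart L p c s) y))) =
        complex_of_real (f (patch.logt y))" if "y \<in> patch.patch" for y
        by (simp add: logt[OF that] f_def)
    qed
    then show ?thesis
      unfolding induced_metric_def base_coord_def[symmetric]
      by (simp add: patch.metric_def ddbar_form_def vec_eq_iff block_part_def)
         (simp add: scaleR_conv_of_real)
  qed
  \<comment> \<open>As t = ln r / 2, the level \<open>\<tau>\<close> consists of vectors of squared
    norm exp (2 t) with t the time of \<open>\<tau>\<close>; division by the local weight gives the
    squared modulus of the fibre coordinate.\<close>
  define \<zeta> where "\<zeta> = complex_of_real (sqrt (exp (2 * prof.time \<tau>) / local_weight L p r s x))"
  have h: "0 < local_weight L p r s x" by (rule weight_pos[OF s])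
  have \<zeta>: "(cmod \<zeta>)\<^sup>2 = exp (2 * prof.time \<tau>) / local_weight L p r s x" "\<zeta> \<noteq> 0"
    using h by (simp_all add: \<zeta>_def)
  obtain v where v: "v \<in> L" "p v = x" "snd s v = \<zeta>" using triv_point[OF s] by metis
  have rv: "r v = exp (2 * prof.time \<tau>)"
    using norm_sq_weight[OF s(1) v(1)] v s h \<zeta> by simp
  then have ln_rv: "log_norm r v = prof.time \<tau>" by (simp add: log_norm_def)
  define w where "w = snd (total_chart L p c s) v"
  have w: "w $ None = \<zeta>" "base_coord w = snd c x"
    using v by (simp_all add: w_def total_chart_def base_coord_def vec_eq_iff)
  have wp: "w \<in> patch.patch" using w xU \<zeta> by (simp add: patch.patch_def)
  have lw: "patch.logt w = prof.time \<tau>"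
    using \<zeta> h chart_inv_chart[OF c x]
    by (simp add: patch.logt_def w log_weight_def ln_div)
  have wd: "w \<in> patch.time_dom" unfolding patch.time_dom_def using wp lw \<tau> by (simp add: J_def)
  have m: "\<mu> (patch.logt w) = \<tau>" unfolding lw \<mu>_def by (rule prof.momentum_time[OF \<tau>])
  have "v \<in> induced_domain L r 0 \<epsilon> (F 0) \<tau>0"
    using v rv prof.time_lower_less[OF \<tau>] prof.less_time_upper[OF \<tau>] ln_rv
    by (simp add: induced_domain_def)
  then have "scalar_curvature (induced_metric g L p r 0 \<epsilon> (F 0) \<tau>0 c s) w = of_real (\<sigma> \<tau>)"
    using ind c s x v(2) ln_rv prof.momentum_time[OF \<tau>]
    unfolding induces_scalar_curvature_def w_def by auto
  moreover have "scalar_curvature (induced_metric g L p r 0 \<epsilon> (F 0) \<tau>0 c s) w = scalar_curvature patch.metric w"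
    by (rule scalar_curvature_cong_open[OF patch.open_patch wp metric])
  moreover have "poly P s = patch.Dt s (base_coord w)" for s
    by (simp add: P patch.Dt_def w base_metric_def)
  note patch.scalar_curvature_metric[OF wd this]
  moreover have "base_metric g L p T r \<tau> c = (\<lambda>z. g c z - \<tau> *\<^sub>R curvature_form L p T r c z)"
    by (simp add: base_metric_def fun_eq_iff)
  ultimately show ?thesis
    by (simp add: m w algebra_simps)
qed

end

section \<open>Comparing two profiles\<close>

text \<open>One-sided derivatives on the closed interval become two-sided inside. Continuity up to 0
  is retained because the comparison of two profiles evaluates a conserved quantity there.\<close>

lemma momentum_profile_derivatives:
  assumes "0 < \<epsilon>" "momentum_profile \<phi> {0..<\<epsilon>}"
  obtains F :: "nat \<Rightarrow> real \<Rightarrow> real" where "F 0 = \<phi>"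
    "\<And>n \<tau>. \<tau> \<in> {0<..<\<epsilon>} \<Longrightarrow> (F n has_real_derivative F (Suc n) \<tau>) (at \<tau>)"
    "\<And>\<tau>. \<tau> \<in> {0<..<\<epsilon>} \<Longrightarrow> 0 < \<phi> \<tau>" "continuous_on {0..\<epsilon>} \<phi>"
proof -
  have cl: "closure {0..<\<epsilon>} = {0..\<epsilon>}" using assms(1) by simp
  obtain F where F: "F 0 = \<phi>" "\<And>n \<tau>. \<tau> \<in> {0..\<epsilon>} \<Longrightarrow> (F n has_real_derivative F (Suc n) \<tau>) (at \<tau> within {0..\<epsilon>})"
    using assms(2) unfolding momentum_profile_def smooth_real_on_def cl by metis
  show ?thesis
  proof (rule that[of F])
    show "F 0 = \<phi>" by (rule F(1))
    show "(F n has_real_derivative F (Suc n) \<tau>) (at \<tau>)" if "\<tau> \<in> {0<..<\<epsilon>}" for n \<tau>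
      using F(2)[of \<tau> n] that at_within_Icc_at[of 0 \<tau> \<epsilon>] by auto
    show "0 < \<phi> \<tau>" if "\<tau> \<in> {0<..<\<epsilon>}" for \<tau>
      using assms(2) that by (simp add: momentum_profile_def)
    show "continuous_on {0..\<epsilon>} \<phi>"
      using F by (metis DERIV_continuous_on)
  qed
qed

lemma poly_eq_on_infinite:
  fixes p q :: "'a::idom poly"
  assumes "infinite S" "\<And>x. x \<in> S \<Longrightarrow> poly p x = poly q x"
  shows "p = q"
proof (rule ccontr)
  assume "p \<noteq> q"
  then have "finite {x. poly (p - q) x = 0}" by (intro poly_roots_finite) simp
  moreover have "S \<subseteq> {x. poly (p - q) x = 0}" using assms(2) by auto
  ultimately show False using assms(1) finite_subset by blast
qed

text \<open>The hypothesis says that (P psi)''/P = (Q psi)''/Q. It makes the quantity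
  (Q' P - Q P') psi^2 constant, and this quantity vanishes at 0.\<close>

lemma pencil_determinants_proportional:
  fixes P Q :: "real poly" and \<psi> :: "nat \<Rightarrow> real \<Rightarrow> real"
  assumes P_pos: "\<And>\<tau>. \<tau> \<in> {0<..<\<epsilon>} \<Longrightarrow> 0 < poly P \<tau>"
    and \<psi>: "\<And>n \<tau>. \<tau> \<in> {0<..<\<epsilon>} \<Longrightarrow> (\<psi> n has_real_derivative \<psi> (Suc n) \<tau>) (at \<tau>)"
    and cont: "continuous_on {0..<\<epsilon>} (\<psi> 0)" and \<psi>0: "\<psi> 0 0 = 0"
    and nonzero: "\<tau>1 \<in> {0<..<\<epsilon>}" "\<psi> 0 \<tau>1 \<noteq> 0"
    and eq: "\<And>\<tau>. \<tau> \<in> {0<..<\<epsilon>} \<Longrightarrow>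
      (\<psi> 2 \<tau> * poly P \<tau> + 2 * \<psi> 1 \<tau> * poly (pderiv P) \<tau> + \<psi> 0 \<tau> * poly (pderiv (pderiv P)) \<tau>) * poly Q \<tau> =
      (\<psi> 2 \<tau> * poly Q \<tau> + 2 * \<psi> 1 \<tau> * poly (pderiv Q) \<tau> + \<psi> 0 \<tau> * poly (pderiv (pderiv Q)) \<tau>) * poly P \<tau>"
  obtains \<kappa> where "Q = smult \<kappa> P"
proof -
  define W where "W = pderiv Q * P - Q * pderiv P"
  \<comment> \<open>\<open>K\<close> is the Wronskian of psi P and psi Q. Its derivative is psi
    times (psi Q)'' P - (psi P)'' Q, which vanishes by \<open>eq\<close>.\<close>
  define K where "K \<tau> = poly W \<tau> * (\<psi> 0 \<tau>)\<^sup>2" for \<tau>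
  have W': "poly (pderiv W) \<tau> = poly (pderiv (pderiv Q)) \<tau> * poly P \<tau> - poly Q \<tau> * poly (pderiv (pderiv P)) \<tau>" for \<tau>
    by (simp add: W_def pderiv_mult pderiv_diff algebra_simps)
  have K0: "K \<tau> = 0" if \<tau>: "\<tau> \<in> {0<..<\<epsilon>}" for \<tau>
  proof -
    have "K \<tau> = K 0"
    proof (rule DERIV_isconst_end[of 0 \<tau> K])
      show "0 < \<tau>" using \<tau> by simp
      have "continuous_on {0..\<tau>} (\<psi> 0)" by (rule continuous_on_subset[OF cont]) (use \<tau> in auto)
      then show "continuous_on {0..\<tau>} K" unfolding K_def by (intro continuous_intros)
      fix x assume "0 < x" "x < \<tau>"
      then have x: "x \<in> {0<..<\<epsilon>}" using \<tau> by simp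
      have "(K has_real_derivative poly (pderiv W) x * (\<psi> 0 x)\<^sup>2 + poly W x * (2 * \<psi> 0 x * \<psi> 1 x)) (at x)"
        unfolding K_def[abs_def] using \<psi>[OF x, of 0]
        by (auto intro!: derivative_eq_intros poly_DERIV simp: algebra_simps)
      moreover have "poly (pderiv W) x * (\<psi> 0 x)\<^sup>2 + poly W x * (2 * \<psi> 0 x * \<psi> 1 x) =
        \<psi> 0 x * (poly (pderiv W) x * \<psi> 0 x + 2 * poly W x * \<psi> 1 x)"
        by (simp add: power2_eq_square algebra_simps)
      moreover have "poly (pderiv W) x * \<psi> 0 x + 2 * poly W x * \<psi> 1 x = 0"
        using eq[OF x] unfolding W' by (simp add: W_def algebra_simps)
      ultimately show "(K has_real_derivative 0) (at x)" by simp
    qed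
    then show ?thesis by (simp add: K_def \<psi>0)
  qed
  have "isCont (\<psi> 0) \<tau>1" using \<psi>[OF nonzero(1), of 0] by (rule DERIV_isCont)
  \<comment> \<open>A single zero of \<open>W\<close> would not suffice. Near \<open>\<tau>1\<close>
    the function \<open>\<psi> 0\<close> does not vanish, so \<open>W\<close> has infinitely many
    zeros and is the zero polynomial, whatever zeros \<open>\<psi> 0\<close> has elsewhere.\<close>
  then have "eventually (\<lambda>\<tau>. \<psi> 0 \<tau> \<noteq> 0) (at \<tau>1)"
    using nonzero(2) by (intro tendsto_imp_eventually_ne) (auto simp: isCont_def)
  moreover have "eventually (\<lambda>\<tau>. \<tau> \<in> {0<..<\<epsilon>}) (at \<tau>1)"
    using nonzero(1) by (intro eventually_at_in_open') auto
  ultimately have "eventually (\<lambda>\<tau>. poly W \<tau> = 0) (at \<tau>1)"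
    by eventually_elim (use K0 in \<open>auto simp: K_def\<close>)
  then obtain d where d: "d > 0" "\<And>\<tau>. \<tau> \<noteq> \<tau>1 \<Longrightarrow> dist \<tau> \<tau>1 < d \<Longrightarrow> poly W \<tau> = 0"
    unfolding eventually_at by auto
  have "W = 0"
  proof (rule poly_eq_on_infinite)
    show "infinite {\<tau>1<..<\<tau>1 + d}" using d(1) by (intro infinite_Ioo) simp
    show "poly W x = poly 0 x" if "x \<in> {\<tau>1<..<\<tau>1 + d}" for x
      using that d(2)[of x] by (simp add: dist_real_def)
  qed
  \<comment> \<open>\<open>W\<close> is the numerator of the derivative of Q/P, so this quotient
    keeps its value at \<open>\<tau>1\<close> throughout.\<close>
  define \<kappa> where "\<kappa> = poly Q \<tau>1 / poly P \<tau>1"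
  have const: "poly Q \<tau> / poly P \<tau> = \<kappa>" if \<tau>: "\<tau> \<in> {0<..<\<epsilon>}" for \<tau>
    unfolding \<kappa>_def
  proof (rule DERIV_isconst3[of 0 \<epsilon> \<tau> \<tau>1 "\<lambda>\<tau>. poly Q \<tau> / poly P \<tau>"])
    fix x assume x: "x \<in> {0<..<\<epsilon>}"
    have "((\<lambda>\<tau>. poly Q \<tau> / poly P \<tau>) has_real_derivative poly W x / (poly P x * poly P x)) (at x)"
      using P_pos[OF x] unfolding W_def
      by (auto intro!: derivative_eq_intros poly_DERIV simp: algebra_simps)
    then show "((\<lambda>\<tau>. poly Q \<tau> / poly P \<tau>) has_real_derivative 0) (at x)" by (simp add: \<open>W = 0\<close>)
  qed (use \<tau> nonzero in auto)
  have "poly Q \<tau> = poly (smult \<kappa> P) \<tau>" if "\<tau> \<in> {0<..<\<epsilon>}" for \<tau>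
    using P_pos[OF that] const[OF that] by (simp add: field_simps)
  then have "Q = smult \<kappa> P"
    using nonzero(1) by (intro poly_eq_on_infinite[of "{0<..<\<epsilon>}"] infinite_Ioo) auto
  then show ?thesis by (rule that)
qed

text \<open>Both sides choose from the same set of linear maps, so they agree even where no
  derivative exists. The comparison of Ricci forms thus requires no regularity of the logarithm of
  the determinant.\<close>

lemma frechet_derivative_add_const:
  "frechet_derivative (\<lambda>x. f x + c) (at x) = frechet_derivative f (at x)"
proof -
  have "((\<lambda>x. f x + c) has_derivative D) (at x) \<longleftrightarrow> (f has_derivative D) (at x)" for D
    using has_derivative_add[of f D "at x" "\<lambda>_. c" "\<lambda>_. 0"]
      has_derivative_add[of "\<lambda>x. f x + c" D "at x" "\<lambda>_. - c" "\<lambda>_. 0"] by auto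
  then show ?thesis unfolding frechet_derivative_def by simp
qed

text \<open>Writing the entries of the inverse as quotients of determinants makes their continuity
  in the entries of \<open>M\<close> evident.\<close>

lemma matrix_inv_cramer:
  fixes M :: "'a::field^'n^'n"
  assumes "det M \<noteq> 0"
  shows "matrix_inv M $ k $ j = det (\<chi> i l. if l = k then (if i = j then 1 else 0) else M $ i $ l) / det M"
proof -
  have "M *v (\<chi> k. matrix_inv M $ k $ j) = (\<chi> i. if i = j then 1 else 0)"
    using matrix_inv_mult(1)[OF assms]
    by (simp add: matrix_vector_mult_def matrix_matrix_mult_def mat_def vec_eq_iff)
  then show ?thesis
    unfolding cramer[OF assms] by (simp add: vec_eq_iff cong: if_cong)
qed

lemma tendsto_det:
  fixes M :: "'b \<Rightarrow> 'a::{real_normed_field}^'n^'n"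
  assumes "\<And>i j. ((\<lambda>x. M x $ i $ j) \<longlongrightarrow> N $ i $ j) net"
  shows "((\<lambda>x. det (M x)) \<longlongrightarrow> det N) net"
  unfolding det_def by (intro tendsto_intros assms)

lemma tendsto_trace_matrix_inv:
  fixes M :: "'b \<Rightarrow> 'a::{real_normed_field}^'n^'n"
  assumes M: "\<And>i j. ((\<lambda>x. M x $ i $ j) \<longlongrightarrow> N $ i $ j) net"
    and nz: "\<And>x. det (M x) \<noteq> 0" "det N \<noteq> 0"
  shows "((\<lambda>x. trace (R ** matrix_inv (M x))) \<longlongrightarrow> trace (R ** matrix_inv N)) net"
proof -
  have "((\<lambda>x. matrix_inv (M x) $ k $ j) \<longlongrightarrow> matrix_inv N $ k $ j) net" for k j
    unfolding matrix_inv_cramer[OF nz(1)] matrix_inv_cramer[OF nz(2)]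
    by (intro tendsto_divide tendsto_det M nz) (auto intro: M)
  then show ?thesis
    unfolding trace_def matrix_matrix_mult_def
    by (simp, intro tendsto_sum tendsto_mult tendsto_const)
qed

context hermitian_line_bundle
begin

text \<open>A factor that does not vary over the chart adds the constant \<open>ln k\<close> to the
  logarithm of the determinant, and derivatives remove it.\<close>

lemma base_metric_ricci_const:
  assumes c: "c \<in> A" and x: "x \<in> fst c"
    and factor: "\<And>y. y \<in> fst c \<Longrightarrow> Re (det (base_metric g L p T r \<tau> c (snd c y))) =
      k * Re (det (base_metric g L p T r 0 c (snd c y)))"
    and k: "0 < k" and pos: "\<And>y. y \<in> fst c \<Longrightarrow> 0 < Re (det (base_metric g L p T r 0 c (snd c y)))"
  shows "ricci_form (base_metric g L p T r \<tau> c) (snd c x) = ricci_form (base_metric g L p T r 0 c) (snd c x)"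
proof -
  define U where "U = snd c ` fst c"
  have U: "open U" "snd c x \<in> U"
    using open_chart_image[OF c openin_chart[OF c]] x by (simp_all add: U_def)
  define h where "h \<tau> z = complex_of_real (ln (Re (det (base_metric g L p T r \<tau> c z))))" for \<tau> z
  have h: "h \<tau> z = h 0 z + of_real (ln k)" if "z \<in> U" for z
  proof -
    obtain y where y: "y \<in> fst c" "z = snd c y" using \<open>z \<in> U\<close> by (auto simp: U_def)
    show ?thesis using k pos[OF y(1)] by (simp add: h_def y(2) factor[OF y(1)] ln_mult)
  qed
  have "wirt_bar j (h \<tau>) z = wirt_bar j (h 0) z" if z: "z \<in> U" for j z
  proof -
    have "wirt_bar j (h \<tau>) z = wirt_bar j (\<lambda>z. h 0 z + of_real (ln k)) z"
      by (rule wirt_cong_open(2)[OF U(1) z h])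
    then show ?thesis by (simp add: wirt_bar_def frechet_derivative_add_const)
  qed
  then have "wirt i (wirt_bar j (h \<tau>)) (snd c x) = wirt i (wirt_bar j (h 0)) (snd c x)" for i j
    by (rule wirt_cong_open(1)[OF U])
  then show ?thesis by (simp add: ricci_form_def h_def[abs_def])
qed

end

text \<open>The normalized determinant at \<open>\<tau>\<close> gives the value of the
  characteristic polynomial at \<open>1 / \<tau>\<close>, and the reciprocals of
  \<open>{0<..<\<epsilon>}\<close> are infinitely many.\<close>

lemma mat_char_poly_form_endo_cong:
  fixes G C G' C' :: "complex^'n^'n"
  assumes "0 < \<epsilon>" "det G \<noteq> 0" "det G' \<noteq> 0"
    and ratio: "\<And>\<tau>::real. \<tau> \<in> {0<..<\<epsilon>} \<Longrightarrow> det (G - \<tau> *\<^sub>R C) / det G = det (G' - \<tau> *\<^sub>R C') / det G'"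
  shows "mat_char_poly (form_endo G C) = mat_char_poly (form_endo G' C')"
proof (rule poly_eq_on_infinite)
  have "inj_on (\<lambda>\<tau>::real. inverse (complex_of_real \<tau>)) {0<..<\<epsilon>}" by (auto simp: inj_on_def)
  then show "infinite ((\<lambda>\<tau>::real. inverse (complex_of_real \<tau>)) ` {0<..<\<epsilon>})"
    using infinite_Ioo[OF assms(1)] finite_imageD by blast
  fix x assume "x \<in> (\<lambda>\<tau>::real. inverse (complex_of_real \<tau>)) ` {0<..<\<epsilon>}"
  then obtain \<tau> where \<tau>: "\<tau> \<in> {0<..<\<epsilon>}" "x = inverse (complex_of_real \<tau>)" by auto
  then have x: "x \<noteq> 0" "inverse x = complex_of_real \<tau>" by auto
  show "poly (mat_char_poly (form_endo G C)) x = poly (mat_char_poly (form_endo G' C')) x"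
    using ratio[OF \<tau>(1)]
    unfolding poly_mat_char_poly_form_endo[OF assms(2) x(1)] poly_mat_char_poly_form_endo[OF assms(3) x(1)]
      x(2) pencil_of_real
    by (metis times_divide_eq_right)
qed

theorem theorem5:
  fixes X :: "'a topology" and A :: "('a, 'm::finite) chart set" and g :: "('a, 'm) form11"
    and L :: "'b set" and p :: "'b \<Rightarrow> 'a" and T :: "('a, 'b) triv set" and r :: "'b \<Rightarrow> real"
    and \<epsilon> \<tau>0 :: real and \<sigma>1 \<sigma>2 \<phi>1 \<phi>2 :: "real \<Rightarrow> real"
  assumes "0 < \<epsilon>"
    and "horizontal_data X A g L p T r {0..<\<epsilon>}"
    and "\<tau>0 \<in> {0<..<\<epsilon>}"
    and "real_analytic_fun_on \<sigma>1 {0..<\<epsilon>}" and "real_analytic_fun_on \<sigma>2 {0..<\<epsilon>}"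
    and "momentum_profile \<phi>1 {0..<\<epsilon>}" and "momentum_profile \<phi>2 {0..<\<epsilon>}"
    and "\<exists>\<tau>\<in>{0..<\<epsilon>}. \<phi>1 \<tau> \<noteq> \<phi>2 \<tau>"
    and "\<phi>1 0 = \<phi>2 0"
    and "induces_scalar_curvature A g L p T r 0 \<epsilon> \<phi>1 \<tau>0 \<sigma>1"
    and "induces_scalar_curvature A g L p T r 0 \<epsilon> \<phi>2 \<tau>0 \<sigma>2"
  shows "sigma_constant A g L p T r {0..<\<epsilon>}"
proof -
  interpret hermitian_line_bundle X A L p T r
    using assms(2) by unfold_locales (simp_all add: horizontal_data_def)
  have g: "smooth_fun_on (g c) (snd c ` fst c)" if "c \<in> A" for c
    using assms(2) that by (simp add: horizontal_data_def kaehler_metric_def)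
  have pos: "positive_form A (base_metric g L p T r \<tau>)" if "\<tau> \<in> {0..<\<epsilon>}" for \<tau>
    using assms(2) that by (simp add: horizontal_data_def)
  obtain F1 where F1: "F1 0 = \<phi>1"
    "\<And>n \<tau>. \<tau> \<in> {0<..<\<epsilon>} \<Longrightarrow> (F1 n has_real_derivative F1 (Suc n) \<tau>) (at \<tau>)"
    "\<And>\<tau>. \<tau> \<in> {0<..<\<epsilon>} \<Longrightarrow> 0 < \<phi>1 \<tau>" "continuous_on {0..\<epsilon>} \<phi>1"
    using momentum_profile_derivatives[OF assms(1,6)] by metis
  obtain F2 where F2: "F2 0 = \<phi>2"
    "\<And>n \<tau>. \<tau> \<in> {0<..<\<epsilon>} \<Longrightarrow> (F2 n has_real_derivative F2 (Suc n) \<tau>) (at \<tau>)"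
    "\<And>\<tau>. \<tau> \<in> {0<..<\<epsilon>} \<Longrightarrow> 0 < \<phi>2 \<tau>" "continuous_on {0..\<epsilon>} \<phi>2"
    using momentum_profile_derivatives[OF assms(1,7)] by metis
  define G where "G \<tau> c x = base_metric g L p T r \<tau> c (snd c x)" for \<tau> c x
  have G_pencil: "G \<tau> c x = g c (snd c x) - \<tau> *\<^sub>R curvature_form L p T r c (snd c x)" for \<tau> c x
    by (simp add: G_def base_metric_def)
  have "\<exists>P. \<forall>s. poly P s = Re (det (G s c x))" for c x
    unfolding G_pencil by (rule det_pencil_polynomial) blast
  then obtain P where P: "\<And>c x s. poly (P c x) s = Re (det (G s c x))" by metis
  have det_pos: "0 < poly (P c x) \<tau>" "det (G \<tau> c x) = of_real (poly (P c x) \<tau>)"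
    if "c \<in> A" "x \<in> fst c" "\<tau> \<in> {0..<\<epsilon>}" for c x \<tau>
    using pos_def_mat_det_pos[of "G \<tau> c x"] pos[OF that(3)] that(1,2)
    by (simp_all add: P positive_form_def G_def)
  define N where "N F Q \<tau> = F 2 \<tau> * poly Q \<tau> + 2 * F 1 \<tau> * poly (pderiv Q) \<tau> +
    F 0 \<tau> * poly (pderiv (pderiv Q)) \<tau>" for F :: "nat \<Rightarrow> real \<Rightarrow> real" and Q and \<tau> :: real
  have R: "scalar_curvature (base_metric g L p T r \<tau> c) (snd c x) =
      of_real (\<sigma> \<tau> + N F (P c x) \<tau> / (2 * poly (P c x) \<tau>))"
    if F: "\<And>n \<tau>. \<tau> \<in> {0<..<\<epsilon>} \<Longrightarrow> (F n has_real_derivative F (Suc n) \<tau>) (at \<tau>)"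
      "\<And>\<tau>. \<tau> \<in> {0<..<\<epsilon>} \<Longrightarrow> 0 < F 0 \<tau>"
      "induces_scalar_curvature A g L p T r 0 \<epsilon> (F 0) \<tau>0 \<sigma>"
      and cx: "c \<in> A" "x \<in> fst c" and \<tau>: "\<tau> \<in> {0<..<\<epsilon>}" for F \<sigma> c x \<tau>
    unfolding N_def
  proof (rule scalar_curvature_induced[where F = F and \<sigma> = \<sigma> and g = g and \<epsilon> = \<epsilon>, OF g _ _ _ assms(3) F(3) cx \<tau>])
    show "poly (P c x) s = Re (det (base_metric g L p T r s c (snd c x)))" for s
      by (simp add: P G_def)
  qed (use pos F in auto)
  have R1: "scalar_curvature (base_metric g L p T r \<tau> c) (snd c x) =
      of_real (\<sigma>1 \<tau> + N F1 (P c x) \<tau> / (2 * poly (P c x) \<tau>))"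
    if "c \<in> A" "x \<in> fst c" "\<tau> \<in> {0<..<\<epsilon>}" for c x \<tau>
    by (rule R[of F1 \<sigma>1, OF F1(2) _ _ that]) (use F1 assms(10) in auto)
  have R2: "scalar_curvature (base_metric g L p T r \<tau> c) (snd c x) =
      of_real (\<sigma>2 \<tau> + N F2 (P c x) \<tau> / (2 * poly (P c x) \<tau>))"
    if "c \<in> A" "x \<in> fst c" "\<tau> \<in> {0<..<\<epsilon>}" for c x \<tau>
    by (rule R[of F2 \<sigma>2, OF F2(2) _ _ that]) (use F2 assms(11) in auto)
  define \<psi> where "\<psi> n \<tau> = F1 n \<tau> - F2 n \<tau>" for n \<tau>
  \<comment> \<open>Since the profiles agree at 0, a point where they differ lies in the open
    interval, where both are differentiable.\<close>
  obtain \<tau>1 where \<tau>1: "\<tau>1 \<in> {0<..<\<epsilon>}" "\<psi> 0 \<tau>1 \<noteq> 0"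
  proof -
    obtain \<tau> where \<tau>: "\<tau> \<in> {0..<\<epsilon>}" "\<phi>1 \<tau> \<noteq> \<phi>2 \<tau>" using assms(8) by auto
    then have "\<tau> \<noteq> 0" using assms(9) by metis
    with \<tau> show ?thesis using that[of \<tau>] by (simp add: \<psi>_def F1(1) F2(1))
  qed
  have proportional: "\<exists>\<kappa>. P c' x' = smult \<kappa> (P c x)"
    if cx: "c \<in> A" "x \<in> fst c" "c' \<in> A" "x' \<in> fst c'" for c x c' x'
  proof (rule pencil_determinants_proportional[of \<epsilon> "P c x" \<psi> \<tau>1 "P c' x'"])
    show "continuous_on {0..<\<epsilon>} (\<psi> 0)"
      unfolding \<psi>_def F1(1) F2(1)
      by (intro continuous_intros continuous_on_subset[OF F1(4)] continuous_on_subset[OF F2(4)]) auto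
    show "(\<psi> n has_real_derivative \<psi> (Suc n) \<tau>) (at \<tau>)" if "\<tau> \<in> {0<..<\<epsilon>}" for n \<tau>
      unfolding \<psi>_def[abs_def] by (intro DERIV_diff F1(2) F2(2) that)
    show "\<psi> 0 0 = 0" by (simp add: \<psi>_def F1(1) F2(1) assms(9))
    fix \<tau> assume \<tau>: "\<tau> \<in> {0<..<\<epsilon>}"
    then have \<tau>': "\<tau> \<in> {0..<\<epsilon>}" by simp
    note d = det_pos(1)[OF cx(1,2) \<tau>'] det_pos(1)[OF cx(3,4) \<tau>']
    show "0 < poly (P c x) \<tau>" by (rule d(1))
    have N_diff: "N \<psi> Q \<tau> = N F1 Q \<tau> - N F2 Q \<tau>" for Q
      by (simp add: N_def \<psi>_def algebra_simps)
    have "N \<psi> (P c x) \<tau> / (2 * poly (P c x) \<tau>) = \<sigma>2 \<tau> - \<sigma>1 \<tau>"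
      using R1[OF cx(1,2) \<tau>] R2[OF cx(1,2) \<tau>] unfolding N_diff diff_divide_distrib
      by (simp del: of_real_add)
    moreover have "N \<psi> (P c' x') \<tau> / (2 * poly (P c' x') \<tau>) = \<sigma>2 \<tau> - \<sigma>1 \<tau>"
      using R1[OF cx(3,4) \<tau>] R2[OF cx(3,4) \<tau>] unfolding N_diff diff_divide_distrib
      by (simp del: of_real_add)
    ultimately have "N \<psi> (P c x) \<tau> / (2 * poly (P c x) \<tau>) = N \<psi> (P c' x') \<tau> / (2 * poly (P c' x') \<tau>)"
      by simp
    then have "N \<psi> (P c x) \<tau> * poly (P c' x') \<tau> = N \<psi> (P c' x') \<tau> * poly (P c x) \<tau>"
      using d by (simp add: field_simps)
    then show "(\<psi> 2 \<tau> * poly (P c x) \<tau> + 2 * \<psi> 1 \<tau> * poly (pderiv (P c x)) \<tau> +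
        \<psi> 0 \<tau> * poly (pderiv (pderiv (P c x))) \<tau>) * poly (P c' x') \<tau> =
      (\<psi> 2 \<tau> * poly (P c' x') \<tau> + 2 * \<psi> 1 \<tau> * poly (pderiv (P c' x')) \<tau> +
        \<psi> 0 \<tau> * poly (pderiv (pderiv (P c' x'))) \<tau>) * poly (P c x) \<tau>"
      by (simp add: N_def)
  qed (use \<tau>1 in auto)
  have zero: "0 \<in> {0..<\<epsilon>}" using assms(1) by simp
  \<comment> \<open>As a consequence of a polynomial identity this holds for every real
    \<open>\<tau>\<close>; the form without quotients needs no positivity.\<close>
  have ratio: "poly (P c' x') \<tau> * poly (P c x) 0 = poly (P c x) \<tau> * poly (P c' x') 0"
    if "c \<in> A" "x \<in> fst c" "c' \<in> A" "x' \<in> fst c'" for c x c' x' \<tau>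
    using proportional[OF that] by auto
  have char_poly: "mat_char_poly (form_endo (g c (snd c x)) (curvature_form L p T r c (snd c x))) =
      mat_char_poly (form_endo (g c' (snd c' x')) (curvature_form L p T r c' (snd c' x')))"
    if cx: "c \<in> A" "x \<in> fst c" "c' \<in> A" "x' \<in> fst c'" for c x c' x'
  proof (rule mat_char_poly_form_endo_cong[OF assms(1)])
    have g0: "g c (snd c x) = G 0 c x" for c x by (simp add: G_pencil)
    note d = det_pos(1)[OF cx(1,2) zero] det_pos(1)[OF cx(3,4) zero]
    show "det (g c (snd c x)) \<noteq> 0" "det (g c' (snd c' x')) \<noteq> 0"
      using d by (simp_all add: g0 det_pos(2)[OF cx(1,2) zero] det_pos(2)[OF cx(3,4) zero])
    fix \<tau> assume "\<tau> \<in> {0<..<\<epsilon>}"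
    then have \<tau>: "\<tau> \<in> {0..<\<epsilon>}" by simp
    have "poly (P c x) \<tau> / poly (P c x) 0 = poly (P c' x') \<tau> / poly (P c' x') 0"
      using d ratio[OF cx, of \<tau>] by (simp add: field_simps)
    then show "det (g c (snd c x) - \<tau> *\<^sub>R curvature_form L p T r c (snd c x)) / det (g c (snd c x)) =
      det (g c' (snd c' x') - \<tau> *\<^sub>R curvature_form L p T r c' (snd c' x')) / det (g c' (snd c' x'))"
      unfolding G_pencil[symmetric]
      unfolding g0 det_pos(2)[OF cx(1,2) \<tau>] det_pos(2)[OF cx(3,4) \<tau>]
        det_pos(2)[OF cx(1,2) zero] det_pos(2)[OF cx(3,4) zero]
      by (simp flip: of_real_divide)
  qed
  define S where "S \<tau> c x = scalar_curvature (base_metric g L p T r \<tau> c) (snd c x)" for \<tau> c x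
  have S_eq: "S \<tau> c x = S \<tau> c' x'"
    if cx: "c \<in> A" "x \<in> fst c" "c' \<in> A" "x' \<in> fst c'" and \<tau>: "\<tau> \<in> {0<..<\<epsilon>}" for c x c' x' \<tau>
  proof -
    obtain \<kappa> where \<kappa>: "P c' x' = smult \<kappa> (P c x)" using proportional[OF cx] by auto
    have "\<kappa> \<noteq> 0" using det_pos(1)[OF cx(3,4) zero] \<kappa> by auto
    \<comment> \<open>\<open>N\<close> is linear in the polynomial, so the factor
      \<open>\<kappa>\<close> cancels against the denominator.\<close>
    then have "N F1 (P c' x') \<tau> / (2 * poly (P c' x') \<tau>) = N F1 (P c x) \<tau> / (2 * poly (P c x) \<tau>)"
      using det_pos(1)[OF cx(1,2), of \<tau>] \<tau> by (simp add: \<kappa> N_def pderiv_smult field_simps)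
    then show ?thesis unfolding S_def R1[OF cx(1,2) \<tau>] R1[OF cx(3,4) \<tau>] by simp
  qed
  have S_lim: "((\<lambda>\<tau>. S \<tau> c x) \<longlongrightarrow> S 0 c x) (at_right 0)" if cx: "c \<in> A" "x \<in> fst c" for c x
  proof -
    have ricci: "ricci_form (base_metric g L p T r \<tau> c) (snd c x) = ricci_form (base_metric g L p T r 0 c) (snd c x)"
      if \<tau>: "\<tau> \<in> {0<..<\<epsilon>}" for \<tau>
    proof (rule base_metric_ricci_const[OF cx])
      show "0 < poly (P c x) \<tau> / poly (P c x) 0"
        using det_pos(1)[OF cx, of \<tau>] det_pos(1)[OF cx zero] \<tau> by simp
      fix y assume y: "y \<in> fst c"
      show "0 < Re (det (base_metric g L p T r 0 c (snd c y)))"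
        using det_pos(1)[OF cx(1) y zero] by (simp add: P G_def)
      show "Re (det (base_metric g L p T r \<tau> c (snd c y))) =
          poly (P c x) \<tau> / poly (P c x) 0 * Re (det (base_metric g L p T r 0 c (snd c y)))"
        using ratio[OF cx cx(1) y, of \<tau>] det_pos(1)[OF cx zero]
        unfolding G_def[symmetric] P[symmetric] by (simp add: field_simps)
    qed
    \<comment> \<open>The default value \<open>G 0 c x\<close> keeps the determinant nonzero for
      every real parameter, as \<open>tendsto_trace_matrix_inv\<close> demands; near 0 from the
      right \<open>M\<close> is the actual metric.\<close>
    define M where "M \<tau> = (if \<tau> \<in> {0<..<\<epsilon>} then G \<tau> c x else G 0 c x)" for \<tau>
    have ev: "eventually (\<lambda>\<tau>. \<tau> \<in> {0<..<\<epsilon>}) (at_right 0)"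
      using assms(1) by (auto simp: eventually_at_right_field)
    have lim: "((\<lambda>\<tau>. trace (ricci_form (base_metric g L p T r 0 c) (snd c x) ** matrix_inv (M \<tau>))) \<longlongrightarrow>
       trace (ricci_form (base_metric g L p T r 0 c) (snd c x) ** matrix_inv (G 0 c x))) (at_right 0)"
    proof (rule tendsto_trace_matrix_inv)
      show "det (M \<tau>) \<noteq> 0" for \<tau>
        using det_pos[OF cx, of \<tau>] det_pos[OF cx zero] by (auto simp: M_def)
      show "det (G 0 c x) \<noteq> 0" using det_pos[OF cx zero] by simp
      fix i j
      have "((\<lambda>\<tau>. G \<tau> c x $ i $ j) \<longlongrightarrow> G 0 c x $ i $ j) (at_right 0)"
        unfolding G_pencil by (auto intro!: tendsto_eq_intros)
      then show "((\<lambda>\<tau>. M \<tau> $ i $ j) \<longlongrightarrow> G 0 c x $ i $ j) (at_right 0)"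
        by (rule Lim_transform_eventually) (use ev in \<open>eventually_elim, simp add: M_def\<close>)
    qed
    have trace_R: "S \<tau> c x = trace (ricci_form (base_metric g L p T r \<tau> c) (snd c x) ** matrix_inv (G \<tau> c x))" for \<tau>
      by (simp add: S_def scalar_curvature_def form_endo_def trace_def transpose_def G_def)
    show ?thesis
      unfolding trace_R[of 0]
      by (rule Lim_transform_eventually[OF lim])
         (use ev in \<open>eventually_elim, simp add: M_def trace_R ricci\<close>)
  qed
  have S_eq': "S \<tau> c x = S \<tau> c' x'"
    if cx: "c \<in> A" "x \<in> fst c" "c' \<in> A" "x' \<in> fst c'" and \<tau>: "\<tau> \<in> {0..<\<epsilon>}" for c x c' x' \<tau>
  proof (cases "\<tau> = 0")
    case True
    have ev: "eventually (\<lambda>\<tau>. \<tau> \<in> {0<..<\<epsilon>}) (at_right 0)"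
      using assms(1) by (auto simp: eventually_at_right_field)
    have "((\<lambda>\<tau>. S \<tau> c x) \<longlongrightarrow> S 0 c' x') (at_right 0)"
      by (rule Lim_transform_eventually[OF S_lim[OF cx(3,4)]])
         (use ev in \<open>eventually_elim, use S_eq[OF cx] in simp\<close>)
    then show ?thesis using S_lim[OF cx(1,2)] tendsto_unique[of "at_right (0::real)"] True by auto
  qed (use \<tau> S_eq[OF cx] in auto)
  \<comment> \<open>The scalar curvature is complex by type, while a real constant is sought. For
    positive \<open>\<tau>\<close> the profile formula is real, and at 0 the value is a limit of
    reals.\<close>
  have S_real: "S \<tau> c x \<in> \<real>" if cx: "c \<in> A" "x \<in> fst c" and \<tau>: "\<tau> \<in> {0..<\<epsilon>}" for c x \<tau>
  proof (cases "\<tau> = 0")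
    case True
    have "eventually (\<lambda>\<tau>. \<tau> \<in> {0<..<\<epsilon>}) (at_right 0)"
      using assms(1) by (auto simp: eventually_at_right_field)
    then have "eventually (\<lambda>\<tau>. S \<tau> c x \<in> \<real>) (at_right 0)"
      by eventually_elim (simp only: S_def R1[OF cx] Reals_of_real)
    then show ?thesis
      using Lim_in_closed_set[OF closed_complex_Reals _ _ S_lim[OF cx]] True by simp
  qed (use \<tau> R1[OF cx] in \<open>auto simp: S_def simp del: of_real_add\<close>)
  show ?thesis
    unfolding sigma_constant_def Let_def
  proof (intro conjI ballI allI)
    fix c c' x x' l assume cx: "c \<in> A" "c' \<in> A" "x \<in> fst c" "x' \<in> fst c'"
    show "mat_eigenvalue (form_endo (g c (snd c x)) (curvature_form L p T r c (snd c x))) l =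
      mat_eigenvalue (form_endo (g c' (snd c' x')) (curvature_form L p T r c' (snd c' x'))) l"
      unfolding mat_eigenvalue_iff_root char_poly[OF cx(1,3,2,4)] ..
    show "order l (mat_char_poly (form_endo (g c (snd c x)) (curvature_form L p T r c (snd c x)))) =
      order l (mat_char_poly (form_endo (g c' (snd c' x')) (curvature_form L p T r c' (snd c' x'))))"
      unfolding char_poly[OF cx(1,3,2,4)] ..
  next
    fix \<tau> assume \<tau>: "\<tau> \<in> {0..<\<epsilon>}"
    show "\<exists>k::real. \<forall>c\<in>A. \<forall>x\<in>fst c. scalar_curvature (base_metric g L p T r \<tau> c) (snd c x) = complex_of_real k"
    \<comment> \<open>A nonempty chart supplies the value of \<open>k\<close>; without one the
      condition is vacuous.\<close>
    proof (cases "\<exists>c\<in>A. fst c \<noteq> {}")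
      case True
      then obtain c0 x0 where c0: "c0 \<in> A" "x0 \<in> fst c0" by auto
      obtain k where "S \<tau> c0 x0 = of_real k" using S_real[OF c0 \<tau>] by (rule Reals_cases)
      then have "S \<tau> c x = of_real k" if "c \<in> A" "x \<in> fst c" for c x
        using S_eq'[OF that c0 \<tau>] by simp
      then show ?thesis unfolding S_def by blast
    qed auto
  qed
qed

end
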